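(* Let $n\ge3$. A $1$-generic immersion $f:I\to\mathbb{Q}_n$ is a conformal geodesic if and only if $$\frac{d\mu_1}{ds}+\frac32\,\frac{d|X|^2}{ds}=0\qquad\text{and}\qquad \frac{\nabla^2X}{ds^2}-X\big(|X|^2+2\mu_1\big)=0 \quad\text{on } I .$$
   Context: On $\mathbb{R}^{n+2}$ (coordinates $0,\dots,n+1$) take $\langle v,w\rangle=\sum_{A=1}^nv^Aw^A-v^0w^{n+1}-v^{n+1}w^0$; $\mathbb{Q}_n$ is its projectivized null cone and $\mathrm{M\ddot{o}b}(n)$ the identity component of its isometry group. A frame along an immersion $f:I\to\mathbb{Q}_n$ is a smooth $e=(e_0|\dots|e_{n+1})$ from an open subset of $I$ into $\mathrm{M\ddot{o}b}(n)$ with $[e_0]=f$; $\phi=e^{-1}de$, i.e. $de_b=\sum_a\phi^a_be_a$. Indices $2\le\alpha\le n$, $3\le b,c\le n$. Second order frames satisfy $\phi^\alpha_0=\phi^\alpha_1=0$; writing $\phi^0_\alpha=p^\alpha\phi^1_0$, $f$ is 1-generic if $\sum_\alpha(p^\alpha)^2\ne0$ everywhere, and the conformal arclength $ds=(\sum_\alpha(p^\alpha)^2)^{1/4}\phi^1_0$ is frame independent. Special third order frames (which exist locally for 1-generic $f$) are second order frames with $\phi^1_0=\phi^0_2=ds$, $\phi^0_b=0$, $\phi^0_0=0$; any two differ by a rotation of $e_3,\dots,e_n$ by an $SO(n-2)$-valued function. In such a frame write $\phi^0_1=\mu_1ds$ and $\phi^b_2=q^bds$; the function $\mu_1$ and the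 section $X=\sum_bq^be_b$ of the bundle $\Theta=\mathrm{span}\{e_3,\dots,e_n\}$ are frame independent. $\Theta$ has the metric making $\{e_b\}$ orthonormal (norm $|\cdot|$) and connection $\nabla e_b=\sum_c\phi^c_be_c$; $\nabla X/ds$, $\nabla^2X/ds^2$ are covariant derivatives along $d/ds$. A 1-generic $f$ is a conformal geodesic if for every compact subinterval $D\subset I$ and every smooth variation $f_t$ ($|t|<\varepsilon$) through immersions with $f_0=f$ and $f_t=f$ outside a compact subset of the interior of $D$, one has $\frac{d}{dt}\big|_{t=0}\int_D ds_t=0$, $ds_t$ being the conformal arclength of $f_t$. *)

theory Defs
  imports "HOL-Analysis.Analysis"
begin

text \<open>Concrete coordinate model. Vectors of R^(n+2) are functions nat => real
supported on indices 0..n+1; matrices are nat => nat => real supported on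
{0..n+1} x {0..n+1}; column b of a matrix M is the vector (%a. M a b).\<close>

definition vsupp :: "nat \<Rightarrow> (nat \<Rightarrow> real) \<Rightarrow> bool" where
  "vsupp n v \<longleftrightarrow> (\<forall>i\<ge>n+2. v i = 0)"

definition msupp :: "nat \<Rightarrow> (nat \<Rightarrow> nat \<Rightarrow> real) \<Rightarrow> bool" where
  "msupp n M \<longleftrightarrow> (\<forall>i j. (i \<ge> n+2 \<or> j \<ge> n+2) \<longrightarrow> M i j = 0)"

definition bil :: "nat \<Rightarrow> (nat \<Rightarrow> real) \<Rightarrow> (nat \<Rightarrow> real) \<Rightarrow> real" where
  "bil n v w = (\<Sum>A=1..n. v A * w A) - v 0 * w (n+1) - v (n+1) * w 0"

definition col :: "(nat \<Rightarrow> nat \<Rightarrow> real) \<Rightarrow> nat \<Rightarrow> (nat \<Rightarrow> real)" where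
  "col M b = (\<lambda>a. M a b)"

definition unitv :: "nat \<Rightarrow> (nat \<Rightarrow> real)" where
  "unitv j = (\<lambda>i. if i = j then 1 else 0)"

definition Jm :: "nat \<Rightarrow> nat \<Rightarrow> nat \<Rightarrow> real" where
  "Jm n a b = bil n (unitv a) (unitv b)"

definition idm :: "nat \<Rightarrow> nat \<Rightarrow> nat \<Rightarrow> real" where
  "idm n a b = (if a = b \<and> a < n+2 then 1 else 0)"

definition isom :: "nat \<Rightarrow> (nat \<Rightarrow> nat \<Rightarrow> real) \<Rightarrow> bool" where
  "isom n M \<longleftrightarrow> msupp n M \<and>
     (\<forall>j<n+2. \<forall>k<n+2. bil n (col M j) (col M k) = Jm n j k)"

text \<open>Mob(n): identity component of the isometry group (path component of the
identity inside the group, which for a Lie group is the identity component).\<close>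
definition Mob :: "nat \<Rightarrow> (nat \<Rightarrow> nat \<Rightarrow> real) set" where
  "Mob n = {M. \<exists>\<gamma> :: real \<Rightarrow> nat \<Rightarrow> nat \<Rightarrow> real.
      (\<forall>i j. continuous_on {0..1} (\<lambda>t. \<gamma> t i j)) \<and>
      (\<forall>t\<in>{0..1}. isom n (\<gamma> t)) \<and> \<gamma> 0 = idm n \<and> \<gamma> 1 = M}"

text \<open>Projective class [v] of a vector (a point of Q_n when v is nonzero and null).\<close>
definition proj :: "(nat \<Rightarrow> real) \<Rightarrow> (nat \<Rightarrow> real) set" where
  "proj v = {(\<lambda>i. c * v i) | c. c \<noteq> 0}"

definition nullvec :: "nat \<Rightarrow> (nat \<Rightarrow> real) \<Rightarrow> bool" where
  "nullvec n v \<longleftrightarrow> vsupp n v \<and> v \<noteq> (\<lambda>_. 0) \<and> bil n v v = 0"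

definition smooth_on_R :: "real set \<Rightarrow> (real \<Rightarrow> real) \<Rightarrow> bool" where
  "smooth_on_R U g \<longleftrightarrow> (\<exists>D :: nat \<Rightarrow> real \<Rightarrow> real.
      (\<forall>x\<in>U. D 0 x = g x) \<and>
      (\<forall>k. \<forall>x\<in>U. (D k has_real_derivative D (Suc k) x) (at x)))"

definition smooth_on_R2 :: "(real \<times> real) set \<Rightarrow> (real \<Rightarrow> real \<Rightarrow> real) \<Rightarrow> bool" where
  "smooth_on_R2 W g \<longleftrightarrow> (\<exists>D :: nat \<Rightarrow> nat \<Rightarrow> real \<Rightarrow> real \<Rightarrow> real.
      (\<forall>(t,x)\<in>W. D 0 0 t x = g t x) \<and>
      (\<forall>i j. continuous_on W (\<lambda>(t,x). D i j t x)) \<and>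
      (\<forall>i j. \<forall>(t,x)\<in>W.
          ((\<lambda>s. D i j s x) has_real_derivative D (Suc i) j t x) (at t) \<and>
          ((\<lambda>y. D i j t y) has_real_derivative D i (Suc j) t x) (at x)))"

text \<open>A curve f : I -> Q_n (points of Q_n represented as projective classes)
is a smooth immersion if locally it has a smooth null lift F with
F, F' linearly independent.\<close>
definition immersion :: "nat \<Rightarrow> real set \<Rightarrow> (real \<Rightarrow> (nat \<Rightarrow> real) set) \<Rightarrow> bool" where
  "immersion n I f \<longleftrightarrow> (\<forall>x\<in>I. \<exists>U F. open U \<and> x \<in> U \<and> U \<subseteq> I \<and>
      (\<forall>i. smooth_on_R U (\<lambda>y. F y i)) \<and>
      (\<forall>y\<in>U. nullvec n (F y) \<and> proj (F y) = f y \<and>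
         (\<forall>c. (\<lambda>i. deriv (\<lambda>z. F z i) y) \<noteq> (\<lambda>i. c * F y i))))"

text \<open>Maurer-Cartan form of a frame e along the parameter:
de_b = sum_a phi^a_b e_a, so phi^a_b = sum_d J_ad <e_d, de_b> (J^2 = 1);
phi^a_b is identified with its coefficient with respect to dx.\<close>
definition phi :: "nat \<Rightarrow> (real \<Rightarrow> nat \<Rightarrow> nat \<Rightarrow> real) \<Rightarrow> nat \<Rightarrow> nat \<Rightarrow> real \<Rightarrow> real" where
  "phi n e a b x = (\<Sum>d<n+2. Jm n a d *
       bil n (col (e x) d) (\<lambda>i. deriv (\<lambda>y. e y i b) x))"

definition frame :: "nat \<Rightarrow> real set \<Rightarrow> (real \<Rightarrow> (nat \<Rightarrow> real) set) \<Rightarrow> real set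
    \<Rightarrow> (real \<Rightarrow> nat \<Rightarrow> nat \<Rightarrow> real) \<Rightarrow> bool" where
  "frame n I f U e \<longleftrightarrow> open U \<and> U \<subseteq> I \<and>
     (\<forall>i j. smooth_on_R U (\<lambda>x. e x i j)) \<and>
     (\<forall>x\<in>U. e x \<in> Mob n \<and> proj (col (e x) 0) = f x)"

definition second_order_frame :: "nat \<Rightarrow> real set \<Rightarrow> (real \<Rightarrow> (nat \<Rightarrow> real) set) \<Rightarrow> real set
    \<Rightarrow> (real \<Rightarrow> nat \<Rightarrow> nat \<Rightarrow> real) \<Rightarrow> bool" where
  "second_order_frame n I f U e \<longleftrightarrow> frame n I f U e \<and>
     (\<forall>x\<in>U. \<forall>\<alpha>\<in>{2..n}. phi n e \<alpha> 0 x = 0 \<and> phi n e \<alpha> 1 x = 0)"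

definition pcoef :: "nat \<Rightarrow> (real \<Rightarrow> nat \<Rightarrow> nat \<Rightarrow> real) \<Rightarrow> nat \<Rightarrow> real \<Rightarrow> real" where
  "pcoef n e \<alpha> x = phi n e 0 \<alpha> x / phi n e 1 0 x"

text \<open>Coefficient of the conformal arclength element ds w.r.t. dx, computed in a
second order frame (taken positive, i.e. oriented by the parameter).\<close>
definition dens :: "nat \<Rightarrow> (real \<Rightarrow> nat \<Rightarrow> nat \<Rightarrow> real) \<Rightarrow> real \<Rightarrow> real" where
  "dens n e x = (\<Sum>\<alpha>=2..n. (pcoef n e \<alpha> x)^2) powr (1/4) * \<bar>phi n e 1 0 x\<bar>"

definition one_generic :: "nat \<Rightarrow> real set \<Rightarrow> (real \<Rightarrow> (nat \<Rightarrow> real) set) \<Rightarrow> bool" where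
  "one_generic n I f \<longleftrightarrow> immersion n I f \<and>
     (\<forall>U e x. second_order_frame n I f U e \<and> x \<in> U \<longrightarrow>
        (\<Sum>\<alpha>=2..n. (pcoef n e \<alpha> x)^2) \<noteq> 0)"

text \<open>The (frame independent) conformal arclength density of f at x.\<close>
definition arclen :: "nat \<Rightarrow> real set \<Rightarrow> (real \<Rightarrow> (nat \<Rightarrow> real) set) \<Rightarrow> real \<Rightarrow> real" where
  "arclen n I f x = (SOME s. \<exists>U e. x \<in> U \<and> second_order_frame n I f U e \<and> s = dens n e x)"

definition special_third_order_frame :: "nat \<Rightarrow> real set \<Rightarrow> (real \<Rightarrow> (nat \<Rightarrow> real) set) \<Rightarrow> real set
    \<Rightarrow> (real \<Rightarrow> nat \<Rightarrow> nat \<Rightarrow> real) \<Rightarrow> bool" where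
  "special_third_order_frame n I f U e \<longleftrightarrow> second_order_frame n I f U e \<and>
     (\<forall>x\<in>U. phi n e 1 0 x = dens n e x \<and> phi n e 0 2 x = dens n e x \<and>
        (\<forall>b\<in>{3..n}. phi n e 0 b x = 0) \<and> phi n e 0 0 x = 0)"

definition admissible_variation :: "nat \<Rightarrow> real set \<Rightarrow> (real \<Rightarrow> (nat \<Rightarrow> real) set) \<Rightarrow> real set
    \<Rightarrow> real \<Rightarrow> (real \<Rightarrow> real \<Rightarrow> (nat \<Rightarrow> real) set) \<Rightarrow> bool" where
  "admissible_variation n I f D \<epsilon> ft \<longleftrightarrow> \<epsilon> > 0 \<and>
     (\<forall>p\<in>{-\<epsilon><..<\<epsilon>} \<times> I. \<exists>W G. open W \<and> p \<in> W \<and> W \<subseteq> {-\<epsilon><..<\<epsilon>} \<times> I \<and>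
        (\<forall>i. smooth_on_R2 W (\<lambda>t y. G t y i)) \<and>
        (\<forall>(t,y)\<in>W. nullvec n (G t y) \<and> proj (G t y) = ft t y)) \<and>
     (\<forall>t\<in>{-\<epsilon><..<\<epsilon>}. immersion n I (ft t)) \<and>
     (\<forall>x\<in>I. ft 0 x = f x) \<and>
     (\<exists>K. compact K \<and> K \<subseteq> interior D \<and>
        (\<forall>t\<in>{-\<epsilon><..<\<epsilon>}. \<forall>x\<in>I - K. ft t x = f x))"

definition conformal_geodesic :: "nat \<Rightarrow> real set \<Rightarrow> (real \<Rightarrow> (nat \<Rightarrow> real) set) \<Rightarrow> bool" where
  "conformal_geodesic n I f \<longleftrightarrow> one_generic n I f \<and>
     (\<forall>a b \<epsilon> ft. a \<le> b \<and> {a..b} \<subseteq> I \<and> admissible_variation n I f {a..b} \<epsilon> ft \<longrightarrow>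
        ((\<lambda>t. integral {a..b} (\<lambda>x. arclen n I (ft t) x)) has_real_derivative 0) (at 0))"

text \<open>Invariants in a special third order frame (where phi^1_0 = ds):
mu_1, the components q^b of X, the connection coefficients, d/ds,
and the components of nabla X/ds and nabla^2 X/ds^2.\<close>
definition mu1 :: "nat \<Rightarrow> (real \<Rightarrow> nat \<Rightarrow> nat \<Rightarrow> real) \<Rightarrow> real \<Rightarrow> real" where
  "mu1 n e x = phi n e 0 1 x / phi n e 1 0 x"

definition qX :: "nat \<Rightarrow> (real \<Rightarrow> nat \<Rightarrow> nat \<Rightarrow> real) \<Rightarrow> nat \<Rightarrow> real \<Rightarrow> real" where
  "qX n e b x = phi n e b 2 x / phi n e 1 0 x"

definition conn :: "nat \<Rightarrow> (real \<Rightarrow> nat \<Rightarrow> nat \<Rightarrow> real) \<Rightarrow> nat \<Rightarrow> nat \<Rightarrow> real \<Rightarrow> real" where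
  "conn n e c b x = phi n e c b x / phi n e 1 0 x"

definition dds :: "nat \<Rightarrow> (real \<Rightarrow> nat \<Rightarrow> nat \<Rightarrow> real) \<Rightarrow> (real \<Rightarrow> real) \<Rightarrow> real \<Rightarrow> real" where
  "dds n e g x = deriv g x / phi n e 1 0 x"

definition normX2 :: "nat \<Rightarrow> (real \<Rightarrow> nat \<Rightarrow> nat \<Rightarrow> real) \<Rightarrow> real \<Rightarrow> real" where
  "normX2 n e x = (\<Sum>b=3..n. (qX n e b x)^2)"

definition nablaX :: "nat \<Rightarrow> (real \<Rightarrow> nat \<Rightarrow> nat \<Rightarrow> real) \<Rightarrow> nat \<Rightarrow> real \<Rightarrow> real" where
  "nablaX n e c x = dds n e (qX n e c) x + (\<Sum>b=3..n. qX n e b x * conn n e c b x)"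

definition nabla2X :: "nat \<Rightarrow> (real \<Rightarrow> nat \<Rightarrow> nat \<Rightarrow> real) \<Rightarrow> nat \<Rightarrow> real \<Rightarrow> real" where
  "nabla2X n e c x = dds n e (nablaX n e c) x + (\<Sum>b=3..n. nablaX n e b x * conn n e c b x)"

end

theory Submission
  imports Defs "Jordan_Normal_Form.Determinant"
begin

text \<open>
For a null lift \<open>F\<close> of a curve the conformal arclength is
\<open>ds\<^sup>4 = - det Gram(F, F', F'', F''') / \<langle>F', F'\<rangle>\<^sup>4 dx\<^sup>4\<close>. The right-hand side is unchanged when the lift is
rescaled or the parameter changed, because both act on the jet by triangular substitutions, and in a second
order frame it is the defining expression.

Let \<open>D = d/ds\<close> and let \<open>v\<close> be the velocity of a variation, measured in the lift \<open>e\<^sub>0\<close> of a special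
frame. Expanding the Gram determinant around the frame \<open>e\<^sub>0, e\<^sub>1, e\<^sub>n\<^sub>+\<^sub>1, e\<^sub>2\<close> and integrating by parts,
the variation of \<open>ds\<close> is \<open>\<langle>v, E\<rangle> ds / 2\<close> plus an exact form, where
\<open>E = e\<^sub>n\<^sub>+\<^sub>1 - D\<^sup>3e\<^sub>2 + (D\<mu>\<^sub>1)e\<^sub>2 + 2\<mu>\<^sub>1De\<^sub>2\<close>. By the structure equations \<open>E\<close> is, modulo \<open>e\<^sub>0\<close>,
the first Euler-Lagrange expression times \<open>e\<^sub>2\<close> minus the second one, and \<open>\<langle>v, e\<^sub>0\<rangle> = 0\<close>. This gives
one direction; for the other, the null variations \<open>e\<^sub>0 + t h e\<^sub>b + t\<^sup>2 h\<^sup>2 e\<^sub>n\<^sub>+\<^sub>1 / 2\<close> with a bump function \<open>h\<close>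
and \<open>2 \<le> b \<le> n\<close> single out the components of \<open>E\<close>.
\<close>

text \<open>Two obstacles shape the proof. A variation carries no smooth family of frames, and
  \<open>arclen\<close> merely chooses some frame at each point; the Gram formula replaces the
  choice by an explicit function of the 3-jet of any null lift, which can be differentiated in t.
  Moreover, full frames with values in \<open>Mob n\<close> are constructed only locally, while a
  variation lives on an arbitrary compact interval. But the four columns 0, 1, n+1, 2 are obtained
  from the lift by differentiation alone and exist on all of I. The first variation is computed with
  them, and a full frame is needed only near one point at a time, to identify E. The sign in the
  Gram formula comes from the null pair e_0, e_{n+1}, whose plane has signature (1,1). Linearising
  the formula at the frame gives twice the Lagrangian \<open>lagr\<close>, and the fourth root
  contributes 1/4: this is the factor 1/2 in front of E. The function \<mu>_1 enters as the
  correction that makes e_{n+1} null.\<close>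

hide_const (open) Matrix.col
hide_fact (open) Matrix.col_def

subsection \<open>Smooth functions of one variable\<close>

text \<open>The derivative sequence in \<open>smooth_on_R\<close> offers nothing to induct on: a
  product would need the whole Leibniz formula. Counting derivatives one at a time gives closure
  under the operations by induction on the order, with the function generalised.\<close>

primrec times_diff :: "nat \<Rightarrow> real set \<Rightarrow> (real \<Rightarrow> real) \<Rightarrow> bool" where
  "times_diff 0 U g \<longleftrightarrow> True"
| "times_diff (Suc k) U g \<longleftrightarrow>
     (\<exists>g'. (\<forall>x\<in>U. (g has_real_derivative g' x) (at x)) \<and> times_diff k U g')"

lemma DERIV_transform_open:
  assumes "open U" "x \<in> U" "\<And>y. y \<in> U \<Longrightarrow> g y = h y" "(g has_real_derivative d) (at x)"
  shows "(h has_real_derivative d) (at x)"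
  using DERIV_cong_ev[of x x g h d d] assms eventually_nhds by blast

lemma times_diff_cong:
  assumes "open U" "\<And>x. x \<in> U \<Longrightarrow> g x = h x" "times_diff k U g"
  shows "times_diff k U h"
proof (cases k)
  case (Suc m)
  then obtain g' where "\<forall>x\<in>U. (g has_real_derivative g' x) (at x)" "times_diff m U g'"
    using assms(3) by auto
  then have "\<forall>x\<in>U. (h has_real_derivative g' x) (at x)" "times_diff m U g'"
    using DERIV_transform_open[OF assms(1) _ assms(2)] by auto
  then show ?thesis using Suc by auto
qed simp

lemma times_diff_Suc_D: "times_diff (Suc k) U g \<Longrightarrow> times_diff k U g"
proof (induction k arbitrary: g)
  case (Suc k)
  then show ?case by (metis times_diff.simps(2))
qed simp

text \<open>Replaces the existential derivative by the canonical \<open>deriv\<close>, which does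
  not depend on the neighbourhood. This allows local witnesses to be glued and derivatives to be
  iterated.\<close>

lemma times_diff_Suc_deriv:
  assumes "open U"
  shows "times_diff (Suc k) U g \<longleftrightarrow>
    (\<forall>x\<in>U. (g has_real_derivative deriv g x) (at x)) \<and> times_diff k U (deriv g)"
proof
  assume "times_diff (Suc k) U g"
  then obtain g' where g: "\<forall>x\<in>U. (g has_real_derivative g' x) (at x)" "times_diff k U g'" by auto
  then have "\<And>x. x \<in> U \<Longrightarrow> g' x = deriv g x" using DERIV_imp_deriv by (metis)
  then show "(\<forall>x\<in>U. (g has_real_derivative deriv g x) (at x)) \<and> times_diff k U (deriv g)"
    using g times_diff_cong[OF assms, of g' "deriv g"] by auto
qed auto

lemma times_diff_local:
  assumes "open U" "\<And>x. x \<in> U \<Longrightarrow> \<exists>V. open V \<and> x \<in> V \<and> times_diff k V g"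
  shows "times_diff k U g"
  using assms(2)
proof (induction k arbitrary: g)
  case (Suc k)
  have "\<exists>V. open V \<and> x \<in> V \<and> times_diff k V (deriv g)" if "x \<in> U" for x
    using Suc.prems[OF that] times_diff_Suc_deriv[of _ k g] by auto
  then have "times_diff k U (deriv g)" using Suc.IH by blast
  moreover have "(g has_real_derivative deriv g x) (at x)" if "x \<in> U" for x
    using Suc.prems[OF that] times_diff_Suc_deriv[of _ k g] by auto
  ultimately show ?case using times_diff_Suc_deriv[OF assms(1)] by simp
qed simp

lemma smooth_on_R_iff:
  assumes "open U"
  shows "smooth_on_R U g \<longleftrightarrow> (\<forall>k. times_diff k U g)"
proof
  assume "smooth_on_R U g"
  then obtain D where D: "\<forall>x\<in>U. D 0 x = g x"
    "\<And>k x. x \<in> U \<Longrightarrow> (D k has_real_derivative D (Suc k) x) (at x)"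
    unfolding smooth_on_R_def by blast
  have "times_diff k U (D m)" for k m
  proof (induction k arbitrary: m)
    case (Suc k)
    then show ?case using D(2) by (auto intro!: exI[of _ "D (Suc m)"])
  qed simp
  then show "\<forall>k. times_diff k U g" using D times_diff_cong[OF assms, of "D 0" g] by blast
next
  assume *: "\<forall>k. times_diff k U g"
  have "\<forall>k. times_diff k U ((deriv ^^ m) g)" for m
  proof (induction m)
    case (Suc m)
    then show ?case using times_diff_Suc_deriv[OF assms, of _ "(deriv ^^ m) g"] by auto
  qed (use * in auto)
  then have "\<forall>x\<in>U. ((deriv ^^ m) g has_real_derivative (deriv ^^ Suc m) g x) (at x)" for m
    using times_diff_Suc_deriv[OF assms, of _ "(deriv ^^ m) g"] by auto
  then show "smooth_on_R U g" unfolding smooth_on_R_def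
    by (intro exI[of _ "\<lambda>m. (deriv ^^ m) g"]) auto
qed

lemma times_diff_const: "times_diff k U (\<lambda>x. c)"
  by (induction k arbitrary: c) (auto intro!: exI[of _ "\<lambda>x. 0"] derivative_eq_intros)

lemma times_diff_add:
  "times_diff k U g \<Longrightarrow> times_diff k U h \<Longrightarrow> times_diff k U (\<lambda>x. g x + h x)"
proof (induction k arbitrary: g h)
  case (Suc k)
  then obtain g' h' where "\<forall>x\<in>U. (g has_real_derivative g' x) (at x)" "times_diff k U g'"
    "\<forall>x\<in>U. (h has_real_derivative h' x) (at x)" "times_diff k U h'" by auto
  then show ?case using Suc.IH
    by (auto intro!: exI[of _ "\<lambda>x. g' x + h' x"] derivative_eq_intros)
qed simp

lemma times_diff_mult:
  "times_diff k U g \<Longrightarrow> times_diff k U h \<Longrightarrow> times_diff k U (\<lambda>x. g x * h x)"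
proof (induction k arbitrary: g h)
  case (Suc k)
  then obtain g' h' where *: "\<forall>x\<in>U. (g has_real_derivative g' x) (at x)" "times_diff k U g'"
    "\<forall>x\<in>U. (h has_real_derivative h' x) (at x)" "times_diff k U h'" by auto
  have "times_diff k U (\<lambda>x. g' x * h x + g x * h' x)"
    by (intro times_diff_add Suc.IH * Suc.prems[THEN times_diff_Suc_D])
  then show ?case using *
    by (auto intro!: exI[of _ "\<lambda>x. g' x * h x + g x * h' x"] derivative_eq_intros)
qed simp

lemma times_diff_powr:
  assumes "\<And>x. x \<in> U \<Longrightarrow> g x > 0"
  shows "times_diff k U g \<Longrightarrow> times_diff k U (\<lambda>x. g x powr r)"
proof (induction k arbitrary: r)
  case (Suc k)
  then obtain g' where *: "\<forall>x\<in>U. (g has_real_derivative g' x) (at x)" "times_diff k U g'" by auto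
  have "times_diff k U (\<lambda>x. (r * g x powr (r - 1)) * g' x)"
    by (intro times_diff_mult times_diff_const Suc.IH * times_diff_Suc_D[OF Suc.prems])
  moreover have "((\<lambda>x. g x powr r) has_real_derivative (r * g x powr (r - 1)) * g' x) (at x)"
    if "x \<in> U" for x
    using DERIV_fun_powr[of g "g' x" x r] * assms that by simp
  ultimately show ?case
    by (auto intro!: exI[of _ "\<lambda>x. (r * g x powr (r - 1)) * g' x"])
qed simp

lemma times_diff_inverse:
  assumes "\<And>x. x \<in> U \<Longrightarrow> g x \<noteq> 0"
  shows "times_diff k U g \<Longrightarrow> times_diff k U (\<lambda>x. inverse (g x))"
proof (induction k)
  case (Suc k)
  then obtain g' where *: "\<forall>x\<in>U. (g has_real_derivative g' x) (at x)" "times_diff k U g'" by auto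
  have "times_diff k U (\<lambda>x. (- 1) * (inverse (g x) * g' x * inverse (g x)))"
    by (intro times_diff_mult times_diff_const Suc.IH * times_diff_Suc_D[OF Suc.prems])
  then show ?case using * assms
    by (auto intro!: exI[of _ "\<lambda>x. (- 1) * (inverse (g x) * g' x * inverse (g x))"] derivative_eq_intros)
qed simp

lemma times_diff_affine:
  "times_diff k UNIV g \<Longrightarrow> times_diff k UNIV (\<lambda>x. g (c * x + d))"
proof (induction k arbitrary: g)
  case (Suc k)
  then obtain g' where *: "\<forall>x. (g has_real_derivative g' x) (at x)" "times_diff k UNIV g'" by auto
  have "((\<lambda>x. g (c * x + d)) has_real_derivative c * g' (c * x + d)) (at x)" for x
  proof -
    have "((\<lambda>x. c * x + d) has_real_derivative c) (at x)" by (auto intro!: derivative_eq_intros)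
    from DERIV_chain2[OF *(1)[rule_format] this] show ?thesis by (simp add: mult.commute)
  qed
  then show ?case using Suc.IH[OF *(2)] times_diff_mult[OF times_diff_const]
    by (auto intro!: exI[of _ "\<lambda>x. c * g' (c * x + d)"])
qed simp

lemma smooth_const: "open U \<Longrightarrow> smooth_on_R U (\<lambda>x. c)"
  by (simp add: smooth_on_R_iff times_diff_const)
lemma smooth_add: "open U \<Longrightarrow> smooth_on_R U g \<Longrightarrow> smooth_on_R U h \<Longrightarrow> smooth_on_R U (\<lambda>x. g x + h x)"
  by (simp add: smooth_on_R_iff times_diff_add)
lemma smooth_mult: "open U \<Longrightarrow> smooth_on_R U g \<Longrightarrow> smooth_on_R U h \<Longrightarrow> smooth_on_R U (\<lambda>x. g x * h x)"
  by (simp add: smooth_on_R_iff times_diff_mult)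
lemma smooth_minus: "open U \<Longrightarrow> smooth_on_R U g \<Longrightarrow> smooth_on_R U (\<lambda>x. - g x)"
  using smooth_mult[OF _ smooth_const, of U g "- 1"] by simp
lemma smooth_diff: "open U \<Longrightarrow> smooth_on_R U g \<Longrightarrow> smooth_on_R U h \<Longrightarrow> smooth_on_R U (\<lambda>x. g x - h x)"
  using smooth_add[OF _ _ smooth_minus, of U g h] by simp
lemma smooth_power: "open U \<Longrightarrow> smooth_on_R U g \<Longrightarrow> smooth_on_R U (\<lambda>x. g x ^ k)"
  by (induction k) (simp_all add: smooth_const smooth_mult)
lemma smooth_sum: "open U \<Longrightarrow> (\<And>i. i \<in> A \<Longrightarrow> smooth_on_R U (g i)) \<Longrightarrow> smooth_on_R U (\<lambda>x. \<Sum>i\<in>A. g i x)"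
  by (induction A rule: infinite_finite_induct) (simp_all add: smooth_const smooth_add)
lemma smooth_divide:
  "open U \<Longrightarrow> smooth_on_R U g \<Longrightarrow> smooth_on_R U h \<Longrightarrow> (\<And>x. x \<in> U \<Longrightarrow> h x \<noteq> 0) \<Longrightarrow> smooth_on_R U (\<lambda>x. g x / h x)"
  unfolding divide_inverse
  by (rule smooth_mult) (auto simp: smooth_on_R_iff intro: times_diff_inverse)
lemma smooth_powr:
  "open U \<Longrightarrow> smooth_on_R U g \<Longrightarrow> (\<And>x. x \<in> U \<Longrightarrow> g x > 0) \<Longrightarrow> smooth_on_R U (\<lambda>x. g x powr r)"
  by (auto simp: smooth_on_R_iff intro: times_diff_powr)
lemma smooth_deriv: "open U \<Longrightarrow> smooth_on_R U g \<Longrightarrow> smooth_on_R U (deriv g)"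
  using smooth_on_R_iff[of U] times_diff_Suc_deriv[of U _ g] by auto
lemma smooth_DERIV: "open U \<Longrightarrow> smooth_on_R U g \<Longrightarrow> x \<in> U \<Longrightarrow> (g has_real_derivative deriv g x) (at x)"
  using smooth_on_R_iff[of U] times_diff_Suc_deriv[of U _ g] by auto
lemma smooth_continuous: "open U \<Longrightarrow> smooth_on_R U g \<Longrightarrow> continuous_on U g"
  by (meson DERIV_continuous continuous_at_imp_continuous_on smooth_DERIV)
lemma smooth_cong: "open U \<Longrightarrow> (\<And>x. x \<in> U \<Longrightarrow> g x = h x) \<Longrightarrow> smooth_on_R U g \<Longrightarrow> smooth_on_R U h"
  using smooth_on_R_iff[of U] times_diff_cong[of U g h] by auto
lemma smooth_subset: "smooth_on_R U g \<Longrightarrow> V \<subseteq> U \<Longrightarrow> smooth_on_R V g"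
  unfolding smooth_on_R_def by (elim exE) (rule_tac x = D in exI, auto simp: subset_iff)
lemma smooth_local:
  assumes "open U" "\<And>x. x \<in> U \<Longrightarrow> \<exists>V. open V \<and> x \<in> V \<and> smooth_on_R V g"
  shows "smooth_on_R U g"
  unfolding smooth_on_R_iff[OF assms(1)]
proof
  fix k
  have "\<exists>V. open V \<and> x \<in> V \<and> times_diff k V g" if "x \<in> U" for x
    using assms(2)[OF that] smooth_on_R_iff by auto
  then show "times_diff k U g" by (rule times_diff_local[OF assms(1)])
qed

lemmas smooth_intros = smooth_const smooth_add smooth_mult smooth_minus smooth_diff smooth_power
  smooth_sum smooth_divide smooth_powr smooth_deriv

text \<open>The powers of 1/y are carried along to close the family under differentiation: the
  derivative of member m combines members m+1 and m+2. Smoothness, including at 0, is then one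
  induction for all m at once.\<close>

definition flat_exp :: "nat \<Rightarrow> real \<Rightarrow> real" where
  "flat_exp m y = (if y > 0 then inverse y ^ m * exp (- inverse y) else 0)"

lemma flat_exp_tendsto_0: "(flat_exp m \<longlongrightarrow> 0) (at 0)"
proof -
  have "((\<lambda>y. (inverse y) ^ m / exp (inverse y)) \<longlongrightarrow> (0::real)) (at_right 0)"
    by (rule filterlim_compose[OF tendsto_power_div_exp_0 filterlim_inverse_at_top_right])
  then have r: "(flat_exp m \<longlongrightarrow> 0) (at_right 0)"
  proof (rule Lim_transform_eventually)
    show "\<forall>\<^sub>F y in at_right 0. inverse y ^ m / exp (inverse y) = flat_exp m y"
      using eventually_at_right_less[of 0]
      by eventually_elim (simp add: flat_exp_def exp_minus divide_inverse)
  qed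
  have l: "(flat_exp m \<longlongrightarrow> 0) (at_left 0)"
  proof (rule Lim_transform_eventually[OF tendsto_const])
    show "\<forall>\<^sub>F y in at_left 0. 0 = flat_exp m y"
      unfolding eventually_at_left_field by (auto simp: flat_exp_def intro!: exI[of _ "-1"])
  qed
  show ?thesis using filterlim_split_at[OF l r] .
qed

lemma flat_exp_DERIV:
  "(flat_exp m has_real_derivative flat_exp (m + 2) y - of_nat m * flat_exp (m + 1) y) (at y)"
proof -
  consider "y > 0" | "y < 0" | "y = 0" by linarith
  then show ?thesis
  proof cases
    case 1
    have "((\<lambda>y. inverse y ^ m * exp (- inverse y)) has_real_derivative
       flat_exp (m + 2) y - of_nat m * flat_exp (m + 1) y) (at y)"
    proof -
      have d: "((\<lambda>y. inverse y ^ m * exp (- inverse y)) has_real_derivative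
        (of_nat m * inverse y ^ (m - 1) * (- (inverse y * inverse y))) * exp (- inverse y)
        + inverse y ^ m * (exp (- inverse y) * (inverse y * inverse y))) (at y)"
        using 1 by (auto intro!: derivative_eq_intros simp: power2_eq_square)
      have eq: "of_nat m * inverse y ^ (m - 1) * (- (inverse y * inverse y))
        = - of_nat m * inverse y ^ (m + 1)" by (cases m) (auto simp: algebra_simps)
      show ?thesis using d unfolding eq using 1 by (simp add: flat_exp_def algebra_simps power2_eq_square)
    qed
    then show ?thesis
      using DERIV_transform_open[of "{0<..}" y "\<lambda>y. inverse y ^ m * exp (- inverse y)" "flat_exp m"] 1
      by (auto simp: flat_exp_def)
  next
    case 2
    then show ?thesis
      using DERIV_transform_open[of "{..<0}" y "\<lambda>y. 0" "flat_exp m" 0]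
      by (auto simp: flat_exp_def)
  next
    case 3
    \<comment> \<open>The difference quotient of member m at 0 is member m+1, which tends to
      0.\<close>
    have "((\<lambda>h. (flat_exp m (0 + h) - flat_exp m 0) / h) \<longlongrightarrow> 0) (at 0)"
      by (rule Lim_transform_eventually[OF flat_exp_tendsto_0[of "Suc m"]])
         (simp add: flat_exp_def divide_inverse always_eventually)
    then show ?thesis using 3 by (simp add: DERIV_def flat_exp_def)
  qed
qed

lemma times_diff_flat_exp: "times_diff k UNIV (flat_exp m)"
proof (induction k arbitrary: m)
  case (Suc k)
  have "times_diff k UNIV (\<lambda>y. flat_exp (m + 2) y + (- of_nat m) * flat_exp (m + 1) y)"
    by (intro times_diff_add times_diff_mult times_diff_const Suc)
  then show ?case using flat_exp_DERIV[of m]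
    by (auto intro!: exI[of _ "\<lambda>y. flat_exp (m + 2) y - of_nat m * flat_exp (m + 1) y"])
qed simp

lemma smooth_bump:
  fixes a b :: real
  obtains h where "smooth_on_R UNIV h" "\<And>x. h x \<ge> 0"
    "\<And>x. h x > 0 \<longleftrightarrow> a < x \<and> x < b" "\<And>x. h x \<noteq> 0 \<Longrightarrow> x \<in> {a..b}"
proof
  let ?h = "\<lambda>x. flat_exp 0 (1 * x + (- a)) * flat_exp 0 ((- 1) * x + b)"
  show "smooth_on_R UNIV ?h"
    unfolding smooth_on_R_iff[OF open_UNIV]
    by (intro allI times_diff_mult times_diff_affine times_diff_flat_exp)
qed (auto simp: flat_exp_def split: if_splits)

subsection \<open>Partial derivatives in two variables\<close>

text \<open>\<open>smooth_on_R2\<close> indexes derivatives by a pair of orders, which builds in the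
  symmetry of mixed partials. Here the two partials are independent functions, so that products and
  inverses are handled by induction; the symmetry is recovered by \<open>mixed_partials\<close>.
  Joint continuity at every order serves differentiation under the integral.\<close>

primrec times_diff2 :: "nat \<Rightarrow> (real \<times> real) set \<Rightarrow> (real \<Rightarrow> real \<Rightarrow> real) \<Rightarrow> bool" where
  "times_diff2 0 W g \<longleftrightarrow> continuous_on W (\<lambda>(t,x). g t x)"
| "times_diff2 (Suc k) W g \<longleftrightarrow> continuous_on W (\<lambda>(t,x). g t x) \<and>
     (\<exists>gt gx. (\<forall>(t,x)\<in>W. ((\<lambda>s. g s x) has_real_derivative gt t x) (at t) \<and>
          ((\<lambda>y. g t y) has_real_derivative gx t x) (at x)) \<and>
        times_diff2 k W gt \<and> times_diff2 k W gx)"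

lemma open_slices:
  assumes "open (W :: (real \<times> real) set)"
  shows "open {s. (s, x) \<in> W}" "open {y. (t, y) \<in> W}"
proof -
  have "open ((\<lambda>s. (s, x)) -` W)" "open ((\<lambda>y. (t, y)) -` W)"
    by (intro open_vimage assms continuous_intros)+
  then show "open {s. (s, x) \<in> W}" "open {y. (t, y) \<in> W}" by (simp_all add: vimage_def)
qed

lemma times_diff2_continuous: "times_diff2 k W g \<Longrightarrow> continuous_on W (\<lambda>(t,x). g t x)"
  by (cases k) auto

lemma times_diff2_SucI:
  assumes "continuous_on W (\<lambda>(t,x). g t x)"
    "\<And>t x. (t,x) \<in> W \<Longrightarrow> ((\<lambda>s. g s x) has_real_derivative gt t x) (at t)"
    "\<And>t x. (t,x) \<in> W \<Longrightarrow> ((\<lambda>y. g t y) has_real_derivative gx t x) (at x)"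
    "times_diff2 k W gt" "times_diff2 k W gx"
  shows "times_diff2 (Suc k) W g"
proof -
  have "\<forall>(t,x)\<in>W. ((\<lambda>s. g s x) has_real_derivative gt t x) (at t) \<and>
          ((\<lambda>y. g t y) has_real_derivative gx t x) (at x)" using assms(2,3) by auto
  then show ?thesis using assms(1,4,5) unfolding times_diff2.simps by blast
qed

lemma times_diff2_SucE:
  assumes "times_diff2 (Suc k) W g"
  obtains gt gx where "continuous_on W (\<lambda>(t,x). g t x)"
    "\<And>t x. (t,x) \<in> W \<Longrightarrow> ((\<lambda>s. g s x) has_real_derivative gt t x) (at t)"
    "\<And>t x. (t,x) \<in> W \<Longrightarrow> ((\<lambda>y. g t y) has_real_derivative gx t x) (at x)"
    "times_diff2 k W gt" "times_diff2 k W gx"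
proof -
  from assms obtain gt gx where *: "continuous_on W (\<lambda>(t,x). g t x)"
    "\<forall>(t,x)\<in>W. ((\<lambda>s. g s x) has_real_derivative gt t x) (at t) \<and>
          ((\<lambda>y. g t y) has_real_derivative gx t x) (at x)"
    "times_diff2 k W gt" "times_diff2 k W gx" by auto
  show thesis by (rule that[of gt gx]) (use * in auto)
qed

lemma times_diff2_cong:
  assumes "open W" "\<And>t x. (t,x) \<in> W \<Longrightarrow> g t x = h t x" "times_diff2 k W g"
  shows "times_diff2 k W h"
proof -
  have c: "continuous_on W (\<lambda>(t,x). h t x)"
    using times_diff2_continuous[OF assms(3)] by (rule continuous_on_eq) (use assms(2) in auto)
  show ?thesis
  proof (cases k)
    case (Suc m)
    with assms(3) have "times_diff2 (Suc m) W g" by simp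
    then obtain gt gx where *: "\<And>t x. (t,x) \<in> W \<Longrightarrow> ((\<lambda>s. g s x) has_real_derivative gt t x) (at t)"
      "\<And>t x. (t,x) \<in> W \<Longrightarrow> ((\<lambda>y. g t y) has_real_derivative gx t x) (at x)"
      "times_diff2 m W gt" "times_diff2 m W gx" by (rule times_diff2_SucE) blast
    have "((\<lambda>s. h s x) has_real_derivative gt t x) (at t)" if "(t,x) \<in> W" for t x
      by (rule DERIV_transform_open[OF open_slices(1)[OF assms(1)] _ _ *(1)]) (use that assms(2) in auto)
    moreover have "((\<lambda>y. h t y) has_real_derivative gx t x) (at x)" if "(t,x) \<in> W" for t x
      by (rule DERIV_transform_open[OF open_slices(2)[OF assms(1)] _ _ *(2)]) (use that assms(2) in auto)
    ultimately show ?thesis unfolding Suc using times_diff2_SucI[OF c _ _ *(3,4)] by blast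
  qed (use c in simp)
qed

lemma times_diff2_Suc_D: "times_diff2 (Suc k) W g \<Longrightarrow> times_diff2 k W g"
proof (induction k arbitrary: g)
  case (Suc k)
  from Suc.prems obtain gt gx where *: "continuous_on W (\<lambda>(t,x). g t x)"
    "\<And>t x. (t,x) \<in> W \<Longrightarrow> ((\<lambda>s. g s x) has_real_derivative gt t x) (at t)"
    "\<And>t x. (t,x) \<in> W \<Longrightarrow> ((\<lambda>y. g t y) has_real_derivative gx t x) (at x)"
    "times_diff2 (Suc k) W gt" "times_diff2 (Suc k) W gx" by (rule times_diff2_SucE) blast
  show ?case by (rule times_diff2_SucI[OF *(1-3)]) (use Suc.IH * in blast)+
qed simp

definition partial_t :: "(real \<Rightarrow> real \<Rightarrow> real) \<Rightarrow> real \<Rightarrow> real \<Rightarrow> real" where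
  "partial_t g t x = deriv (\<lambda>s. g s x) t"
definition partial_x :: "(real \<Rightarrow> real \<Rightarrow> real) \<Rightarrow> real \<Rightarrow> real \<Rightarrow> real" where
  "partial_x g t x = deriv (\<lambda>y. g t y) x"

lemma times_diff2_partials:
  assumes "open W" "times_diff2 (Suc k) W g"
  shows "\<And>t x. (t,x) \<in> W \<Longrightarrow> ((\<lambda>s. g s x) has_real_derivative partial_t g t x) (at t)"
    "\<And>t x. (t,x) \<in> W \<Longrightarrow> ((\<lambda>y. g t y) has_real_derivative partial_x g t x) (at x)"
    "times_diff2 k W (partial_t g)" "times_diff2 k W (partial_x g)"
proof -
  from assms(2) obtain gt gx where *: "\<And>t x. (t,x) \<in> W \<Longrightarrow> ((\<lambda>s. g s x) has_real_derivative gt t x) (at t)"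
    "\<And>t x. (t,x) \<in> W \<Longrightarrow> ((\<lambda>y. g t y) has_real_derivative gx t x) (at x)"
    "times_diff2 k W gt" "times_diff2 k W gx" by (rule times_diff2_SucE) blast
  have t: "gt t x = partial_t g t x" and x: "gx t x = partial_x g t x" if "(t,x) \<in> W" for t x
    using *(1,2)[OF that] by (simp_all add: partial_t_def partial_x_def DERIV_imp_deriv)
  show "\<And>t x. (t,x) \<in> W \<Longrightarrow> ((\<lambda>s. g s x) has_real_derivative partial_t g t x) (at t)"
    "\<And>t x. (t,x) \<in> W \<Longrightarrow> ((\<lambda>y. g t y) has_real_derivative partial_x g t x) (at x)"
    using * t x by simp_all
  show "times_diff2 k W (partial_t g)" "times_diff2 k W (partial_x g)"
    using times_diff2_cong[OF assms(1) t *(3)] times_diff2_cong[OF assms(1) x *(4)] by auto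
qed

lemma times_diff2_local:
  assumes "\<And>p. p \<in> W \<Longrightarrow> \<exists>V. open V \<and> p \<in> V \<and> times_diff2 k V g"
  shows "times_diff2 k W g"
  using assms
proof (induction k arbitrary: g)
  have cont: "continuous_on W (\<lambda>(t,x). g t x)"
    if "\<And>p. p \<in> W \<Longrightarrow> \<exists>V. open V \<and> p \<in> V \<and> times_diff2 k V g" for k g
  proof (rule continuous_at_imp_continuous_on, rule ballI)
    fix p assume "p \<in> W"
    with that obtain V where "open V" "p \<in> V" "times_diff2 k V g" by blast
    then show "isCont (\<lambda>(t,x). g t x) p"
      using times_diff2_continuous continuous_on_eq_continuous_at by blast
  qed
  {
    case 0
    show ?case using cont[OF 0] by simp
  next
    case (Suc k)
    have A: "((\<lambda>s. g s x) has_real_derivative partial_t g t x) (at t)"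
      "((\<lambda>y. g t y) has_real_derivative partial_x g t x) (at x)" if "(t,x) \<in> W" for t x
      using Suc.prems[OF that] times_diff2_partials(1,2)[of _ k g _ x] by (auto simp del: times_diff2.simps)
    have "\<exists>V. open V \<and> p \<in> V \<and> times_diff2 k V (partial_t g)"
      "\<exists>V. open V \<and> p \<in> V \<and> times_diff2 k V (partial_x g)" if "p \<in> W" for p
      using Suc.prems[OF that] times_diff2_partials(3,4)[of _ k g] by blast+
    then have B: "times_diff2 k W (partial_t g)" "times_diff2 k W (partial_x g)"
      using Suc.IH by blast+
    show ?case by (rule times_diff2_SucI[OF cont[OF Suc.prems] A B])
  }
qed

lemma smooth_on_R2_times_diff2:
  assumes "open W" "smooth_on_R2 W g"
  shows "times_diff2 k W g"
proof -
  obtain D where D: "\<forall>(t,x)\<in>W. D 0 0 t x = g t x"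
      "\<And>i j. continuous_on W (\<lambda>(t,x). D i j t x)"
      "\<And>i j. \<forall>(t,x)\<in>W.
          ((\<lambda>s. D i j s x) has_real_derivative D (Suc i) j t x) (at t) \<and>
          ((\<lambda>y. D i j t y) has_real_derivative D i (Suc j) t x) (at x)"
    using assms(2) unfolding smooth_on_R2_def by blast
  have "times_diff2 k W (D i j)" for i j
  proof (induction k arbitrary: i j)
    case (Suc k)
    show ?case
      by (rule times_diff2_SucI[OF D(2), where gt = "D (Suc i) j" and gx = "D i (Suc j)"])
         (use D(3)[of i j] Suc in auto)
  qed (use D(2) in simp)
  then show ?thesis by (rule times_diff2_cong[OF assms(1), of "D 0 0" g, rotated]) (use D(1) in auto)
qed

lemma times_diff2_add:
  "times_diff2 k W g \<Longrightarrow> times_diff2 k W h \<Longrightarrow> times_diff2 k W (\<lambda>t x. g t x + h t x)"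
proof (induction k arbitrary: g h)
  case 0
  then show ?case by (auto simp: case_prod_beta intro: continuous_intros)
next
  case (Suc k)
  from Suc.prems(1) obtain gt gx where *: "continuous_on W (\<lambda>(t,x). g t x)"
    "\<And>t x. (t,x) \<in> W \<Longrightarrow> ((\<lambda>s. g s x) has_real_derivative gt t x) (at t)"
    "\<And>t x. (t,x) \<in> W \<Longrightarrow> ((\<lambda>y. g t y) has_real_derivative gx t x) (at x)"
    "times_diff2 k W gt" "times_diff2 k W gx" by (rule times_diff2_SucE) blast
  from Suc.prems(2) obtain ht hx where **: "continuous_on W (\<lambda>(t,x). h t x)"
    "\<And>t x. (t,x) \<in> W \<Longrightarrow> ((\<lambda>s. h s x) has_real_derivative ht t x) (at t)"
    "\<And>t x. (t,x) \<in> W \<Longrightarrow> ((\<lambda>y. h t y) has_real_derivative hx t x) (at x)"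
    "times_diff2 k W ht" "times_diff2 k W hx" by (rule times_diff2_SucE) blast
  show ?case
    by (rule times_diff2_SucI[where gt = "\<lambda>t x. gt t x + ht t x" and gx = "\<lambda>t x. gx t x + hx t x"])
       (use * ** Suc.IH in \<open>auto simp: case_prod_beta intro!: continuous_intros DERIV_add\<close>)
qed

lemma times_diff2_mult:
  "times_diff2 k W g \<Longrightarrow> times_diff2 k W h \<Longrightarrow> times_diff2 k W (\<lambda>t x. g t x * h t x)"
proof (induction k arbitrary: g h)
  case 0
  then show ?case by (auto simp: case_prod_beta intro: continuous_intros)
next
  case (Suc k)
  from Suc.prems(1) obtain gt gx where *: "continuous_on W (\<lambda>(t,x). g t x)"
    "\<And>t x. (t,x) \<in> W \<Longrightarrow> ((\<lambda>s. g s x) has_real_derivative gt t x) (at t)"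
    "\<And>t x. (t,x) \<in> W \<Longrightarrow> ((\<lambda>y. g t y) has_real_derivative gx t x) (at x)"
    "times_diff2 k W gt" "times_diff2 k W gx" by (rule times_diff2_SucE) blast
  from Suc.prems(2) obtain ht hx where **: "continuous_on W (\<lambda>(t,x). h t x)"
    "\<And>t x. (t,x) \<in> W \<Longrightarrow> ((\<lambda>s. h s x) has_real_derivative ht t x) (at t)"
    "\<And>t x. (t,x) \<in> W \<Longrightarrow> ((\<lambda>y. h t y) has_real_derivative hx t x) (at x)"
    "times_diff2 k W ht" "times_diff2 k W hx" by (rule times_diff2_SucE) blast
  note l = Suc.prems[THEN times_diff2_Suc_D]
  show ?case
    by (rule times_diff2_SucI[where gt = "\<lambda>t x. gt t x * h t x + ht t x * g t x"
           and gx = "\<lambda>t x. gx t x * h t x + hx t x * g t x"])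
       (use * ** l in \<open>auto simp: case_prod_beta intro!: continuous_intros DERIV_mult
           times_diff2_add Suc.IH\<close>)
qed

lemma times_diff2_const: "times_diff2 k W (\<lambda>t x. c)"
proof (induction k arbitrary: c)
  case (Suc k)
  show ?case
    by (rule times_diff2_SucI[where gt = "\<lambda>t x. 0" and gx = "\<lambda>t x. 0"])
       (use Suc in \<open>auto intro!: continuous_intros\<close>)
qed auto

lemma times_diff2_inverse:
  assumes "\<And>t x. (t,x) \<in> W \<Longrightarrow> g t x \<noteq> 0"
  shows "times_diff2 k W g \<Longrightarrow> times_diff2 k W (\<lambda>t x. inverse (g t x))"
proof (induction k)
  case 0
  then show ?case using assms by (auto simp: case_prod_beta intro!: continuous_intros)
next
  case (Suc k)
  from Suc.prems obtain gt gx where *: "continuous_on W (\<lambda>(t,x). g t x)"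
    "\<And>t x. (t,x) \<in> W \<Longrightarrow> ((\<lambda>s. g s x) has_real_derivative gt t x) (at t)"
    "\<And>t x. (t,x) \<in> W \<Longrightarrow> ((\<lambda>y. g t y) has_real_derivative gx t x) (at x)"
    "times_diff2 k W gt" "times_diff2 k W gx" by (rule times_diff2_SucE) blast
  note l = Suc.IH[OF Suc.prems[THEN times_diff2_Suc_D]]
  show ?case
  proof (rule times_diff2_SucI[where gt = "\<lambda>t x. (- 1) * (inverse (g t x) * gt t x * inverse (g t x))"
           and gx = "\<lambda>t x. (- 1) * (inverse (g t x) * gx t x * inverse (g t x))"])
    show "continuous_on W (\<lambda>(t,x). inverse (g t x))"
      using * assms by (auto simp: case_prod_beta intro!: continuous_intros)
    show "((\<lambda>s. inverse (g s x)) has_real_derivative (- 1) * (inverse (g t x) * gt t x * inverse (g t x))) (at t)"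
      "((\<lambda>y. inverse (g t y)) has_real_derivative (- 1) * (inverse (g t x) * gx t x * inverse (g t x))) (at x)"
      if "(t,x) \<in> W" for t x
      using *(2,3)[OF that] assms[OF that] by (auto intro!: derivative_eq_intros)
  qed (intro times_diff2_mult times_diff2_const l *)+
qed

lemma integral_representation_DERIV:
  fixes u v :: "real \<Rightarrow> real"
  assumes "a < x" "x < b" "continuous_on {a..b} v"
    "\<And>y. y \<in> {a..b} \<Longrightarrow> u y - u a = integral {a..y} v"
  shows "(u has_real_derivative v x) (at x)"
proof -
  have "((\<lambda>y. integral {a..y} v) has_real_derivative v x) (at x within {a..b})"
    by (rule integral_has_real_derivative[OF assms(3)]) (use assms(1,2) in auto)
  then have "((\<lambda>y. integral {a..y} v) has_real_derivative v x) (at x)"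
    using at_within_interior[of x "{a..b}"] assms(1,2) by simp
  from DERIV_add[OF this DERIV_const[of "u a"]]
  have "((\<lambda>y. integral {a..y} v + u a) has_real_derivative v x) (at x)" by simp
  then show ?thesis
    by (rule DERIV_transform_open[of "{a<..<b}", rotated 3]) (use assms(1,2) in \<open>auto simp flip: assms(4)\<close>)
qed

text \<open>A form of Schwarz's theorem in which one mixed derivative is given and the other is
  produced. The increment of \<open>g\<close> in x is the integral of \<open>gx\<close>;
  differentiating under the integral in t exhibits \<open>gt\<close> as a primitive of
  \<open>gxt\<close>, and the fundamental theorem concludes.\<close>

lemma mixed_partials:
  assumes "open W" "(t0,x0) \<in> W"
    and gt: "\<And>t x. (t,x) \<in> W \<Longrightarrow> ((\<lambda>s. g s x) has_real_derivative gt t x) (at t)"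
    and gx: "\<And>t x. (t,x) \<in> W \<Longrightarrow> ((\<lambda>y. g t y) has_real_derivative gx t x) (at x)"
    and gxt: "\<And>t x. (t,x) \<in> W \<Longrightarrow> ((\<lambda>s. gx s x) has_real_derivative gxt t x) (at t)"
    and cx: "continuous_on W (\<lambda>(t,x). gx t x)"
    and cxt: "continuous_on W (\<lambda>(t,x). gxt t x)"
  shows "((\<lambda>y. gt t0 y) has_real_derivative gxt t0 x0) (at x0)"
proof -
  obtain A B where AB: "open A" "open B" "t0 \<in> A" "x0 \<in> B" "A \<times> B \<subseteq> W"
    using open_prod_elim[OF assms(1,2)] by (metis mem_Sigma_iff)
  obtain r where r: "r > 0" "cball t0 r \<subseteq> A" using AB open_contains_cball by blast
  obtain q where q: "q > 0" "cball x0 q \<subseteq> B" using AB open_contains_cball by blast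
  define T where "T = ball t0 r"
  have sub: "(t,x) \<in> W" if "t \<in> T" "x \<in> {x0-q..x0+q}" for t x
    using that r q AB(5) by (force simp: T_def dist_real_def)
  have eq: "gt t0 y - gt t0 (x0-q) = integral {x0-q..y} (gxt t0)" if y: "y \<in> {x0-q..x0+q}" for y
  proof -
    have c1: "continuous_on {x0-q..y} (gx t)" if "t \<in> T" for t
    proof -
      have "Pair t ` {x0-q..y} \<subseteq> W" using sub that y by auto
      then show ?thesis
        using continuous_on_compose2[OF cx, of "{x0-q..y}" "\<lambda>y. (t,y)"]
        by (simp add: continuous_on_Pair)
    qed
    have 1: "g t y - g t (x0-q) = integral {x0-q..y} (gx t)" if "t \<in> T" for t
    proof -
      have "(gx t has_integral g t y - g t (x0-q)) {x0-q..y}"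
      proof (rule fundamental_theorem_of_calculus)
        show "x0 - q \<le> y" using y by simp
        show "(g t has_vector_derivative gx t z) (at z within {x0-q..y})" if "z \<in> {x0-q..y}" for z
        proof -
          have "(g t has_real_derivative gx t z) (at z)"
            using gx[OF sub[OF \<open>t \<in> T\<close>, of z]] that y by simp
          then show ?thesis
            using has_real_derivative_iff_has_vector_derivative has_field_derivative_at_within by blast
        qed
      qed
      then show ?thesis by (simp add: integral_unique)
    qed
    have "((\<lambda>t. integral (cbox (x0-q) y) (gx t)) has_field_derivative integral (cbox (x0-q) y) (gxt t0)) (at t0 within T)"
    proof (rule leibniz_rule_field_derivative)
      show "((\<lambda>t. gx t x) has_field_derivative gxt t x) (at t within T)"
        if "t \<in> T" "x \<in> cbox (x0-q) y" for t x
        using gxt[OF sub, of t x] that y by (auto intro: has_field_derivative_at_within)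
      show "gx t integrable_on cbox (x0-q) y" if "t \<in> T" for t
        using integrable_continuous_interval[OF c1[OF that]] by simp
      show "continuous_on (T \<times> cbox (x0-q) y) (\<lambda>(x, t). gxt x t)"
        by (rule continuous_on_subset[OF cxt]) (use sub y in auto)
    qed (auto simp: T_def r)
    then have "((\<lambda>t. integral {x0-q..y} (gx t)) has_field_derivative integral {x0-q..y} (gxt t0)) (at t0)"
      using at_within_open[of t0 T] r by (simp add: T_def)
    then have "((\<lambda>t. g t y - g t (x0-q)) has_field_derivative integral {x0-q..y} (gxt t0)) (at t0)"
      by (rule DERIV_transform_open[of T, rotated 3]) (use 1 r in \<open>auto simp: T_def\<close>)
    moreover have "((\<lambda>t. g t y - g t (x0-q)) has_field_derivative gt t0 y - gt t0 (x0-q)) (at t0)"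
      using y q r by (intro DERIV_diff gt sub) (auto simp: T_def)
    ultimately show ?thesis using DERIV_unique by blast
  qed
  have "continuous_on {x0-q..x0+q} (gxt t0)"
  proof -
    have "Pair t0 ` {x0-q..x0+q} \<subseteq> W" using sub r by (auto simp: T_def)
    then show ?thesis
      using continuous_on_compose2[OF cxt, of "{x0-q..x0+q}" "\<lambda>y. (t0,y)"]
      by (simp add: continuous_on_Pair)
  qed
  then show ?thesis by (intro integral_representation_DERIV[OF _ _ _ eq, of x0]) (use q in auto)
qed

subsection \<open>The Lorentzian form and Gram determinants\<close>

lemma bil_commute: "bil n v w = bil n w v"
  by (simp add: bil_def mult.commute)

lemma bil_add_left: "bil n (\<lambda>i. u i + v i) w = bil n u w + bil n v w"
  by (simp add: bil_def algebra_simps sum.distrib)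
lemma bil_diff_left: "bil n (\<lambda>i. u i - v i) w = bil n u w - bil n v w"
  by (simp add: bil_def algebra_simps sum_subtractf)
lemma bil_scale_left: "bil n (\<lambda>i. c * u i) w = c * bil n u w"
  by (simp add: bil_def algebra_simps sum_distrib_left)
lemma bil_zero_left: "bil n (\<lambda>i. 0) w = 0"
  by (simp add: bil_def)
lemma bil_minus_left: "bil n (\<lambda>i. - u i) w = - bil n u w"
  using bil_scale_left[of n "-1" u w] by simp
lemma bil_sum_left: "bil n (\<lambda>i. \<Sum>k\<in>A. u k i) w = (\<Sum>k\<in>A. bil n (u k) w)"
  by (induction A rule: infinite_finite_induct) (simp_all add: bil_zero_left bil_add_left)
lemma bil_divide_left: "bil n (\<lambda>i. u i / c) w = bil n u w / c"
  using bil_scale_left[of n "1/c" u w] by simp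

lemma bil_add_right: "bil n w (\<lambda>i. u i + v i) = bil n w u + bil n w v"
  using bil_add_left bil_commute by metis
lemma bil_diff_right: "bil n w (\<lambda>i. u i - v i) = bil n w u - bil n w v"
  using bil_diff_left bil_commute by metis
lemma bil_scale_right: "bil n w (\<lambda>i. c * u i) = c * bil n w u"
  using bil_scale_left bil_commute by metis
lemma bil_zero_right: "bil n w (\<lambda>i. 0) = 0"
  using bil_zero_left bil_commute by metis
lemma bil_minus_right: "bil n w (\<lambda>i. - u i) = - bil n w u"
  using bil_minus_left bil_commute by metis
lemma bil_sum_right: "bil n w (\<lambda>i. \<Sum>k\<in>A. u k i) = (\<Sum>k\<in>A. bil n w (u k))"
  using bil_sum_left[where n = n and A = A and u = u and w = w] by (simp add: bil_commute[of n w])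
lemma bil_divide_right: "bil n w (\<lambda>i. u i / c) = bil n w u / c"
  using bil_divide_left bil_commute by metis

lemmas bil_simps = bil_add_left bil_diff_left bil_scale_left bil_zero_left bil_minus_left
  bil_sum_left bil_divide_left bil_add_right bil_diff_right bil_scale_right bil_zero_right
  bil_minus_right bil_sum_right bil_divide_right

text \<open>Determinant of the symmetric matrix with rows (a b c d), (b e f g), (c f h i), (d g i
  j), expanded along the first row. As an explicit polynomial it is accessible to
  \<open>algebra\<close> and to the derivative rules.\<close>

definition sym_det4 :: "real \<Rightarrow> real \<Rightarrow> real \<Rightarrow> real \<Rightarrow> real \<Rightarrow> real \<Rightarrow> real \<Rightarrow> real \<Rightarrow> real \<Rightarrow> real \<Rightarrow> real" where
  "sym_det4 a b c d e f g h i j =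
     a * (e * (h * j - i * i) - f * (f * j - i * g) + g * (f * i - h * g))
   - b * (b * (h * j - i * i) - f * (c * j - i * d) + g * (c * i - h * d))
   + c * (b * (f * j - i * g) - e * (c * j - i * d) + g * (c * g - f * d))
   - d * (b * (f * i - h * g) - e * (c * i - h * d) + f * (c * g - f * d))"

definition gram4 :: "nat \<Rightarrow> (nat \<Rightarrow> real) \<Rightarrow> (nat \<Rightarrow> real) \<Rightarrow> (nat \<Rightarrow> real) \<Rightarrow> (nat \<Rightarrow> real) \<Rightarrow> real" where
  "gram4 n u v w z = sym_det4 (bil n u u) (bil n u v) (bil n u w) (bil n u z)
     (bil n v v) (bil n v w) (bil n v z) (bil n w w) (bil n w z) (bil n z z)"

text \<open>A linear substitution multiplies a Gram determinant by the square of its determinant.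
  Triangular substitutions are split into four lemmas, one vector at a time, which keeps the
  polynomial identities small.\<close>

lemma gram4_fst: "gram4 n (\<lambda>i. a * u i) v w z = a\<^sup>2 * gram4 n u v w z"
  unfolding gram4_def sym_det4_def bil_simps by Groebner_Basis.algebra

lemma gram4_snd: "gram4 n u (\<lambda>i. b * u i + a * v i) w z = a\<^sup>2 * gram4 n u v w z"
  unfolding gram4_def sym_det4_def bil_simps bil_commute[of n v u] by Groebner_Basis.algebra

lemma gram4_trd: "gram4 n u v (\<lambda>i. b * u i + c * v i + a * w i) z = a\<^sup>2 * gram4 n u v w z"
  unfolding gram4_def sym_det4_def bil_simps bil_commute[of n v u] bil_commute[of n w u]
    bil_commute[of n w v] by Groebner_Basis.algebra

lemma gram4_fth: "gram4 n u v w (\<lambda>i. b * u i + c * v i + d * w i + a * z i) = a\<^sup>2 * gram4 n u v w z"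
  unfolding gram4_def sym_det4_def bil_simps bil_commute[of n v u] bil_commute[of n w u]
    bil_commute[of n w v] bil_commute[of n z u] bil_commute[of n z v] bil_commute[of n z w] by Groebner_Basis.algebra

text \<open>For a null lift \<open>F\<close> of a curve, \<open>curv4 n F F' F'' F'''\<close> is the fourth power of its conformal
arclength density.\<close>
definition curv4 :: "nat \<Rightarrow> (nat \<Rightarrow> real) \<Rightarrow> (nat \<Rightarrow> real) \<Rightarrow> (nat \<Rightarrow> real) \<Rightarrow> (nat \<Rightarrow> real) \<Rightarrow> real" where
  "curv4 n u v w z = - gram4 n u v w z / (bil n v v)^4"

text \<open>The determinant scales by the squares of the four diagonal entries, and the denominator
  by \<open>a1 ^ 8\<close>, because \<open>u\<close> is orthogonal to itself and to
  \<open>v\<close>. Rescaling a lift by r puts r in all four diagonal places and gives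
  \<open>s = 1\<close>: this is why the exponent in the denominator is 4.\<close>

lemma curv4_triangular:
  assumes "bil n u u = 0" "bil n u v = 0"
    and "u' = (\<lambda>i. a0 * u i)" "v' = (\<lambda>i. b0 * u i + a1 * v i)"
    "w' = (\<lambda>i. c0 * u i + c1 * v i + a2 * w i)"
    "z' = (\<lambda>i. d0 * u i + d1 * v i + d2 * w i + a3 * z i)"
    and a: "a1 \<noteq> 0" "a2\<^sup>2 * a3\<^sup>2 * a0\<^sup>2 = s * a1 ^ 6"
  shows "curv4 n u' v' w' z' = s * curv4 n u v w z"
proof -
  have g: "gram4 n u' v' w' z' = a0\<^sup>2 * (a1\<^sup>2 * (a2\<^sup>2 * (a3\<^sup>2 * gram4 n u v w z)))"
    unfolding assms(3-6) gram4_fst gram4_snd gram4_trd gram4_fth by (rule refl)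
  have "bil n v' v' = a1\<^sup>2 * bil n v v"
    unfolding assms(4) using assms(1,2) by (simp add: bil_simps bil_commute[of n v u] power2_eq_square)
  then have "curv4 n u' v' w' z' = - ((a2\<^sup>2 * a3\<^sup>2 * a0\<^sup>2) * a1\<^sup>2 * gram4 n u v w z) / (a1 ^ 8 * (bil n v v)^4)"
    unfolding curv4_def g by (simp add: power_mult_distrib algebra_simps)
  also have "\<dots> = s * curv4 n u v w z"
  proof -
    have "a1 ^ 6 * a1\<^sup>2 = a1 ^ 8" by (simp flip: power_add)
    then have "(a2\<^sup>2 * a3\<^sup>2 * a0\<^sup>2) * a1\<^sup>2 = s * a1 ^ 8" using a(2) by (simp add: mult.assoc)
    then show ?thesis using a(1) by (simp add: curv4_def)
  qed
  finally show ?thesis .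
qed

subsection \<open>Derivatives of vector-valued functions\<close>

definition vder :: "(real \<Rightarrow> nat \<Rightarrow> real) \<Rightarrow> (nat \<Rightarrow> real) \<Rightarrow> real \<Rightarrow> bool" where
  "vder u d x \<longleftrightarrow> (\<forall>i. ((\<lambda>y. u y i) has_real_derivative d i) (at x))"

definition vsmooth :: "real set \<Rightarrow> (real \<Rightarrow> nat \<Rightarrow> real) \<Rightarrow> bool" where
  "vsmooth U u \<longleftrightarrow> (\<forall>i. smooth_on_R U (\<lambda>x. u x i))"

definition vderiv :: "(real \<Rightarrow> nat \<Rightarrow> real) \<Rightarrow> real \<Rightarrow> nat \<Rightarrow> real" where
  "vderiv u x = (\<lambda>i. deriv (\<lambda>y. u y i) x)"

lemma vder_unique: "vder u d x \<Longrightarrow> vder u d' x \<Longrightarrow> d = d'"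
  unfolding vder_def by (intro ext) (use DERIV_unique in blast)
lemma vder_imp_vderiv: "vder u d x \<Longrightarrow> vderiv u x = d"
  unfolding vder_def vderiv_def by (auto simp: DERIV_imp_deriv)
lemma vsmooth_vder: "open U \<Longrightarrow> vsmooth U u \<Longrightarrow> x \<in> U \<Longrightarrow> vder u (vderiv u x) x"
  unfolding vder_def vderiv_def vsmooth_def by (simp add: smooth_DERIV)
lemma vsmooth_vderiv: "open U \<Longrightarrow> vsmooth U u \<Longrightarrow> vsmooth U (vderiv u)"
  unfolding vderiv_def vsmooth_def using smooth_deriv by auto
lemma vder_transform: "open U \<Longrightarrow> x \<in> U \<Longrightarrow> (\<And>y. y \<in> U \<Longrightarrow> u y = v y) \<Longrightarrow> vder u d x \<Longrightarrow> vder v d x"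
  unfolding vder_def using DERIV_transform_open[of U x "\<lambda>y. u y i" "\<lambda>y. v y i" for i] by auto
lemma vder_add: "vder u d x \<Longrightarrow> vder v c x \<Longrightarrow> vder (\<lambda>y i. u y i + v y i) (\<lambda>i. d i + c i) x"
  unfolding vder_def by (auto intro: DERIV_add)
lemma vder_diff: "vder u d x \<Longrightarrow> vder v c x \<Longrightarrow> vder (\<lambda>y i. u y i - v y i) (\<lambda>i. d i - c i) x"
  unfolding vder_def by (auto intro: DERIV_diff)
lemma vder_scale:
  "(g has_real_derivative g') (at x) \<Longrightarrow> vder u d x \<Longrightarrow>
    vder (\<lambda>y i. g y * u y i) (\<lambda>i. g' * u x i + g x * d i) x"
  unfolding vder_def by (auto intro!: derivative_eq_intros)
lemma vder_sum:
  assumes "finite A" "\<And>k. k \<in> A \<Longrightarrow> vder (u k) (d k) x"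
  shows "vder (\<lambda>y i. \<Sum>k\<in>A. u k y i) (\<lambda>i. \<Sum>k\<in>A. d k i) x"
  using assms unfolding vder_def by (auto intro!: DERIV_sum)
lemma bil_DERIV:
  assumes "vder u d x" "vder v c x"
  shows "((\<lambda>y. bil n (u y) (v y)) has_real_derivative bil n d (v x) + bil n (u x) c) (at x)"
proof -
  have "((\<lambda>y. bil n (u y) (v y)) has_real_derivative
    (\<Sum>A=1..n. u x A * c A + d A * v x A) - (u x 0 * c (n+1) + d 0 * v x (n+1)) - (u x (n+1) * c 0 + d (n+1) * v x 0)) (at x)"
    unfolding bil_def by (intro DERIV_diff DERIV_sum DERIV_mult') (use assms in \<open>auto simp: vder_def\<close>)
  then show ?thesis by (simp add: bil_def sum.distrib algebra_simps)
qed

lemma smooth_bil: "open U \<Longrightarrow> vsmooth U u \<Longrightarrow> vsmooth U v \<Longrightarrow> smooth_on_R U (\<lambda>x. bil n (u x) (v x))"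
  unfolding bil_def vsmooth_def by (intro smooth_intros) auto
lemma vsmooth_add: "open U \<Longrightarrow> vsmooth U u \<Longrightarrow> vsmooth U v \<Longrightarrow> vsmooth U (\<lambda>x i. u x i + v x i)"
  unfolding vsmooth_def by (simp add: smooth_add)
lemma vsmooth_diff: "open U \<Longrightarrow> vsmooth U u \<Longrightarrow> vsmooth U v \<Longrightarrow> vsmooth U (\<lambda>x i. u x i - v x i)"
  unfolding vsmooth_def by (simp add: smooth_diff)
lemma vsmooth_scale: "open U \<Longrightarrow> smooth_on_R U g \<Longrightarrow> vsmooth U v \<Longrightarrow> vsmooth U (\<lambda>x i. g x * v x i)"
  unfolding vsmooth_def by (simp add: smooth_mult)
lemma vsmooth_subset: "vsmooth U u \<Longrightarrow> V \<subseteq> U \<Longrightarrow> vsmooth V u"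
  unfolding vsmooth_def by (blast intro: smooth_subset)
lemma vsmooth_cong: "open U \<Longrightarrow> (\<And>x. x \<in> U \<Longrightarrow> u x = v x) \<Longrightarrow> vsmooth U u \<Longrightarrow> vsmooth U v"
  unfolding vsmooth_def using smooth_cong[of U "\<lambda>x. u x i" "\<lambda>x. v x i" for i] by auto

lemmas vsmooth_intros = vsmooth_add vsmooth_diff vsmooth_scale vsmooth_vderiv

lemma vder_vsupp:
  assumes "open U" "x \<in> U" "\<And>y. y \<in> U \<Longrightarrow> vsupp n (u y)" "vder u d x"
  shows "vsupp n d"
  unfolding vsupp_def
proof (intro allI impI)
  fix i assume "n + 2 \<le> i"
  then have "((\<lambda>y. 0) has_real_derivative d i) (at x)"
    using assms DERIV_transform_open[of U x "\<lambda>y. u y i" "\<lambda>y. 0" "d i"] by (auto simp: vsupp_def vder_def)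
  then show "d i = 0" using DERIV_unique[OF _ DERIV_const] by blast
qed

lemma vsupp_lin: "vsupp n u \<Longrightarrow> vsupp n v \<Longrightarrow> vsupp n (\<lambda>i. u i + v i)"
  "vsupp n u \<Longrightarrow> vsupp n v \<Longrightarrow> vsupp n (\<lambda>i. u i - v i)"
  "vsupp n u \<Longrightarrow> vsupp n (\<lambda>i. c * u i)"
  by (auto simp: vsupp_def)

subsection \<open>Moving columns of a frame by rotations\<close>

lemma Jm_simps:
  "Jm n 0 0 = 0" "Jm n (Suc n) (Suc n) = 0" "Jm n 0 (Suc n) = -1" "Jm n (Suc n) 0 = -1"
  "1 \<le> A \<Longrightarrow> A \<le> n \<Longrightarrow> b < n + 2 \<Longrightarrow> Jm n A b = (if A = b then 1 else 0)"
  "1 \<le> A \<Longrightarrow> A \<le> n \<Longrightarrow> b < n + 2 \<Longrightarrow> Jm n b A = (if A = b then 1 else 0)"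
  by (auto simp: Jm_def bil_def unitv_def if_distrib[of "\<lambda>x. _ * x"] if_distrib[of "\<lambda>x. x * _"]
      sum.delta sum.delta' cong: if_cong)

definition refl_along :: "nat \<Rightarrow> (nat \<Rightarrow> real) \<Rightarrow> (nat \<Rightarrow> real) \<Rightarrow> nat \<Rightarrow> real" where
  "refl_along n a z = (\<lambda>i. z i - 2 * bil n z a / bil n a a * a i)"

definition rotate_to :: "nat \<Rightarrow> (nat \<Rightarrow> real) \<Rightarrow> (nat \<Rightarrow> real) \<Rightarrow> (nat \<Rightarrow> real) \<Rightarrow> nat \<Rightarrow> real" where
  "rotate_to n u w z = refl_along n (\<lambda>i. u i + w i) (refl_along n u z)"

lemma bil_refl_along:
  assumes "bil n a a \<noteq> 0"
  shows "bil n (refl_along n a z) (refl_along n a w) = bil n z w"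
proof -
  have "2 * bil n z a / bil n a a * (2 * bil n w a / bil n a a * bil n a a)
      = 2 * bil n z a / bil n a a * (2 * bil n w a)"
    using assms by simp
  then show ?thesis unfolding refl_along_def bil_simps bil_commute[of n a w]
    by (simp add: algebra_simps)
qed

lemma refl_along_lin:
  "refl_along n a (\<lambda>i. b * y i + c * z i) = (\<lambda>i. b * refl_along n a y i + c * refl_along n a z i)"
  unfolding refl_along_def by (intro ext) (simp add: bil_simps algebra_simps add_divide_distrib)

lemma rotate_to_lin:
  "rotate_to n u w (\<lambda>i. b * y i + c * z i) = (\<lambda>i. b * rotate_to n u w y i + c * rotate_to n u w z i)"
  unfolding rotate_to_def by (simp add: refl_along_lin)

lemma rotate_to_fixes: "bil n z u = 0 \<Longrightarrow> bil n z w = 0 \<Longrightarrow> rotate_to n u w z = z"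
  unfolding rotate_to_def refl_along_def by (simp add: bil_simps)

text \<open>The first reflection takes \<open>u\<close> to \<open>- u\<close>; the second, whose
  mirror vector \<open>u + w\<close> has norm 2 (k + <u,w>), takes \<open>- u\<close> to
  \<open>w\<close>. Dividing by \<open>k\<close> in the last hypothesis lets one condition serve
  spacelike and timelike vectors.\<close>

lemma rotate_to_maps:
  assumes "bil n u u = k" "bil n w w = k" "k \<noteq> 0" "1 + bil n u w / k > 0"
  shows "rotate_to n u w u = w"
proof
  fix i
  define c where "c = bil n u w"
  have c: "k + c \<noteq> 0" using assms(3,4) unfolding c_def by (auto simp: field_simps)
  have 1: "refl_along n u u = (\<lambda>i. - u i)" using assms by (simp add: refl_along_def)
  have 2: "bil n (\<lambda>i. u i + w i) (\<lambda>i. u i + w i) = 2 * (k + c)"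
    using assms by (simp add: bil_simps c_def bil_commute[of n w u])
  have 3: "bil n (\<lambda>i. - u i) (\<lambda>i. u i + w i) = - (k + c)"
    using assms by (simp add: bil_simps c_def)
  show "rotate_to n u w u i = w i"
  proof -
    have "2 * - d / (2 * d) = -1" if "d \<noteq> 0" for d :: real using that by simp
    from this[OF c] show ?thesis unfolding rotate_to_def 1 unfolding refl_along_def 2 3 by simp
  qed
qed

lemma refl_along_isom:
  assumes "isom n M" "vsupp n a" "bil n a a \<noteq> 0"
  shows "isom n (\<lambda>i j. refl_along n a (col M j) i)"
proof -
  have "col M j = (\<lambda>i. 0)" if "j \<ge> n + 2" for j
    using assms(1) that by (auto simp: isom_def msupp_def col_def)
  then have "msupp n (\<lambda>i j. refl_along n a (col M j) i)"
    using assms by (auto simp: isom_def msupp_def refl_along_def col_def vsupp_def bil_simps)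
  moreover have "col (\<lambda>i j. refl_along n a (col M j) i) j = refl_along n a (col M j)" for j
    by (simp add: col_def)
  ultimately show ?thesis using assms by (simp add: isom_def bil_refl_along)
qed

lemma refl2_isom:
  assumes "isom n M" "vsupp n a" "bil n a a \<noteq> 0" "vsupp n b" "bil n b b \<noteq> 0"
  shows "isom n (\<lambda>i j. refl_along n b (refl_along n a (col M j)) i)"
  using refl_along_isom[OF refl_along_isom[OF assms(1-3)] assms(4,5)] by (simp add: col_def)

lemma Mob_isom: "M \<in> Mob n \<Longrightarrow> isom n M"
  unfolding Mob_def by force

lemma Mob_extend:
  assumes "M \<in> Mob n" "\<And>i j. continuous_on {0..1} (\<lambda>t. \<delta> t i j)"
    "\<And>t. t \<in> {0..1} \<Longrightarrow> isom n (\<delta> t)" "\<delta> 0 = M"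
  shows "\<delta> (1::real) \<in> Mob n"
proof -
  obtain \<gamma> :: "real \<Rightarrow> nat \<Rightarrow> nat \<Rightarrow> real" where g: "\<And>i j. continuous_on {0..1} (\<lambda>t. \<gamma> t i j)"
    "\<And>t. t \<in> {0..1} \<Longrightarrow> isom n (\<gamma> t)" "\<gamma> 0 = idm n" "\<gamma> 1 = M"
    using assms(1) unfolding Mob_def by blast
  define \<eta> where "\<eta> = (\<lambda>t i j. ((\<lambda>t. \<gamma> t i j) +++ (\<lambda>t. \<delta> t i j)) t)"
  have "continuous_on {0..1} (\<lambda>t. \<eta> t i j)" for i j
    unfolding \<eta>_def using path_join_imp[of "\<lambda>t. \<gamma> t i j" "\<lambda>t. \<delta> t i j"] g assms
    by (simp add: path_def pathstart_def pathfinish_def)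
  moreover have "isom n (\<eta> t)" if "t \<in> {0..1}" for t
  proof (cases "t \<le> 1/2")
    case True
    then have "\<eta> t = \<gamma> (2 * t)" by (simp add: \<eta>_def joinpaths_def)
    then show ?thesis using g(2)[of "2 * t"] True that by simp
  next
    case False
    then have "\<eta> t = \<delta> (2 * t - 1)" by (simp add: \<eta>_def joinpaths_def)
    then show ?thesis using assms(3)[of "2 * t - 1"] False that by simp
  qed
  moreover have "\<eta> 0 = idm n" "\<eta> 1 = \<delta> 1"
    using g by (simp_all add: \<eta>_def joinpaths_def)
  ultimately show ?thesis unfolding Mob_def by blast
qed

lemma idm_Mob: "idm n \<in> Mob n"
proof -
  have "col (idm n) j = unitv j" if "j < n + 2" for j
    using that by (auto simp: col_def idm_def unitv_def)
  then have "isom n (idm n)" by (auto simp: isom_def msupp_def Jm_def) (auto simp: idm_def)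
  then show ?thesis unfolding Mob_def by (auto intro!: exI[of _ "\<lambda>t. idm n"])
qed

text \<open>Since the rotation taking \<open>u\<close> to \<open>w\<close> is a product of the reflections along \<open>u\<close> and along
\<open>u + w\<close>, moving the second mirror through \<open>u + t w\<close> joins it to the identity.\<close>
lemma rotate_to_Mob:
  assumes "M \<in> Mob n" "vsupp n u" "vsupp n w"
    "bil n u u = k" "bil n w w = k" "k \<noteq> 0" "1 + bil n u w / k > 0"
  shows "(\<lambda>i j. rotate_to n u w (col M j) i) \<in> Mob n"
proof -
  define a where "a t = (\<lambda>i. u i + t * w i)" for t :: real
  define c where "c = bil n u w / k"
  have kc: "bil n u w = k * c" using assms(6) by (simp add: c_def)
  have aa: "bil n (a t) (a t) = k * (1 + t\<^sup>2 + 2 * t * c)" for t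
    using assms kc by (simp add: a_def bil_simps bil_commute[of n w u] power2_eq_square algebra_simps)
  have nz: "bil n (a t) (a t) \<noteq> 0" if "t \<in> {0..1}" for t
  proof -
    \<comment> \<open>As c > -1, this form shows that the moving mirror vector does not become null
      on [0,1].\<close>
    have "1 + t\<^sup>2 + 2 * t * c = (1 - t)\<^sup>2 + 2 * t * (1 + c)" by (simp add: power2_eq_square algebra_simps)
    also have "\<dots> > 0"
    proof (cases "t = 0")
      case False
      then have "2 * t * (1 + c) > 0" using that assms(7) by (simp add: c_def)
      then show ?thesis by (smt (verit) zero_le_power2)
    qed simp
    finally show ?thesis using aa[of t] assms(6) by simp
  qed
  have va: "vsupp n (a t)" for t using assms by (auto simp: a_def vsupp_def)
  have iso: "isom n M" using Mob_isom assms(1) by blast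
  define d where "d t = (\<lambda>i j. refl_along n (a t) (refl_along n u (col M j)) i)" for t
  have "d 1 \<in> Mob n"
  proof (rule Mob_extend[OF assms(1), of d])
    show "isom n (d t)" if "t \<in> {0..1}" for t
      unfolding d_def by (rule refl2_isom[OF iso assms(2) _ va nz[OF that]]) (use assms in simp)
    show "d 0 = M"
      using assms unfolding d_def a_def by (intro ext) (simp add: refl_along_def bil_simps col_def)
    show "continuous_on {0..1} (\<lambda>t. d t i j)" for i j
    proof -
      have "continuous_on {0..1} (\<lambda>t. bil n z (a t))" for z
        unfolding a_def bil_simps by (intro continuous_intros)
      moreover have "continuous_on {0..1} (\<lambda>t. bil n (a t) (a t))"
        unfolding aa by (intro continuous_intros)
      moreover have "continuous_on {0..1} (\<lambda>t. a t i)" for i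
        unfolding a_def by (intro continuous_intros)
      ultimately show ?thesis unfolding d_def refl_along_def[of n "a _"]
        by (intro continuous_intros) (use nz in auto)
    qed
  qed
  then show ?thesis by (simp add: d_def a_def rotate_to_def)
qed

definition smooth_Mob :: "nat \<Rightarrow> real set \<Rightarrow> (real \<Rightarrow> nat \<Rightarrow> nat \<Rightarrow> real) \<Rightarrow> bool" where
  "smooth_Mob n V e \<longleftrightarrow> (\<forall>i j. smooth_on_R V (\<lambda>x. e x i j)) \<and> (\<forall>x\<in>V. e x \<in> Mob n)"

lemma smooth_Mob_col: "smooth_Mob n V e \<Longrightarrow> vsmooth V (\<lambda>x. col (e x) j)"
  by (simp add: smooth_Mob_def vsmooth_def col_def)

lemma smooth_Mob_subset: "smooth_Mob n U e \<Longrightarrow> V \<subseteq> U \<Longrightarrow> smooth_Mob n V e"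
  unfolding smooth_Mob_def by (blast intro: smooth_subset)

lemma open_positive_set:
  fixes g :: "real \<Rightarrow> real"
  assumes "open V" "continuous_on V g"
  shows "open {x \<in> V. g x > 0}"
proof -
  have "open (V \<inter> g -` {0<..})" using assms by (simp add: continuous_open_preimage)
  then show ?thesis by (simp add: vimage_def Int_def)
qed

lemma smooth_Mob_rotate:
  assumes V: "open V" "smooth_Mob n V e" "vsmooth V u" "vsmooth V w"
    and s: "\<And>x. x \<in> V \<Longrightarrow> vsupp n (u x)" "\<And>x. x \<in> V \<Longrightarrow> vsupp n (w x)"
    and k: "\<And>x. x \<in> V \<Longrightarrow> bil n (u x) (u x) = k" "\<And>x. x \<in> V \<Longrightarrow> bil n (w x) (w x) = k" "k \<noteq> 0"
    and pos: "\<And>x. x \<in> V \<Longrightarrow> 1 + bil n (u x) (w x) / k > 0"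
  shows "smooth_Mob n V (\<lambda>x i j. rotate_to n (u x) (w x) (col (e x) j) i)"
  unfolding smooth_Mob_def
proof (intro conjI allI ballI)
  show "(\<lambda>i j. rotate_to n (u x) (w x) (col (e x) j) i) \<in> Mob n" if "x \<in> V" for x
    using V(2) that s k pos by (intro rotate_to_Mob) (auto simp: smooth_Mob_def)
  have uw: "bil n (\<lambda>i. u x i + w x i) (\<lambda>i. u x i + w x i) \<noteq> 0" if "x \<in> V" for x
  proof -
    have "bil n (\<lambda>i. u x i + w x i) (\<lambda>i. u x i + w x i) = 2 * k * (1 + bil n (u x) (w x) / k)"
      using k(1,2)[OF that] k(3)
      by (simp add: bil_add_left bil_add_right bil_commute[of n "w x" "u x"] distrib_left)
    then show ?thesis using pos[OF that] k(3) by simp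
  qed
  have r: "vsmooth V (\<lambda>x. refl_along n (a x) (z x))"
    if "vsmooth V a" "vsmooth V z" "\<And>x. x \<in> V \<Longrightarrow> bil n (a x) (a x) \<noteq> 0" for a z
    unfolding refl_along_def
    by (intro vsmooth_intros smooth_intros smooth_bil V that) auto
  have "vsmooth V (\<lambda>x. rotate_to n (u x) (w x) (col (e x) j))" for j
    unfolding rotate_to_def
    by (intro r vsmooth_intros V smooth_Mob_col[OF V(2)] uw) (use k in auto)
  then show "smooth_on_R V (\<lambda>x. rotate_to n (u x) (w x) (col (e x) j) i)" for i j
    by (simp add: vsmooth_def)
qed

lemma isom_col: "isom n M \<Longrightarrow> j < n + 2 \<Longrightarrow> k < n + 2 \<Longrightarrow> bil n (col M j) (col M k) = Jm n j k"
  by (simp add: isom_def)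

lemma isom_vsupp: "isom n M \<Longrightarrow> vsupp n (col M j)"
  by (simp add: isom_def msupp_def vsupp_def col_def)

text \<open>A spacelike column is turned towards \<open>w\<close> in two steps through a multiple of
\<open>col n\<close>, its sign being chosen so that the second step never has to map a vector to its negative.\<close>
lemma smooth_Mob_turn:
  assumes V: "open V" "x0 \<in> V" "smooth_Mob n V e" "vsmooth V u" "vsmooth V w" "n \<ge> 1"
    and s: "\<And>x. x \<in> V \<Longrightarrow> vsupp n (u x)" "\<And>x. x \<in> V \<Longrightarrow> vsupp n (w x)"
    and k: "\<And>x. x \<in> V \<Longrightarrow> bil n (u x) (u x) = k" "\<And>x. x \<in> V \<Longrightarrow> bil n (w x) (w x) = k" "k > 0"
    and perp: "\<And>x. x \<in> V \<Longrightarrow> bil n (u x) (col (e x) n) = 0"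
  obtains V' \<rho> where "open V'" "x0 \<in> V'" "V' \<subseteq> V"
    "smooth_Mob n V' (\<lambda>x i j. \<rho> x (col (e x) j) i)"
    "\<And>x. x \<in> V' \<Longrightarrow> \<rho> x (u x) = w x"
    "\<And>x z. x \<in> V' \<Longrightarrow> bil n z (u x) = 0 \<Longrightarrow> bil n z (w x) = 0 \<Longrightarrow> bil n z (col (e x) n) = 0 \<Longrightarrow> \<rho> x z = z"
    "\<And>x b c y z. \<rho> x (\<lambda>i. b * y i + c * z i) = (\<lambda>i. b * \<rho> x y i + c * \<rho> x z i)"
proof -
  define \<sigma> :: real where "\<sigma> = (if bil n (col (e x0) n) (w x0) \<ge> 0 then sqrt k else - sqrt k)"
  have sg: "\<sigma>\<^sup>2 = k" using k(3) by (simp add: \<sigma>_def)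
  define v where "v x = (\<lambda>i. \<sigma> * col (e x) n i)" for x
  have iso: "isom n (e x)" if "x \<in> V" for x
    using V(3) that Mob_isom by (auto simp: smooth_Mob_def)
  have vv: "bil n (v x) (v x) = k" if "x \<in> V" for x
    using isom_col[OF iso[OF that], of n n] V(6) sg
    by (simp add: v_def bil_simps Jm_simps power2_eq_square)
  have uv: "bil n (u x) (v x) = 0" if "x \<in> V" for x
    using perp[OF that] by (simp add: v_def bil_simps)
  have vs: "vsmooth V v" unfolding v_def by (intro vsmooth_intros smooth_intros V smooth_Mob_col[OF V(3)])
  have vsp: "vsupp n (v x)" if "x \<in> V" for x
    using isom_vsupp[OF iso[OF that], of n] by (simp add: v_def vsupp_def)
  define V' where "V' = {x \<in> V. 1 + bil n (v x) (w x) / k > 0}"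
  have V'V: "V' \<subseteq> V" by (auto simp: V'_def)
  have oV': "open V'" unfolding V'_def
    by (rule open_positive_set[OF V(1)])
       (rule smooth_continuous[OF V(1)], intro smooth_intros smooth_bil V vs, use k in auto)
  have "bil n (v x0) (w x0) \<ge> 0"
    using k(3) by (simp add: v_def bil_scale_left \<sigma>_def zero_le_mult_iff mult_le_0_iff)
  then have x0: "x0 \<in> V'" using V(2) k(3) by (simp add: V'_def add_pos_nonneg)
  have e1: "smooth_Mob n V (\<lambda>x i j. rotate_to n (u x) (v x) (col (e x) j) i)"
    by (rule smooth_Mob_rotate[OF V(1,3,4) vs s(1) vsp k(1) vv]) (use uv k in auto)
  define \<rho> where "\<rho> x z = rotate_to n (v x) (w x) (rotate_to n (u x) (v x) z)" for x z
  have "smooth_Mob n V' (\<lambda>x i j. rotate_to n (v x) (w x) (col (\<lambda>i j. rotate_to n (u x) (v x) (col (e x) j) i) j) i)"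
    by (rule smooth_Mob_rotate[where k = k])
       (use oV' V'V e1 vs V s vsp k vv in \<open>auto intro: smooth_Mob_subset vsmooth_subset simp: V'_def\<close>)
  then have "smooth_Mob n V' (\<lambda>x i j. \<rho> x (col (e x) j) i)" by (simp add: \<rho>_def col_def)
  moreover have "\<rho> x (u x) = w x" if "x \<in> V'" for x
  proof -
    have x: "x \<in> V" "1 + bil n (v x) (w x) / k > 0" using that by (auto simp: V'_def)
    have "rotate_to n (u x) (v x) (u x) = v x"
      by (rule rotate_to_maps[OF k(1)[OF x(1)] vv[OF x(1)]]) (use uv[OF x(1)] k in auto)
    moreover have "rotate_to n (v x) (w x) (v x) = w x"
      by (rule rotate_to_maps[OF vv[OF x(1)] k(2)[OF x(1)]]) (use x k in auto)
    ultimately show ?thesis by (simp add: \<rho>_def)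
  qed
  moreover have "\<rho> x z = z"
    if "bil n z (u x) = 0" "bil n z (w x) = 0" "bil n z (col (e x) n) = 0" for x z
    using that by (simp add: \<rho>_def rotate_to_fixes v_def bil_simps)
  ultimately show thesis
    using that[of V' \<rho>] oV' x0 V'V by (simp add: \<rho>_def rotate_to_lin)
qed

section \<open>Dual components, expansion in columns, and time orientation\<close>

definition lower :: "nat \<Rightarrow> (nat \<Rightarrow> real) \<Rightarrow> nat \<Rightarrow> real" where
  "lower n v k = (if k = 0 then - v (n+1) else if k = n + 1 then - v 0 else v k)"

lemma sum_split_ends:
  fixes n :: nat and g :: "nat \<Rightarrow> real"
  shows "(\<Sum>k<n+2. g k) = g 0 + (\<Sum>k=1..n. g k) + g (n+1)"
proof -
  have "{..<n+2} = insert 0 (insert (n+1) {1..n})" by auto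
  then show ?thesis by simp
qed

lemma bil_lower: "bil n v w = (\<Sum>k<n+2. lower n v k * w k)"
proof -
  have "(\<Sum>k<n+2. lower n v k * w k) = lower n v 0 * w 0 + (\<Sum>k=1..n. lower n v k * w k) + lower n v (n+1) * w (n+1)"
    by (rule sum_split_ends)
  also have "(\<Sum>k=1..n. lower n v k * w k) = (\<Sum>k=1..n. v k * w k)"
    by (rule sum.cong) (auto simp: lower_def)
  finally show ?thesis by (simp add: bil_def lower_def)
qed

lemma Jm_sym: "Jm n a b = Jm n b a"
  unfolding Jm_def by (rule bil_commute)

lemma Jm_unitv: "d < n + 2 \<Longrightarrow> Jm n a d = lower n (unitv a) d"
  unfolding Jm_def bil_lower
  by (simp add: unitv_def if_distrib[of "\<lambda>x. _ * x"] sum.delta cong: if_cong)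

lemma Jm_lower: "a < n + 2 \<Longrightarrow> (\<Sum>d<n+2. Jm n a d * g d) = lower n g a"
proof -
  assume a: "a < n + 2"
  have "(\<Sum>d<n+2. Jm n a d * g d) = bil n (unitv a) g"
    unfolding bil_lower by (rule sum.cong) (simp_all add: Jm_unitv)
  also have "\<dots> = (\<Sum>k<n+2. lower n g k * unitv a k)" by (subst bil_commute) (rule bil_lower)
  also have "\<dots> = lower n g a"
    using a by (simp add: unitv_def if_distrib[of "\<lambda>x. _ * x"] sum.delta cong: if_cong)
  finally show ?thesis .
qed

lemma lower_sum: "lower n (\<lambda>d. \<Sum>k\<in>K. g d k * v k) a = (\<Sum>k\<in>K. lower n (\<lambda>d. g d k) a * v k)"
  by (simp add: lower_def sum_negf)

text \<open>The columns form a basis because a left inverse of a square matrix is a right inverse.\<close>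
lemma isom_expand:
  assumes "isom n M" "vsupp n v"
  shows "v = (\<lambda>i. \<Sum>a<n+2. (\<Sum>d<n+2. Jm n a d * bil n (Defs.col M d) v) * M i a)"
proof -
  let ?N = "n + 2"
  \<comment> \<open>\<open>C\<close> is the product J M^T J, the left inverse that the isometry
    condition provides.\<close>
  define C where "C a k = lower n (\<lambda>d. lower n (Defs.col M d) k) a" for a k
  have coef: "(\<Sum>d<?N. Jm n a d * bil n (Defs.col M d) w) = (\<Sum>k<?N. C a k * w k)" if "a < ?N" for a w
    unfolding Jm_lower[OF that] C_def unfolding bil_lower by (rule lower_sum)
  define A B where "A = mat ?N ?N (\<lambda>(i,a). M i a)" and "B = mat ?N ?N (\<lambda>(a,k). C a k)"
  have carr: "A \<in> carrier_mat ?N ?N" "B \<in> carrier_mat ?N ?N" by (auto simp: A_def B_def)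
  have "B * A = 1\<^sub>m ?N"
  proof (rule eq_matI)
    fix a b assume ab: "a < dim_row (1\<^sub>m ?N)" "b < dim_col (1\<^sub>m ?N)"
    then have ab': "a < ?N" "b < ?N" by auto
    have "(B * A) $$ (a, b) = (\<Sum>k<?N. C a k * Defs.col M b k)"
      using ab' by (simp add: A_def B_def scalar_prod_def Defs.col_def lessThan_atLeast0)
    also have "\<dots> = (\<Sum>d<?N. Jm n a d * bil n (Defs.col M d) (Defs.col M b))" by (rule coef[OF ab'(1), symmetric])
    also have "\<dots> = (\<Sum>d<?N. Jm n a d * Jm n d b)"
      using assms(1) ab' by (intro sum.cong) (auto simp: isom_def)
    also have "\<dots> = lower n (\<lambda>d. Jm n d b) a" by (rule Jm_lower[OF ab'(1)])
    also have "\<dots> = (if a = b then 1 else 0)"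
    proof -
      have "Jm n d b = lower n (unitv b) d" if "d < ?N" for d
        using Jm_unitv[OF that] Jm_sym by metis
      then show ?thesis using ab' by (auto simp: lower_def unitv_def)
    qed
    finally show "(B * A) $$ (a, b) = 1\<^sub>m ?N $$ (a, b)" using ab' by simp
  qed (auto simp: A_def B_def)
  then have AB: "A * B = 1\<^sub>m ?N" using mat_mult_left_right_inverse[OF carr(2,1)] by simp
  show ?thesis
  proof
    fix i
    show "v i = (\<Sum>a<?N. (\<Sum>d<?N. Jm n a d * bil n (Defs.col M d) v) * M i a)"
    proof (cases "i < ?N")
      case True
      have d: "(\<Sum>a<?N. M i a * C a k) = (if i = k then 1 else 0)" if "k < ?N" for k
      proof -
        have "(A * B) $$ (i, k) = (\<Sum>a<?N. M i a * C a k)"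
          using True that by (simp add: A_def B_def scalar_prod_def lessThan_atLeast0)
        then show ?thesis using True that AB by simp
      qed
      have "(\<Sum>a<?N. (\<Sum>d<?N. Jm n a d * bil n (Defs.col M d) v) * M i a) = (\<Sum>a<?N. \<Sum>k<?N. M i a * C a k * v k)"
        by (rule sum.cong) (simp_all only: lessThan_iff coef sum_distrib_left sum_distrib_right mult_ac)
      also have "\<dots> = (\<Sum>k<?N. (\<Sum>a<?N. M i a * C a k) * v k)"
        by (subst sum.swap) (simp only: sum_distrib_right)
      also have "\<dots> = (\<Sum>k<?N. (if i = k then v k else 0))" 
        by (rule sum.cong) (simp_all only: lessThan_iff d if_distrib[of "\<lambda>r. r * _"] mult_1 mult_zero_left)
      also have "\<dots> = v i" using True by (simp only: sum.delta' finite_lessThan lessThan_iff if_True)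
      finally show ?thesis by simp
    next
      case False
      then show ?thesis using assms by (simp add: vsupp_def isom_def msupp_def)
    qed
  qed
qed

text \<open>A null vector satisfies 2 v_0 v_{n+1} = sum of squares >= 0, so its two end coordinates
  have no opposite signs. If \<open>a\<close> pointed to the future and \<open>b\<close> did not,
  Cauchy-Schwarz would make <a,b> nonnegative. The lemma passes the orientation of \<open>e0\<close>
  on to \<open>en\<close>.\<close>

lemma null_future:
  assumes "bil n a a = 0" "bil n b b = 0" "a 0 + a (n+1) > 0" "bil n a b < 0"
  shows "b 0 + b (n+1) > 0"
proof (rule ccontr)
  assume neg: "\<not> ?thesis"
  have a: "(\<Sum>A=1..n. (a A)\<^sup>2) = 2 * a 0 * a (n+1)" and b: "(\<Sum>A=1..n. (b A)\<^sup>2) = 2 * b 0 * b (n+1)"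
    using assms(1,2) by (simp_all add: bil_def power2_eq_square)
  have "a 0 * a (n+1) \<ge> 0" "b 0 * b (n+1) \<ge> 0"
    using a b sum_nonneg[of "{1..n}" "\<lambda>A. (a A)\<^sup>2"] sum_nonneg[of "{1..n}" "\<lambda>A. (b A)\<^sup>2"] by simp_all
  then have s: "a 0 \<ge> 0" "a (n+1) \<ge> 0" "b 0 \<le> 0" "b (n+1) \<le> 0"
    using assms(3) neg by (auto simp: zero_le_mult_iff)
  define r where "r = - a 0 * b (n+1) - a (n+1) * b 0"
  have "a 0 * b (n+1) \<le> 0" "a (n+1) * b 0 \<le> 0" using s by (simp_all add: mult_nonneg_nonpos)
  then have "r \<ge> 0" by (simp add: r_def)
  have "(\<Sum>A=1..n. a A * b A)\<^sup>2 \<le> (\<Sum>A=1..n. (a A)\<^sup>2) * (\<Sum>A=1..n. (b A)\<^sup>2)"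
    by (rule Cauchy_Schwarz_ineq_sum)
  also have "\<dots> = r\<^sup>2 - (a 0 * b (n+1) - a (n+1) * b 0)\<^sup>2"
    unfolding a b r_def by (simp add: power2_eq_square algebra_simps)
  also have "\<dots> \<le> r\<^sup>2" by simp
  finally have "\<bar>\<Sum>A=1..n. a A * b A\<bar> \<le> r" using \<open>r \<ge> 0\<close> by (simp add: abs_le_square_iff[symmetric])
  then show False using assms(4) by (simp add: bil_def r_def)
qed

section \<open>Completing canonical columns to local frames in Mob(n)\<close>

lemma smooth_Mob_iso: "smooth_Mob n V e \<Longrightarrow> x \<in> V \<Longrightarrow> isom n (e x)"
  using Mob_isom by (auto simp: smooth_Mob_def)

locale null_columns =
  fixes n :: nat and U :: "real set" and e0 e1 e2 en :: "real \<Rightarrow> nat \<Rightarrow> real" and \<sigma> \<mu> :: "real \<Rightarrow> real"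
  assumes oU: "open U"
    and sm: "vsmooth U e0" "vsmooth U e1" "vsmooth U e2" "vsmooth U en" "smooth_on_R U \<sigma>" "smooth_on_R U \<mu>"
    and pos: "\<And>x. x \<in> U \<Longrightarrow> \<sigma> x > 0"
    and supp: "\<And>x. x \<in> U \<Longrightarrow> vsupp n (e0 x)" "\<And>x. x \<in> U \<Longrightarrow> vsupp n (e1 x)"
      "\<And>x. x \<in> U \<Longrightarrow> vsupp n (e2 x)" "\<And>x. x \<in> U \<Longrightarrow> vsupp n (en x)"
    and d0: "\<And>x. x \<in> U \<Longrightarrow> vder e0 (\<lambda>i. \<sigma> x * e1 x i) x"
    and d1: "\<And>x. x \<in> U \<Longrightarrow> vder e1 (\<lambda>i. \<sigma> x * (\<mu> x * e0 x i + en x i)) x"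
    and dn: "\<And>x. x \<in> U \<Longrightarrow> vder en (\<lambda>i. \<sigma> x * (\<mu> x * e1 x i + e2 x i)) x"
    and g: "\<And>x. x \<in> U \<Longrightarrow> bil n (e0 x) (e0 x) = 0" "\<And>x. x \<in> U \<Longrightarrow> bil n (e0 x) (e1 x) = 0"
      "\<And>x. x \<in> U \<Longrightarrow> bil n (e0 x) (en x) = -1" "\<And>x. x \<in> U \<Longrightarrow> bil n (e0 x) (e2 x) = 0"
      "\<And>x. x \<in> U \<Longrightarrow> bil n (e1 x) (e1 x) = 1" "\<And>x. x \<in> U \<Longrightarrow> bil n (e1 x) (en x) = 0"
      "\<And>x. x \<in> U \<Longrightarrow> bil n (e1 x) (e2 x) = 0" "\<And>x. x \<in> U \<Longrightarrow> bil n (en x) (en x) = 0"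
      "\<And>x. x \<in> U \<Longrightarrow> bil n (en x) (e2 x) = 0"

locale moving_frame = null_columns +
  assumes unit: "\<And>x. x \<in> U \<Longrightarrow> bil n (e2 x) (e2 x) = 1"

text \<open>Null vectors cannot serve as mirrors, so the pair \<open>e0\<close>, \<open>en\<close>
  is replaced by its timelike sum and its spacelike difference. Starting from the identity, the sum
  is turned into place, then the difference, then \<open>e1\<close>; each turn fixes what is already
  placed because its mirrors are orthogonal to that. Column n is the auxiliary direction of
  \<open>smooth_Mob_turn\<close>, and \<open>n \<ge> 2\<close> keeps it apart from column 1.\<close>

lemma (in null_columns) frame_with_columns3:
  assumes n: "n \<ge> 2" and x0: "x0 \<in> U" and p0: "e0 x0 0 + e0 x0 (n+1) > 0"
  obtains V e where "open V" "x0 \<in> V" "V \<subseteq> U" "smooth_Mob n V e"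
    "\<And>x. x \<in> V \<Longrightarrow> col (e x) 0 = e0 x" "\<And>x. x \<in> V \<Longrightarrow> col (e x) 1 = e1 x"
    "\<And>x. x \<in> V \<Longrightarrow> col (e x) (n+1) = en x"
proof -
  note U = oU x0 sm(1,2,4)
  have J: "Jm n 0 n = 0" "Jm n (n+1) n = 0" "Jm n 0 1 = 0" "Jm n (n+1) 1 = 0" "Jm n 1 n = 0" "Jm n 1 1 = 1"
    "Jm n 0 0 = 0" "Jm n (n+1) (n+1) = 0" "Jm n 0 (n+1) = -1" "Jm n (n+1) 0 = -1"
    using n by (auto simp: Jm_simps)
  define u1 where "u1 = (\<lambda>i. unitv 0 i + unitv (n+1) i)"
  define w1 where "w1 x = (\<lambda>i. e0 x i + en x i)" for x
  have u1w: "bil n u1 z = - (z 0 + z (n+1))" for z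
    by (simp add: u1_def bil_def unitv_def)
  have u1u1: "bil n u1 u1 = -2" unfolding u1w by (simp add: u1_def unitv_def)
  have w1w1: "bil n (w1 x) (w1 x) = -2" if "x \<in> U" for x
    using g(1,8,3)[OF that] by (simp add: w1_def bil_simps bil_commute[of n "en x" "e0 x"])
  have w1s: "vsmooth U w1" unfolding w1_def by (intro vsmooth_intros U)
  have sw: "vsupp n u1" "\<And>x. x \<in> U \<Longrightarrow> vsupp n (w1 x)"
    using supp by (auto simp: u1_def w1_def vsupp_def unitv_def)
  define V1 where "V1 = {x \<in> U. 1 + bil n u1 (w1 x) / (-2) > 0}"
  have u1s: "vsmooth U (\<lambda>x. u1)" by (simp add: vsmooth_def smooth_const U)
  have oV1: "open V1" unfolding V1_def
    by (rule open_positive_set[OF U(1)])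
       (rule smooth_continuous[OF U(1)], intro smooth_intros smooth_bil U u1s w1s, auto)
  have V1U: "V1 \<subseteq> U" by (auto simp: V1_def)
  \<comment> \<open>\<open>en\<close> inherits the future orientation of \<open>e0\<close>, so <u1,
    w1> is negative and stays away from 2, the value at which \<open>u1 + w1\<close> would be
    null.\<close>
  have x1: "x0 \<in> V1"
  proof -
    have "en x0 0 + en x0 (n+1) > 0"
      by (rule null_future[OF g(1)[OF U(2)] g(8)[OF U(2)] p0]) (use g(3)[OF U(2)] in simp)
    then show ?thesis using U(2) p0 by (simp add: V1_def u1w w1_def)
  qed
  define m1 where "m1 = (\<lambda>x i j. rotate_to n u1 (w1 x) (col (idm n) j) i)"
  have "smooth_Mob n V1 (\<lambda>x. idm n)" by (simp add: smooth_Mob_def idm_Mob smooth_const oV1)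
  then have m1: "smooth_Mob n V1 m1" unfolding m1_def
    by (rule smooth_Mob_rotate[OF oV1, where k = "-2"])
       (use V1U vsmooth_subset[OF u1s V1U] vsmooth_subset[OF w1s V1U] u1u1 w1w1 sw in \<open>auto simp: V1_def\<close>)
  have ci: "col (idm n) 0 = unitv 0" "col (idm n) (n+1) = unitv (n+1)"
    by (auto simp: col_def idm_def unitv_def)
  have ce1: "col (m1 x) j = rotate_to n u1 (w1 x) (col (idm n) j)" for x j by (simp add: m1_def col_def)
  have e1w: "(\<lambda>i. col (m1 x) 0 i + col (m1 x) (n+1) i) = w1 x" if "x \<in> V1" for x
  proof -
    have "rotate_to n u1 (w1 x) u1 = w1 x"
      using that by (intro rotate_to_maps[where k = "-2"]) (auto simp: u1u1 w1w1 V1_def)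
    moreover have "(\<lambda>i. col (m1 x) 0 i + col (m1 x) (n+1) i) = rotate_to n u1 (w1 x) (\<lambda>i. 1 * unitv 0 i + 1 * unitv (n+1) i)"
      unfolding rotate_to_lin ce1 ci by simp
    ultimately show ?thesis by (simp add: u1_def)
  qed
  define u2 where "u2 x = (\<lambda>i. col (m1 x) 0 i - col (m1 x) (n+1) i)" for x
  define w2 where "w2 x = (\<lambda>i. e0 x i - en x i)" for x
  note i1 = isom_col[OF smooth_Mob_iso[OF m1]]
  obtain V2 \<rho> where V2: "open V2" "x0 \<in> V2" "V2 \<subseteq> V1"
    and m2: "smooth_Mob n V2 (\<lambda>x i j. \<rho> x (col (m1 x) j) i)"
    and \<rho>: "\<And>x. x \<in> V2 \<Longrightarrow> \<rho> x (u2 x) = w2 x"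
    "\<And>x z. x \<in> V2 \<Longrightarrow> bil n z (u2 x) = 0 \<Longrightarrow> bil n z (w2 x) = 0 \<Longrightarrow> bil n z (col (m1 x) n) = 0 \<Longrightarrow> \<rho> x z = z"
    "\<And>x b c y z. \<rho> x (\<lambda>i. b * y i + c * z i) = (\<lambda>i. b * \<rho> x y i + c * \<rho> x z i)"
  proof (rule smooth_Mob_turn[OF oV1 x1 m1, of u2 w2 2])
    show "vsmooth V1 u2" unfolding u2_def by (intro vsmooth_intros oV1 smooth_Mob_col[OF m1])
    show "vsmooth V1 w2" unfolding w2_def
      by (intro vsmooth_intros oV1) (use U V1U in \<open>auto intro: vsmooth_subset\<close>)
    show "1 \<le> n" using n by simp
    show "vsupp n (u2 x)" "vsupp n (w2 x)" if "x \<in> V1" for x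
      using isom_vsupp[OF smooth_Mob_iso[OF m1 that]] supp V1U that unfolding u2_def w2_def
      by (intro vsupp_lin; blast)+
    show "bil n (u2 x) (u2 x) = 2" if "x \<in> V1" for x
      using i1[OF that] J by (simp add: u2_def bil_simps)
    show "bil n (w2 x) (w2 x) = 2" if "x \<in> V1" for x
      using g(1,3,8)[of x] that V1U by (auto simp: w2_def bil_simps bil_commute[of n "en x" "e0 x"])
    show "bil n (u2 x) (col (m1 x) n) = 0" if "x \<in> V1" for x
      using i1[OF that] J by (simp add: u2_def bil_simps)
  qed auto
  define m2 where "m2 = (\<lambda>x i j. \<rho> x (col (m1 x) j) i)"
  have ce2: "col (m2 x) j = \<rho> x (col (m1 x) j)" for x j by (simp add: m2_def col_def)
  have V2U: "V2 \<subseteq> U" using V2 V1U by blast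
  have c0n: "col (m2 x) 0 = e0 x" "col (m2 x) (n+1) = en x" if x: "x \<in> V2" for x
  proof -
    have xs: "x \<in> V1" "x \<in> U" using x V2 V1U by auto
    have w: "\<rho> x (w1 x) = w1 x"
    proof (rule \<rho>(2)[OF x])
      show "bil n (w1 x) (u2 x) = 0" "bil n (w1 x) (col (m1 x) n) = 0"
        unfolding e1w[OF xs(1), symmetric] u2_def using i1[OF xs(1)] J by (simp_all add: bil_simps)
      show "bil n (w1 x) (w2 x) = 0"
        using g(1,8,3)[OF xs(2)] by (simp add: w1_def w2_def bil_simps bil_commute[of n "en x" "e0 x"])
    qed
    have sd: "col (m1 x) 0 = (\<lambda>i. (1/2) * w1 x i + (1/2) * u2 x i)"
      "col (m1 x) (n+1) = (\<lambda>i. (1/2) * w1 x i + (-1/2) * u2 x i)"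
      unfolding e1w[OF xs(1), symmetric] u2_def by (auto simp: field_simps)
    show "col (m2 x) 0 = e0 x" "col (m2 x) (n+1) = en x"
      unfolding ce2 sd \<rho>(3) w \<rho>(1)[OF x] by (auto simp: w1_def w2_def field_simps)
  qed
  have m2': "smooth_Mob n V2 m2" using m2 unfolding m2_def .
  note i2 = isom_col[OF smooth_Mob_iso[OF m2']]
  obtain V3 \<tau> where V3: "open V3" "x0 \<in> V3" "V3 \<subseteq> V2"
    and m3: "smooth_Mob n V3 (\<lambda>x i j. \<tau> x (col (m2 x) j) i)"
    and \<tau>: "\<And>x. x \<in> V3 \<Longrightarrow> \<tau> x (col (m2 x) 1) = e1 x"
    "\<And>x z. x \<in> V3 \<Longrightarrow> bil n z (col (m2 x) 1) = 0 \<Longrightarrow> bil n z (e1 x) = 0 \<Longrightarrow> bil n z (col (m2 x) n) = 0 \<Longrightarrow> \<tau> x z = z"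
  proof (rule smooth_Mob_turn[OF V2(1,2) m2', of "\<lambda>x. col (m2 x) 1" e1 1])
    show "vsmooth V2 (\<lambda>x. col (m2 x) 1)" by (rule smooth_Mob_col[OF m2'])
    show "vsmooth V2 e1" using U(4) V2U by (rule vsmooth_subset)
    show "1 \<le> n" using n by simp
    show "vsupp n (col (m2 x) 1)" "vsupp n (e1 x)" if "x \<in> V2" for x
      using isom_vsupp[OF smooth_Mob_iso[OF m2' that]] supp V2U that by blast+
    show "bil n (col (m2 x) 1) (col (m2 x) 1) = 1" "bil n (e1 x) (e1 x) = 1"
      "bil n (col (m2 x) 1) (col (m2 x) n) = 0" if "x \<in> V2" for x
      using i2[OF that] J g(5)[of x] that V2U by auto
  qed auto
  define m3 where "m3 = (\<lambda>x i j. \<tau> x (col (m2 x) j) i)"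
  have ce3: "col (m3 x) j = \<tau> x (col (m2 x) j)" for x j by (simp add: m3_def col_def)
  show thesis
  proof (rule that[OF V3(1,2)])
    show "V3 \<subseteq> U" using V3 V2U by blast
    show "smooth_Mob n V3 m3" using m3 by (simp add: m3_def)
    fix x assume x: "x \<in> V3"
    then have xs: "x \<in> V2" "x \<in> U" using V3 V2U by auto
    show "col (m3 x) 1 = e1 x" unfolding ce3 by (rule \<tau>(1)[OF x])
    show "col (m3 x) 0 = e0 x" unfolding ce3 c0n[OF xs(1)]
      by (rule \<tau>(2)[OF x]) (use i2[OF xs(1)] J g(2)[OF xs(2)] in \<open>simp_all flip: c0n(1)[OF xs(1)]\<close>)
    show "col (m3 x) (n+1) = en x" unfolding ce3 c0n[OF xs(1)]
      by (rule \<tau>(2)[OF x]) (use i2[OF xs(1)] J g(6)[OF xs(2)] bil_commute[of n "en x" "e1 x"] in \<open>simp_all flip: c0n(2)[OF xs(1)]\<close>)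
  qed
qed

lemma (in moving_frame) frame_with_columns4:
  assumes n: "n \<ge> 3" and x0: "x0 \<in> U" and p0: "e0 x0 0 + e0 x0 (n+1) > 0"
  obtains V e where "open V" "x0 \<in> V" "V \<subseteq> U" "smooth_Mob n V e"
    "\<And>x. x \<in> V \<Longrightarrow> col (e x) 0 = e0 x" "\<And>x. x \<in> V \<Longrightarrow> col (e x) 1 = e1 x"
    "\<And>x. x \<in> V \<Longrightarrow> col (e x) (n+1) = en x" "\<And>x. x \<in> V \<Longrightarrow> col (e x) 2 = e2 x"
proof -
  have "n \<ge> 2" using n by simp
  from frame_with_columns3[OF this x0 p0]
  obtain V e where V: "open V" "x0 \<in> V" "V \<subseteq> U" and e: "smooth_Mob n V e"
    and c: "\<And>x. x \<in> V \<Longrightarrow> col (e x) 0 = e0 x" "\<And>x. x \<in> V \<Longrightarrow> col (e x) 1 = e1 x"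
      "\<And>x. x \<in> V \<Longrightarrow> col (e x) (n+1) = en x" by blast
  have J: "Jm n 2 n = 0" "Jm n 2 2 = 1" "Jm n 0 2 = 0" "Jm n 1 2 = 0" "Jm n (n+1) 2 = 0"
    "Jm n 0 n = 0" "Jm n 1 n = 0" "Jm n (n+1) n = 0"
    using n by (auto simp: Jm_simps)
  note i2 = isom_col[OF smooth_Mob_iso[OF e]]
  obtain V3 \<tau> where V3: "open V3" "x0 \<in> V3" "V3 \<subseteq> V"
    and m3: "smooth_Mob n V3 (\<lambda>x i j. \<tau> x (col (e x) j) i)"
    and \<tau>: "\<And>x. x \<in> V3 \<Longrightarrow> \<tau> x (col (e x) 2) = e2 x"
    "\<And>x z. x \<in> V3 \<Longrightarrow> bil n z (col (e x) 2) = 0 \<Longrightarrow> bil n z (e2 x) = 0 \<Longrightarrow> bil n z (col (e x) n) = 0 \<Longrightarrow> \<tau> x z = z"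
  proof (rule smooth_Mob_turn[OF V(1,2) e, of "\<lambda>x. col (e x) 2" e2 1])
    show "vsmooth V (\<lambda>x. col (e x) 2)" by (rule smooth_Mob_col[OF e])
    show "vsmooth V e2" using sm(3) V(3) by (rule vsmooth_subset)
    show "1 \<le> n" using n by simp
    show "vsupp n (col (e x) 2)" "vsupp n (e2 x)" if "x \<in> V" for x
      using isom_vsupp[OF smooth_Mob_iso[OF e that]] supp V that by blast+
    show "bil n (col (e x) 2) (col (e x) 2) = 1" "bil n (e2 x) (e2 x) = 1"
      "bil n (col (e x) 2) (col (e x) n) = 0" if "x \<in> V" for x
      using i2[OF that] J n unit[of x] that V by auto
  qed auto
  define m3 where "m3 = (\<lambda>x i j. \<tau> x (col (e x) j) i)"
  have ce3: "col (m3 x) j = \<tau> x (col (e x) j)" for x j by (simp add: m3_def col_def)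
  show thesis
  proof (rule that[OF V3(1,2)])
    show "V3 \<subseteq> U" using V3 V by blast
    show "smooth_Mob n V3 m3" using m3 by (simp add: m3_def)
    fix x assume x: "x \<in> V3"
    then have xs: "x \<in> V" "x \<in> U" using V3 V by auto
    show "col (m3 x) 2 = e2 x" unfolding ce3 by (rule \<tau>(1)[OF x])
    show "col (m3 x) 0 = e0 x" unfolding ce3 c[OF xs(1)]
      by (rule \<tau>(2)[OF x]) (use i2[OF xs(1)] J n g(4)[OF xs(2)] in \<open>simp_all flip: c(1)[OF xs(1)]\<close>)
    show "col (m3 x) 1 = e1 x" unfolding ce3 c[OF xs(1)]
      by (rule \<tau>(2)[OF x]) (use i2[OF xs(1)] J n g(7)[OF xs(2)] in \<open>simp_all flip: c(2)[OF xs(1)]\<close>)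
    show "col (m3 x) (n+1) = en x" unfolding ce3 c[OF xs(1)]
      by (rule \<tau>(2)[OF x]) (use i2[OF xs(1)] J n g(9)[OF xs(2)] in \<open>simp_all flip: c(3)[OF xs(1)]\<close>)
  qed
qed

subsection \<open>The arclength density through null lifts\<close>

text \<open>In the basis \<open>e0\<close>, \<open>e1\<close>, \<open>en\<close>, \<open>p\<close>
  the jet of \<open>F\<close> is triangular with diagonal r, r \<beta>, r \<beta>^2, r \<beta>^2,
  hence \<open>curv4_triangular\<close> applies with s = \<beta>^2. The hypotheses are shaped to
  cover second order frames, the canonical columns, and the fields \<open>w0\<close>,
  \<open>w1\<close>, \<open>w2\<close> of a variation.\<close>

lemma curv4_moving:
  assumes U: "open U" "x \<in> U" and sm: "smooth_on_R U \<alpha>" "smooth_on_R U \<beta>" "smooth_on_R U \<gamma>" "smooth_on_R U r"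
    and d0: "\<And>y. y \<in> U \<Longrightarrow> vder e0 (\<lambda>i. \<alpha> y * e0 y i + \<beta> y * e1 y i) y"
    and d1: "\<And>y. y \<in> U \<Longrightarrow> vder e1 (\<lambda>i. \<gamma> y * e0 y i + \<beta> y * en y i) y"
    and dn: "\<And>y. y \<in> U \<Longrightarrow> vder en (\<lambda>i. \<gamma> y * e1 y i + p y i - \<alpha> y * en y i) y"
    and nz: "\<beta> x \<noteq> 0" "r x \<noteq> 0" and g: "bil n (e0 x) (e0 x) = 0" "bil n (e0 x) (e1 x) = 0"
    and F: "\<And>y. y \<in> U \<Longrightarrow> F y = (\<lambda>i. r y * e0 y i)"
  shows "curv4 n (F x) (vderiv F x) (vderiv (vderiv F) x) (vderiv (vderiv (vderiv F)) x)
      = (\<beta> x)\<^sup>2 * curv4 n (e0 x) (e1 x) (en x) (p x)"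
proof -
  define a b where "a = (\<lambda>y. deriv r y + r y * \<alpha> y)" and "b = (\<lambda>y. r y * \<beta> y)"
  define A B C where "A = (\<lambda>y. deriv a y + a y * \<alpha> y + b y * \<gamma> y)"
    and "B = (\<lambda>y. a y * \<beta> y + deriv b y)" and "C = (\<lambda>y. b y * \<beta> y)"
  have sab: "smooth_on_R U a" "smooth_on_R U b"
    unfolding a_def b_def by (intro smooth_intros U sm)+
  have sABC: "smooth_on_R U A" "smooth_on_R U B" "smooth_on_R U C"
    unfolding A_def B_def C_def by (intro smooth_intros U sm sab)+
  note D = smooth_DERIV[OF U(1)]
  have 1: "vderiv F y = (\<lambda>i. a y * e0 y i + b y * e1 y i)" if y: "y \<in> U" for y
  proof (rule vder_imp_vderiv, rule vder_transform[OF U(1) y])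
    have "vder (\<lambda>y i. r y * e0 y i) (\<lambda>i. deriv r y * e0 y i + r y * (\<alpha> y * e0 y i + \<beta> y * e1 y i)) y"
      by (intro vder_scale D sm y d0)
    then show "vder (\<lambda>y i. r y * e0 y i) (\<lambda>i. a y * e0 y i + b y * e1 y i) y"
      by (simp add: a_def b_def algebra_simps)
  qed (simp add: F)
  have 2: "vderiv (vderiv F) y = (\<lambda>i. A y * e0 y i + B y * e1 y i + C y * en y i)" if y: "y \<in> U" for y
  proof (rule vder_imp_vderiv, rule vder_transform[OF U(1) y])
    have "vder (\<lambda>y i. a y * e0 y i + b y * e1 y i)
      (\<lambda>i. (deriv a y * e0 y i + a y * (\<alpha> y * e0 y i + \<beta> y * e1 y i)) +
           (deriv b y * e1 y i + b y * (\<gamma> y * e0 y i + \<beta> y * en y i))) y"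
      by (intro vder_add vder_scale D sab y d0 d1)
    then show "vder (\<lambda>y i. a y * e0 y i + b y * e1 y i) (\<lambda>i. A y * e0 y i + B y * e1 y i + C y * en y i) y"
      by (simp add: A_def B_def C_def algebra_simps)
  qed (simp add: 1)
  have 3: "vderiv (vderiv (vderiv F)) x = (\<lambda>i. (deriv A x + A x * \<alpha> x + B x * \<gamma> x) * e0 x i
      + (A x * \<beta> x + deriv B x + C x * \<gamma> x) * e1 x i + (B x * \<beta> x + deriv C x - C x * \<alpha> x) * en x i + C x * p x i)"
  proof (rule vder_imp_vderiv, rule vder_transform[OF U])
    have "vder (\<lambda>y i. A y * e0 y i + B y * e1 y i + C y * en y i)
      (\<lambda>i. (deriv A x * e0 x i + A x * (\<alpha> x * e0 x i + \<beta> x * e1 x i)) +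
           (deriv B x * e1 x i + B x * (\<gamma> x * e0 x i + \<beta> x * en x i)) +
           (deriv C x * en x i + C x * (\<gamma> x * e1 x i + p x i - \<alpha> x * en x i))) x"
      by (intro vder_add vder_scale D sABC U d0 d1 dn)
    then show "vder (\<lambda>y i. A y * e0 y i + B y * e1 y i + C y * en y i)
       (\<lambda>i. (deriv A x + A x * \<alpha> x + B x * \<gamma> x) * e0 x i
      + (A x * \<beta> x + deriv B x + C x * \<gamma> x) * e1 x i + (B x * \<beta> x + deriv C x - C x * \<alpha> x) * en x i + C x * p x i) x"
      by (simp add: algebra_simps)
  qed (simp add: 2)
  show ?thesis
    unfolding 3 2[OF U(2)] 1[OF U(2)] F[OF U(2)]
    by (rule curv4_triangular[OF g refl refl refl refl])
       (use nz in \<open>auto simp: b_def C_def power_mult_distrib power2_eq_square numeral_eq_Suc\<close>)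
qed

text \<open>The Gram matrix splits into a hyperbolic plane, a unit vector and \<open>p\<close>, so
  its determinant is -<p,p>; this is the reason for the sign in \<open>curv4\<close>.\<close>

lemma curv4_orthogonal:
  assumes "bil n e0 e0 = 0" "bil n en en = 0" "bil n e0 en = -1" "bil n e1 e1 = 1"
    "bil n e0 e1 = 0" "bil n e1 en = 0" "bil n e0 p = 0" "bil n e1 p = 0" "bil n en p = 0"
  shows "curv4 n e0 e1 en p = bil n p p"
  using assms by (simp add: curv4_def gram4_def sym_det4_def)

text \<open>Meaningful for classes of null vectors, on which \<open>v 0 + v (n+1)\<close> never vanishes. Unlike an
arbitrary lift this one is globally defined and does not move where a variation is at rest.\<close>
definition nlift :: "nat \<Rightarrow> (nat \<Rightarrow> real) set \<Rightarrow> nat \<Rightarrow> real" where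
  "nlift n S = (SOME v. v \<in> S \<and> v 0 + v (n+1) = 1)"

text \<open>The hyperplane on which the two end coordinates add up to 0 is spacelike: the form is
  the sum of the v_A^2 plus 2 v_0^2 there. It meets the null cone only at the origin, so one affine
  chart contains all null directions.\<close>

lemma nullvec_sum_nonzero:
  assumes "nullvec n v"
  shows "v 0 + v (n+1) \<noteq> 0"
proof
  assume z: "v 0 + v (n+1) = 0"
  then have vn: "v (n+1) = - v 0" by simp
  have "bil n v v = 0" using assms by (simp add: nullvec_def)
  then have "(\<Sum>A=1..n. (v A)\<^sup>2) + 2 * (v 0)\<^sup>2 = 0"
    unfolding bil_def vn by (simp add: power2_eq_square)
  moreover have "(\<Sum>A=1..n. (v A)\<^sup>2) \<ge> 0" by (rule sum_nonneg) simp
  ultimately have v0: "v 0 = 0" and "(\<Sum>A=1..n. (v A)\<^sup>2) = 0"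
    by (smt (verit) zero_le_power2 zero_eq_power2)+
  then have "\<forall>A\<in>{1..n}. v A = 0" by (subst (asm) sum_nonneg_eq_0_iff) auto
  moreover have "\<forall>i\<ge>n+2. v i = 0" using assms by (simp add: nullvec_def vsupp_def)
  ultimately have "v i = 0" for i
    using v0 vn by (cases "i = 0"; cases "i = n + 1"; cases "i \<le> n") auto
  then show False using assms by (auto simp: nullvec_def)
qed

lemma nlift_proj:
  assumes "nullvec n v"
  shows "nlift n (proj v) = (\<lambda>i. v i / (v 0 + v (n+1)))"
proof -
  note nz = nullvec_sum_nonzero[OF assms]
  have "\<exists>w. w \<in> proj v \<and> w 0 + w (n+1) = 1"
    using nz by (intro exI[of _ "\<lambda>i. (1 / (v 0 + v (n+1))) * v i"])
      (auto simp: proj_def simp flip: add_divide_distrib intro!: exI[of _ "1 / (v 0 + v (n+1))"])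
  then have "nlift n (proj v) \<in> proj v \<and> nlift n (proj v) 0 + nlift n (proj v) (n+1) = 1"
    unfolding nlift_def by (rule someI_ex)
  then obtain c where c: "nlift n (proj v) = (\<lambda>i. c * v i)" "c * v 0 + c * v (n+1) = 1"
    by (auto simp: proj_def)
  have "c = 1 / (v 0 + v (n+1))" using c(2) nz by (simp add: field_simps)
  then show ?thesis using c(1) by simp
qed

lemma nullvec_scale: "nullvec n v \<Longrightarrow> c \<noteq> 0 \<Longrightarrow> nullvec n (\<lambda>i. c * v i)"
  by (auto simp: nullvec_def vsupp_def bil_simps fun_eq_iff)

lemma proj_scale:
  assumes "c \<noteq> 0"
  shows "proj (\<lambda>i. c * v i) = proj v"
proof -
  have "\<exists>d. (\<lambda>i. k * (c * v i)) = (\<lambda>i. d * v i) \<and> d \<noteq> 0" if "k \<noteq> 0" for k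
    using that assms by (intro exI[of _ "k * c"]) (auto simp: mult.assoc)
  moreover have "\<exists>d. (\<lambda>i. k * v i) = (\<lambda>i. d * (c * v i)) \<and> d \<noteq> 0" if "k \<noteq> 0" for k
    using that assms by (intro exI[of _ "k / c"]) auto
  ultimately show ?thesis by (auto simp: proj_def)
qed

lemma nlift_props:
  assumes "nullvec n v"
  shows "nullvec n (nlift n (proj v))" "proj (nlift n (proj v)) = proj v"
    "nlift n (proj v) 0 + nlift n (proj v) (n+1) = 1"
proof -
  note nz = nullvec_sum_nonzero[OF assms]
  have e: "nlift n (proj v) = (\<lambda>i. (1 / (v 0 + v (n+1))) * v i)" by (simp add: nlift_proj[OF assms])
  show "nullvec n (nlift n (proj v))" unfolding e by (rule nullvec_scale[OF assms]) (use nz in simp)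
  show "proj (nlift n (proj v)) = proj v" unfolding e using nz by (intro proj_scale) auto
  show "nlift n (proj v) 0 + nlift n (proj v) (n+1) = 1"
    unfolding e using nz by (simp flip: add_divide_distrib)
qed

lemma immersion_local_lift:
  assumes "immersion n I f" "x \<in> I"
  shows "\<exists>U F. open U \<and> x \<in> U \<and> U \<subseteq> I \<and> vsmooth U F \<and>
      (\<forall>y\<in>U. nullvec n (F y) \<and> proj (F y) = f y \<and> (\<forall>c. vderiv F y \<noteq> (\<lambda>i. c * F y i)))"
  using assms unfolding immersion_def vsmooth_def vderiv_def by blast

text \<open>The derivative of the normalised lift lies in the spacelike hyperplane of
  \<open>nullvec_sum_nonzero\<close>, so its norm is positive unless it vanishes. If it vanished,
  the derivative of the given local lift would be a multiple of that lift, which the immersion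
  condition excludes.\<close>

lemma immersion_nlift:
  assumes "open I" "immersion n I f"
  shows "vsmooth I (\<lambda>y. nlift n (f y))"
    "\<And>y. y \<in> I \<Longrightarrow> nullvec n (nlift n (f y))"
    "\<And>y. y \<in> I \<Longrightarrow> proj (nlift n (f y)) = f y"
    "\<And>y. y \<in> I \<Longrightarrow> nlift n (f y) 0 + nlift n (f y) (n+1) = 1"
    "\<And>y. y \<in> I \<Longrightarrow> bil n (vderiv (\<lambda>y. nlift n (f y)) y) (vderiv (\<lambda>y. nlift n (f y)) y) > 0"
proof -
  let ?N = "\<lambda>y. nlift n (f y)"
  note loc = immersion_local_lift[OF assms(2)]
  show nv: "nullvec n (?N y)" "proj (?N y) = f y" "?N y 0 + ?N y (n+1) = 1" if "y \<in> I" for y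
  proof -
    from loc[OF that] obtain F where F: "nullvec n (F y)" "proj (F y) = f y" by blast
    show "nullvec n (?N y)" "proj (?N y) = f y" "?N y 0 + ?N y (n+1) = 1"
      using nlift_props[OF F(1)] F(2) by auto
  qed
  have sF: "vsmooth U ?N \<and> (\<forall>y\<in>U. ?N y = (\<lambda>i. F y i / (F y 0 + F y (n+1))))"
    if U: "open U" "vsmooth U F" "\<forall>y\<in>U. nullvec n (F y) \<and> proj (F y) = f y" for U F
  proof -
    have e: "?N y = (\<lambda>i. F y i / (F y 0 + F y (n+1)))" if "y \<in> U" for y
      using U(3) that nlift_proj by metis
    have "vsmooth U (\<lambda>y i. F y i / (F y 0 + F y (n+1)))"
      using U nullvec_sum_nonzero unfolding vsmooth_def by (intro allI smooth_intros) auto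
    then have "vsmooth U ?N" by (rule vsmooth_cong[OF U(1), rotated]) (use e in auto)
    then show ?thesis using e by blast
  qed
  show sm: "vsmooth I ?N"
    unfolding vsmooth_def
  proof (intro allI smooth_local[OF assms(1)])
    fix i x assume "x \<in> I"
    from loc[OF this] sF show "\<exists>V. open V \<and> x \<in> V \<and> smooth_on_R V (\<lambda>x. ?N x i)"
      unfolding vsmooth_def by blast
  qed
  fix y assume y: "y \<in> I"
  obtain U F where U: "open U" "y \<in> U" "U \<subseteq> I" "vsmooth U F"
      "\<forall>y\<in>U. nullvec n (F y) \<and> proj (F y) = f y" "\<And>c. vderiv F y \<noteq> (\<lambda>i. c * F y i)"
    using loc[OF y] by blast
  define d where "d = vderiv ?N y"
  have vd: "vder ?N d y" unfolding d_def by (rule vsmooth_vder[OF assms(1) sm y])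
  have "((\<lambda>y. ?N y 0 + ?N y (n+1)) has_real_derivative d 0 + d (n+1)) (at y)"
    using vd by (intro DERIV_add) (auto simp: vder_def)
  then have "((\<lambda>y. 1) has_real_derivative d 0 + d (n+1)) (at y)"
    by (rule DERIV_transform_open[OF assms(1) y, rotated]) (use nv in auto)
  then have d0: "d 0 + d (n+1) = 0" using DERIV_unique[OF _ DERIV_const] by blast
  have dsupp: "vsupp n d" by (rule vder_vsupp[OF assms(1) y _ vd]) (use nv in \<open>auto simp: nullvec_def\<close>)
  have "bil n d d = (\<Sum>A=1..n. (d A)\<^sup>2) + 2 * (d 0)\<^sup>2"
    using d0 by (simp add: bil_def power2_eq_square eq_neg_iff_add_eq_0[symmetric] add.commute)
  moreover have "d \<noteq> (\<lambda>i. 0)"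
  proof
    assume dz: "d = (\<lambda>i. 0)"
    define s where "s = (\<lambda>y. F y 0 + F y (n+1))"
    have ss: "smooth_on_R U s" unfolding s_def using U by (intro smooth_intros) (auto simp: vsmooth_def)
    have nz: "s y \<noteq> 0" if "y \<in> U" for y using U(5) that nullvec_sum_nonzero by (auto simp: s_def)
    have Fe: "F y = (\<lambda>i. s y * ?N y i)" if "y \<in> U" for y
      using sF[OF U(1,4,5)] that nz by (auto simp: s_def)
    have "vder (\<lambda>y i. s y * ?N y i) (\<lambda>i. deriv s y * ?N y i + s y * d i) y"
      by (intro vder_scale smooth_DERIV[OF U(1) ss U(2)] vd)
    then have "vder F (\<lambda>i. deriv s y * ?N y i + s y * d i) y"
      by (rule vder_transform[OF U(1,2), rotated]) (simp add: Fe)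
    then have "vderiv F y = (\<lambda>i. (deriv s y / s y) * F y i)"
      using vder_imp_vderiv Fe[OF U(2)] nz[OF U(2)] dz by (auto simp: fun_eq_iff)
    then show False using U(6) by blast
  qed
  ultimately have "bil n d d > 0"
  proof -
    assume e: "bil n d d = (\<Sum>A=1..n. (d A)\<^sup>2) + 2 * (d 0)\<^sup>2" and nz: "d \<noteq> (\<lambda>i. 0)"
    have n1: "(\<Sum>A=1..n. (d A)\<^sup>2) \<ge> 0" by (rule sum_nonneg) simp
    show ?thesis
    proof (rule ccontr)
      assume "\<not> ?thesis"
      then have "(\<Sum>A=1..n. (d A)\<^sup>2) = 0" and z: "d 0 = 0"
        using n1 e by (smt (verit) zero_le_power2 zero_eq_power2)+
      then have "\<forall>A\<in>{1..n}. d A = 0" by (subst (asm) sum_nonneg_eq_0_iff) auto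
      then have "d i = 0" for i
        using z d0 dsupp by (cases "i = 0"; cases "i = n + 1"; cases "i \<le> n") (auto simp: vsupp_def)
      then show False using nz by auto
    qed
  qed
  then show "bil n (vderiv ?N y) (vderiv ?N y) > 0" by (simp add: d_def)
qed

definition lift_curv :: "nat \<Rightarrow> (real \<Rightarrow> (nat \<Rightarrow> real) set) \<Rightarrow> real \<Rightarrow> real" where
  "lift_curv n f x = (let N = (\<lambda>y. nlift n (f y)) in
     curv4 n (N x) (vderiv N x) (vderiv (vderiv N) x) (vderiv (vderiv (vderiv N)) x))"

text \<open>The operator D of the overview when \<sigma> is the coefficient of ds.\<close>

definition dop :: "(real \<Rightarrow> real) \<Rightarrow> (real \<Rightarrow> nat \<Rightarrow> real) \<Rightarrow> real \<Rightarrow> nat \<Rightarrow> real" where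
  "dop \<sigma> u x = (\<lambda>i. vderiv u x i / \<sigma> x)"

lemma vsmooth_dop:
  "open U \<Longrightarrow> vsmooth U u \<Longrightarrow> smooth_on_R U \<sigma> \<Longrightarrow> (\<And>x. x \<in> U \<Longrightarrow> \<sigma> x \<noteq> 0) \<Longrightarrow> vsmooth U (dop \<sigma> u)"
  using vsmooth_vderiv[of U u] unfolding vsmooth_def dop_def by (intro allI smooth_divide) auto

lemma vder_dop:
  "open U \<Longrightarrow> vsmooth U u \<Longrightarrow> x \<in> U \<Longrightarrow> \<sigma> x \<noteq> 0 \<Longrightarrow> vder u (\<lambda>i. \<sigma> x * dop \<sigma> u x i) x"
  using vsmooth_vder[of U u x] by (simp add: dop_def)

lemma dop_eqI: "vder u (\<lambda>i. \<sigma> x * d i) x \<Longrightarrow> \<sigma> x \<noteq> 0 \<Longrightarrow> dop \<sigma> u x = d"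
  using vder_imp_vderiv[of u] by (auto simp: dop_def)

subsection \<open>Structure equations of frames\<close>

text \<open>The Maurer-Cartan form with its upper index lowered. In this shape the Lie algebra
  relations are plain skew-symmetry, and \<open>phi_omega\<close> carries them over to
  \<open>phi\<close>.\<close>

definition omega :: "nat \<Rightarrow> (real \<Rightarrow> nat \<Rightarrow> nat \<Rightarrow> real) \<Rightarrow> nat \<Rightarrow> nat \<Rightarrow> real \<Rightarrow> real" where
  "omega n e d b x = bil n (col (e x) d) (vderiv (\<lambda>y. col (e y) b) x)"

lemma phi_omega:
  "phi n e 0 b x = - omega n e (n+1) b x"
  "phi n e (n+1) b x = - omega n e 0 b x"
  "1 \<le> A \<Longrightarrow> A \<le> n \<Longrightarrow> phi n e A b x = omega n e A b x"
proof -
  have *: "phi n e a b x = lower n (\<lambda>d. omega n e d b x) a" if "a < n + 2" for a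
    unfolding phi_def omega_def vderiv_def col_def[of _ b] by (rule Jm_lower[OF that])
  show "phi n e 0 b x = - omega n e (n+1) b x" "phi n e (n+1) b x = - omega n e 0 b x"
    "1 \<le> A \<Longrightarrow> A \<le> n \<Longrightarrow> phi n e A b x = omega n e A b x"
    by (auto simp: * lower_def)
qed

lemma omega_skew:
  assumes "open U" "smooth_Mob n U e" "x \<in> U" "b < n + 2" "d < n + 2"
  shows "omega n e d b x = - omega n e b d x"
proof -
  note v = vsmooth_vder[OF assms(1) smooth_Mob_col[OF assms(2)] assms(3)]
  have "((\<lambda>y. bil n (col (e y) d) (col (e y) b)) has_real_derivative
     bil n (vderiv (\<lambda>y. col (e y) d) x) (col (e x) b) + bil n (col (e x) d) (vderiv (\<lambda>y. col (e y) b) x)) (at x)"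
    by (rule bil_DERIV[OF v v])
  then have "((\<lambda>y. Jm n d b) has_real_derivative
     bil n (vderiv (\<lambda>y. col (e y) d) x) (col (e x) b) + bil n (col (e x) d) (vderiv (\<lambda>y. col (e y) b) x)) (at x)"
    by (rule DERIV_transform_open[OF assms(1,3), rotated])
       (use isom_col[OF smooth_Mob_iso[OF assms(2)] assms(5,4)] in auto)
  from DERIV_unique[OF this DERIV_const] show ?thesis
    by (simp add: omega_def bil_commute[of n "vderiv (\<lambda>y. col (e y) d) x"])
qed

lemma frame_vder:
  assumes "open U" "smooth_Mob n U e" "x \<in> U"
  shows "vder (\<lambda>y. col (e y) b) (\<lambda>i. phi n e 0 b x * col (e x) 0 i
     + (\<Sum>A=1..n. phi n e A b x * col (e x) A i) + phi n e (n+1) b x * col (e x) (n+1) i) x"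
proof -
  let ?d = "vderiv (\<lambda>y. col (e y) b) x"
  have v: "vder (\<lambda>y. col (e y) b) ?d x"
    by (rule vsmooth_vder[OF assms(1) smooth_Mob_col[OF assms(2)] assms(3)])
  have "vsupp n ?d"
    by (rule vder_vsupp[OF assms(1,3) _ v]) (rule isom_vsupp[OF smooth_Mob_iso[OF assms(2)]])
  from isom_expand[OF smooth_Mob_iso[OF assms(2,3)] this]
  have "?d = (\<lambda>i. \<Sum>a<n+2. phi n e a b x * col (e x) a i)"
    unfolding phi_def vderiv_def col_def .
  then show ?thesis using v unfolding sum_split_ends by simp
qed

lemma smooth_phi:
  assumes "open U" "smooth_Mob n U e"
  shows "smooth_on_R U (phi n e a b)"
proof -
  have "smooth_on_R U (\<lambda>x. \<Sum>d<n+2. Jm n a d * bil n (col (e x) d) (vderiv (\<lambda>y. col (e y) b) x))"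
    by (intro smooth_intros smooth_bil vsmooth_intros smooth_Mob_col[OF assms(2)] assms)
  then show ?thesis by (simp only: phi_def[abs_def] vderiv_def col_def[of _ b])
qed

lemma frame_smooth_Mob: "frame n I f U e \<Longrightarrow> smooth_Mob n U e"
  by (simp add: frame_def smooth_Mob_def)

lemma second_orderD:
  assumes "second_order_frame n I f U e"
  shows "open U" "smooth_Mob n U e" "U \<subseteq> I" "\<And>y. y \<in> U \<Longrightarrow> proj (col (e y) 0) = f y"
proof -
  have "frame n I f U e" using assms by (simp add: second_order_frame_def)
  then show "open U" "smooth_Mob n U e" "U \<subseteq> I" "\<And>y. y \<in> U \<Longrightarrow> proj (col (e y) 0) = f y"
    using frame_smooth_Mob[of n I f U e] by (auto simp: frame_def)
qed

lemma frame_nullvec: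
  assumes "isom n M"
  shows "nullvec n (col M 0)"
proof -
  have "bil n (col M 0) (col M (n+1)) = -1" "bil n (col M 0) (col M 0) = 0"
    using isom_col[OF assms, of 0 "n+1"] isom_col[OF assms, of 0 0] by (auto simp: Jm_simps)
  then show ?thesis using isom_vsupp[OF assms, of 0]
    by (auto simp: nullvec_def bil_zero_left)
qed

lemma second_order_vder:
  assumes "n \<ge> 1" and so: "second_order_frame n I f U e" and x: "x \<in> U"
  shows "vder (\<lambda>y. col (e y) 0) (\<lambda>i. phi n e 0 0 x * col (e x) 0 i + phi n e 1 0 x * col (e x) 1 i) x"
    "vder (\<lambda>y. col (e y) 1) (\<lambda>i. phi n e 0 1 x * col (e x) 0 i + phi n e 1 0 x * col (e x) (n+1) i) x"
    "vder (\<lambda>y. col (e y) (n+1)) (\<lambda>i. phi n e 0 1 x * col (e x) 1 i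
       + (\<Sum>\<alpha>=2..n. phi n e 0 \<alpha> x * col (e x) \<alpha> i) - phi n e 0 0 x * col (e x) (n+1) i) x"
proof -
  note U = second_orderD(1,2)[OF so]
  have z: "phi n e \<alpha> 0 x = 0" "phi n e \<alpha> 1 x = 0" if "\<alpha> \<in> {2..n}" for \<alpha>
    using so x that by (auto simp: second_order_frame_def)
  have split: "(\<Sum>A=1..n. g A) = g 1 + (\<Sum>\<alpha>=2..n. g \<alpha>)" for g :: "nat \<Rightarrow> real"
    using sum.atLeast_Suc_atMost[OF assms(1), of g] by (simp add: numeral_2_eq_2)
  note sk = omega_skew[OF U x]
  have o00: "omega n e 0 0 x = 0" using sk[of 0 0] by simp
  have o11: "phi n e 1 1 x = 0" using sk[of 1 1] assms(1) phi_omega(3)[of 1 n e 1 x] by simp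
  have n10: "phi n e (n+1) 1 x = phi n e 1 0 x"
    using sk[of 0 1] phi_omega(2)[of n e 1 x] phi_omega(3)[of 1 n e 0 x] assms(1) by simp
  have onn: "phi n e 0 (n+1) x = 0" using sk[of "n+1" "n+1"] phi_omega(1)[of n e "n+1" x] by simp
  have nn: "phi n e (n+1) (n+1) x = - phi n e 0 0 x"
    using sk[of 0 "n+1"] phi_omega(2)[of n e "n+1" x] phi_omega(1)[of n e 0 x] by simp
  have An: "phi n e A (n+1) x = phi n e 0 A x" if "1 \<le> A" "A \<le> n" for A
    using sk[of A "n+1"] that phi_omega(1)[of n e A x] phi_omega(3)[of A n e "n+1" x] by simp
  have n0: "phi n e (n+1) 0 x = 0" using o00 phi_omega(2)[of n e 0 x] by simp
  show "vder (\<lambda>y. col (e y) 0) (\<lambda>i. phi n e 0 0 x * col (e x) 0 i + phi n e 1 0 x * col (e x) 1 i) x"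
    using frame_vder[OF U x, of 0] unfolding n0 split by (simp add: z)
  show "vder (\<lambda>y. col (e y) 1) (\<lambda>i. phi n e 0 1 x * col (e x) 0 i + phi n e 1 0 x * col (e x) (n+1) i) x"
    using frame_vder[OF U x, of 1] unfolding n10 split o11 by (simp add: z[unfolded One_nat_def])
  have "(\<Sum>\<alpha>=2..n. phi n e \<alpha> (n+1) x * col (e x) \<alpha> i) = (\<Sum>\<alpha>=2..n. phi n e 0 \<alpha> x * col (e x) \<alpha> i)" for i
    by (rule sum.cong) (auto simp only: An atLeastAtMost_iff)
  then show "vder (\<lambda>y. col (e y) (n+1)) (\<lambda>i. phi n e 0 1 x * col (e x) 1 i
       + (\<Sum>\<alpha>=2..n. phi n e 0 \<alpha> x * col (e x) \<alpha> i) - phi n e 0 0 x * col (e x) (n+1) i) x"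
    using frame_vder[OF U x, of "n+1"] An[OF order_refl assms(1)] unfolding nn onn split by simp
qed

lemma isom_col_sum:
  assumes "isom n M" "S \<subseteq> {1..n}"
  shows "d < n + 2 \<Longrightarrow> bil n (col M d) (\<lambda>i. \<Sum>\<alpha>\<in>S. c \<alpha> * col M \<alpha> i) = (if d \<in> S then c d else 0)"
    "bil n (\<lambda>i. \<Sum>\<alpha>\<in>S. c \<alpha> * col M \<alpha> i) (\<lambda>i. \<Sum>\<alpha>\<in>S. c \<alpha> * col M \<alpha> i) = (\<Sum>\<alpha>\<in>S. (c \<alpha>)\<^sup>2)"
proof -
  have fin: "finite S" using assms(2) finite_subset by blast
  have *: "bil n (col M d) (\<lambda>i. \<Sum>\<alpha>\<in>S. c \<alpha> * col M \<alpha> i) = (if d \<in> S then c d else 0)"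
    if d: "d < n + 2" for d
  proof -
    have "bil n (col M d) (\<lambda>i. \<Sum>\<alpha>\<in>S. c \<alpha> * col M \<alpha> i) = (\<Sum>\<alpha>\<in>S. c \<alpha> * bil n (col M d) (col M \<alpha>))"
      by (simp only: bil_sum_right bil_scale_right)
    also have "\<dots> = (\<Sum>\<alpha>\<in>S. if d = \<alpha> then c \<alpha> else 0)"
      by (rule sum.cong) (use assms(2) d in \<open>auto simp: isom_col[OF assms(1)] Jm_simps subset_iff\<close>)
    finally show ?thesis using fin by simp
  qed
  then show "d < n + 2 \<Longrightarrow> bil n (col M d) (\<lambda>i. \<Sum>\<alpha>\<in>S. c \<alpha> * col M \<alpha> i) = (if d \<in> S then c d else 0)" .
  have "bil n (\<lambda>i. \<Sum>\<alpha>\<in>S. c \<alpha> * col M \<alpha> i) (\<lambda>i. \<Sum>\<alpha>\<in>S. c \<alpha> * col M \<alpha> i)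
     = (\<Sum>\<beta>\<in>S. c \<beta> * bil n (col M \<beta>) (\<lambda>i. \<Sum>\<alpha>\<in>S. c \<alpha> * col M \<alpha> i))"
    by (simp only: bil_sum_left bil_scale_left)
  also have "\<dots> = (\<Sum>\<beta>\<in>S. (c \<beta>)\<^sup>2)"
    by (rule sum.cong) (use assms(2) * in \<open>auto simp: power2_eq_square subset_iff\<close>)
  finally show "bil n (\<lambda>i. \<Sum>\<alpha>\<in>S. c \<alpha> * col M \<alpha> i) (\<lambda>i. \<Sum>\<alpha>\<in>S. c \<alpha> * col M \<alpha> i) = (\<Sum>\<alpha>\<in>S. (c \<alpha>)\<^sup>2)" .
qed

text \<open>The vector p, the sum of the phi^0_\<alpha> e_\<alpha>, is orthogonal to columns 0, 1
  and n+1, so \<open>curv4_orthogonal\<close> leaves its squared length. The coefficient phi^1_0 is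
  nonzero because its square, up to the scale of the lift, is <N',N'>.\<close>

lemma second_order_lift_curv:
  assumes n: "n \<ge> 1" and I: "open I" "immersion n I f" and so: "second_order_frame n I f U e" and x: "x \<in> U"
  shows "phi n e 1 0 x \<noteq> 0" "lift_curv n f x = (phi n e 1 0 x)\<^sup>2 * (\<Sum>\<alpha>=2..n. (phi n e 0 \<alpha> x)\<^sup>2)"
proof -
  note U = second_orderD(1-3)[OF so] and fr = second_orderD(4)[OF so]
  note iso = smooth_Mob_iso[OF U(2)]
  define N where "N = (\<lambda>y. nlift n (f y))"
  define r where "r = (\<lambda>y. 1 / (col (e y) 0 0 + col (e y) 0 (n+1)))"
  have nz: "col (e y) 0 0 + col (e y) 0 (n+1) \<noteq> 0" if "y \<in> U" for y
    using nullvec_sum_nonzero[OF frame_nullvec[OF iso[OF that]]] .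
  have N: "N y = (\<lambda>i. r y * col (e y) 0 i)" if "y \<in> U" for y
    using nlift_proj[OF frame_nullvec[OF iso[OF that]]] fr[OF that] by (simp add: N_def r_def)
  have sr: "smooth_on_R U r"
    unfolding r_def using nz smooth_Mob_col[OF U(2), of 0]
    by (intro smooth_intros U) (auto simp: vsmooth_def)
  note g = isom_col[OF iso[OF x]]
  have g': "bil n (col (e x) 0) (col (e x) 0) = 0" "bil n (col (e x) 0) (col (e x) 1) = 0"
    "bil n (col (e x) 1) (col (e x) 1) = 1" "bil n (col (e x) (n+1)) (col (e x) (n+1)) = 0"
    "bil n (col (e x) 0) (col (e x) (n+1)) = -1" "bil n (col (e x) 1) (col (e x) (n+1)) = 0"
    "bil n (col (e x) 1) (col (e x) 0) = 0"
    using g[of 1 0] g[of 0 0] g[of 0 1] g[of 1 1] g[of "n+1" "n+1"] g[of 0 "n+1"] g[of 1 "n+1"] n by (auto simp: Jm_simps)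
  have "vder (\<lambda>y i. r y * col (e y) 0 i)
     (\<lambda>i. deriv r x * col (e x) 0 i + r x * (phi n e 0 0 x * col (e x) 0 i + phi n e 1 0 x * col (e x) 1 i)) x"
    by (intro vder_scale smooth_DERIV[OF U(1) sr x] second_order_vder[OF n so x])
  then have "vder N (\<lambda>i. deriv r x * col (e x) 0 i + r x * (phi n e 0 0 x * col (e x) 0 i + phi n e 1 0 x * col (e x) 1 i)) x"
    by (rule vder_transform[OF U(1) x, rotated]) (simp add: N)
  from vder_imp_vderiv[OF this]
  have "bil n (vderiv N x) (vderiv N x) = (r x * phi n e 1 0 x)\<^sup>2"
    using g' by (simp add: bil_simps power2_eq_square)
  moreover have "bil n (vderiv N x) (vderiv N x) > 0"
    using immersion_nlift(5)[OF I] x U(3) unfolding N_def by blast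
  ultimately show p10: "phi n e 1 0 x \<noteq> 0" by auto
  define p where "p = (\<lambda>y i. \<Sum>\<alpha>=2..n. phi n e 0 \<alpha> y * col (e y) \<alpha> i)"
  have sub: "{2..n} \<subseteq> {1..n}" by auto
  have "lift_curv n f x = (phi n e 1 0 x)\<^sup>2 * curv4 n (col (e x) 0) (col (e x) 1) (col (e x) (n+1)) (p x)"
    unfolding lift_curv_def Let_def N_def[symmetric]
    by (rule curv4_moving[OF U(1) x, of "phi n e 0 0" _ "phi n e 0 1" r])
       (use second_order_vder[OF n so] smooth_phi[OF U(1,2)] p10 sr N g' nz[OF x] in \<open>auto simp: p_def r_def\<close>)
  also have "curv4 n (col (e x) 0) (col (e x) 1) (col (e x) (n+1)) (p x) = bil n (p x) (p x)"
    using g' n isom_col_sum(1)[OF iso[OF x] sub, of _ "\<lambda>\<alpha>. phi n e 0 \<alpha> x"]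
    by (intro curv4_orthogonal) (auto simp: p_def)
  also have "\<dots> = (\<Sum>\<alpha>=2..n. (phi n e 0 \<alpha> x)\<^sup>2)"
    unfolding p_def by (rule isom_col_sum(2)[OF iso[OF x] sub])
  finally show "lift_curv n f x = (phi n e 1 0 x)\<^sup>2 * (\<Sum>\<alpha>=2..n. (phi n e 0 \<alpha> x)\<^sup>2)" .
qed

lemma second_order_dens:
  assumes "n \<ge> 1" "open I" "immersion n I f" "second_order_frame n I f U e" "x \<in> U"
  shows "lift_curv n f x = (phi n e 1 0 x) ^ 4 * (\<Sum>\<alpha>=2..n. (pcoef n e \<alpha> x)\<^sup>2)"
    "dens n e x = lift_curv n f x powr (1/4)"
proof -
  let ?p = "phi n e 1 0 x" and ?S = "\<Sum>\<alpha>=2..n. (pcoef n e \<alpha> x)\<^sup>2"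
  note c = second_order_lift_curv[OF assms]
  have "(\<Sum>\<alpha>=2..n. (phi n e 0 \<alpha> x)\<^sup>2) = ?p\<^sup>2 * ?S"
    using c(1) by (simp add: pcoef_def power_divide sum_distrib_left)
  then show eq: "lift_curv n f x = ?p ^ 4 * ?S" using c(2) by (simp add: power2_eq_square numeral_eq_Suc)
  \<comment> \<open>A second order frame may have negative phi^1_0; the absolute value in
    \<open>dens\<close> is what the fourth root of the fourth power returns.\<close>
  have "?p ^ 4 = \<bar>?p\<bar> powr 4" using c(1) powr_realpow[of "\<bar>?p\<bar>" 4] by simp
  then have "(?p ^ 4) powr (1/4) = \<bar>?p\<bar>" using c(1) by (simp only: powr_powr) simp
  moreover have "?S \<ge> 0" by (intro sum_nonneg) simp
  ultimately show "dens n e x = lift_curv n f x powr (1/4)"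
    unfolding eq dens_def by (simp add: powr_mult)
qed

subsection \<open>Canonical columns along a null lift\<close>

text \<open>Scaling the lift by \<open>l\<close>, which is \<sigma> divided by the length of N',
  makes \<open>c1\<close>, the D-derivative of \<open>c0\<close>, a unit vector. Then <c0, Dc1> =
  -1, so subtracting \<mu> \<open>c0\<close> from Dc1 changes its norm by 2 \<mu>; the choice \<mu>
  = -<Dc1,Dc1>/2 makes \<open>cn\<close> null. What remains of Dcn after removing \<mu>
  \<open>c1\<close> is \<open>c2\<close>. The remaining inner products come from differentiating
  those already known.\<close>

lemma null_lift_columns:
  fixes N :: "real \<Rightarrow> nat \<Rightarrow> real"
  assumes I: "open I" and N: "vsmooth I N" "\<And>y. y \<in> I \<Longrightarrow> nullvec n (N y)"
    "\<And>y. y \<in> I \<Longrightarrow> bil n (vderiv N y) (vderiv N y) > 0"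
    and \<sigma>: "smooth_on_R I \<sigma>" "\<And>y. y \<in> I \<Longrightarrow> \<sigma> y > 0"
  obtains c0 c1 c2 cn \<mu> l where "null_columns n I c0 c1 c2 cn \<sigma> \<mu>"
    "\<And>y. y \<in> I \<Longrightarrow> l y > 0" "c0 = (\<lambda>y i. l y * N y i)"
    "\<And>y. y \<in> I \<Longrightarrow> curv4 n (N y) (vderiv N y) (vderiv (vderiv N) y) (vderiv (vderiv (vderiv N)) y)
        = \<sigma> y ^ 4 * bil n (c2 y) (c2 y)"
proof -
  define a where "a = (\<lambda>y. bil n (vderiv N y) (vderiv N y))"
  have sa: "smooth_on_R I a" unfolding a_def by (intro smooth_bil vsmooth_intros I N)
  have ap: "a y > 0" if "y \<in> I" for y using N(3)[OF that] by (simp add: a_def)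
  define l where "l = (\<lambda>y. \<sigma> y * a y powr (-1/2))"
  have sl: "smooth_on_R I l" unfolding l_def by (intro smooth_intros I \<sigma> sa) (use ap in auto)
  have lp: "l y > 0" if "y \<in> I" for y using \<sigma>(2)[OF that] ap[OF that] by (simp add: l_def)
  have l2: "(l y)\<^sup>2 * a y = (\<sigma> y)\<^sup>2" if "y \<in> I" for y
  proof -
    have "(a y powr (-1/2))\<^sup>2 * a y = a y powr (-1) * a y powr 1"
      using ap[OF that] by (simp add: power2_eq_square flip: powr_add)
    also have "\<dots> = 1" using ap[OF that] by (simp only: powr_add[symmetric]) simp
    finally show ?thesis by (simp add: l_def power_mult_distrib mult.assoc)
  qed
  have \<sigma>n: "\<sigma> y \<noteq> 0" if "y \<in> I" for y using \<sigma>(2)[OF that] by simp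
  define c0 where "c0 = (\<lambda>y i. l y * N y i)"
  define c1 where "c1 = dop \<sigma> c0"
  define \<mu> where "\<mu> = (\<lambda>y. - (1/2) * bil n (dop \<sigma> c1 y) (dop \<sigma> c1 y))"
  define cn where "cn = (\<lambda>y i. dop \<sigma> c1 y i - \<mu> y * c0 y i)"
  define c2 where "c2 = (\<lambda>y i. dop \<sigma> cn y i - \<mu> y * c1 y i)"
  note dops = vsmooth_dop[OF I _ \<sigma>(1) \<sigma>n]
  have s0: "vsmooth I c0" unfolding c0_def by (intro vsmooth_intros I sl N)
  have s1: "vsmooth I c1" unfolding c1_def by (rule dops[OF s0])
  have sm: "smooth_on_R I \<mu>" unfolding \<mu>_def by (intro smooth_intros smooth_bil dops I s1)
  have sn: "vsmooth I cn" unfolding cn_def by (intro vsmooth_intros dops I s0 s1 sm)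
  have s2: "vsmooth I c2" unfolding c2_def by (intro vsmooth_intros dops I s1 sn sm)
  have d0: "vder c0 (\<lambda>i. \<sigma> y * c1 y i) y" if "y \<in> I" for y
    unfolding c1_def by (rule vder_dop[where \<sigma> = \<sigma>, OF I s0 that \<sigma>n[OF that]])
  have d1: "vder c1 (\<lambda>i. \<sigma> y * (\<mu> y * c0 y i + cn y i)) y" if "y \<in> I" for y
    using vder_dop[where \<sigma> = \<sigma>, OF I s1 that \<sigma>n[OF that]] by (simp add: cn_def)
  have dn: "vder cn (\<lambda>i. \<sigma> y * (\<mu> y * c1 y i + c2 y i)) y" if "y \<in> I" for y
    using vder_dop[where \<sigma> = \<sigma>, OF I sn that \<sigma>n[OF that]] by (simp add: c2_def)
  have v0: "vsupp n (c0 y)" if "y \<in> I" for y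
    using N(2)[OF that] by (auto simp: nullvec_def c0_def vsupp_def)
  have vd: "vsupp n (dop \<sigma> u y)" if "vsmooth I u" "\<And>y. y \<in> I \<Longrightarrow> vsupp n (u y)" "y \<in> I" for u y
    using vder_vsupp[OF I that(3) that(2) vsmooth_vder[OF I that(1,3)]] by (auto simp: dop_def vsupp_def)
  have v1: "vsupp n (c1 y)" if "y \<in> I" for y unfolding c1_def by (rule vd[OF s0 v0 that])
  have vn: "vsupp n (cn y)" if "y \<in> I" for y unfolding cn_def by (intro vsupp_lin vd[OF s1 v1 that] v0 that)
  have v2: "vsupp n (c2 y)" if "y \<in> I" for y unfolding c2_def by (intro vsupp_lin vd[OF sn vn that] v1 that)
  have const: "bil n d (v y) + bil n (u y) d' = 0"
    if "y \<in> I" "\<And>z. z \<in> I \<Longrightarrow> bil n (u z) (v z) = k" "vder u d y" "vder v d' y" for u v d d' k y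
  proof -
    have "((\<lambda>y. k) has_real_derivative bil n d (v y) + bil n (u y) d') (at y)"
      by (rule DERIV_transform_open[OF I that(1) _ bil_DERIV[OF that(3,4)]]) (use that(2) in auto)
    then show ?thesis using DERIV_unique[OF _ DERIV_const] by blast
  qed
  have g00: "bil n (c0 y) (c0 y) = 0" if "y \<in> I" for y
    using N(2)[OF that] by (simp add: c0_def bil_simps nullvec_def)
  have g01: "bil n (c0 y) (c1 y) = 0" if "y \<in> I" for y
    using const[OF that g00 d0[OF that] d0[OF that]] \<sigma>n[OF that]
    by (simp add: bil_simps bil_commute[of n "c1 y" "c0 y"])
  have g11: "bil n (c1 y) (c1 y) = 1" if "y \<in> I" for y
  proof -
    have "vder c0 (\<lambda>i. deriv l y * N y i + l y * vderiv N y i) y"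
      unfolding c0_def by (intro vder_scale smooth_DERIV[OF I sl that] vsmooth_vder[OF I N(1) that])
    from vder_unique[OF this d0[OF that]]
    have e: "(\<lambda>i. deriv l y * N y i + l y * vderiv N y i) = (\<lambda>i. \<sigma> y * c1 y i)" .
    have NN: "bil n (N y) (N y) = 0" if "y \<in> I" for y using N(2)[OF that] by (simp add: nullvec_def)
    have "bil n (N y) (vderiv N y) = 0"
      using const[OF that NN vsmooth_vder[OF I N(1) that] vsmooth_vder[OF I N(1) that]]
      by (simp add: bil_commute[of n "vderiv N y" "N y"])
    then have "(l y)\<^sup>2 * a y = (\<sigma> y)\<^sup>2 * bil n (c1 y) (c1 y)"
      using arg_cong[OF e, of "\<lambda>v. bil n v v"] NN[OF that]
      by (simp add: bil_simps bil_commute[of n "vderiv N y" "N y"] power2_eq_square a_def algebra_simps)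
    then show ?thesis using l2[OF that] \<sigma>n[OF that] by simp
  qed
  have g0n: "bil n (c0 y) (cn y) = -1" if "y \<in> I" for y
    using const[OF that g01 d0[OF that] d1[OF that]] \<sigma>n[OF that] g00[OF that] g11[OF that]
    by (simp add: bil_simps) (metis add.inverse_unique mult.right_neutral mult_cancel_left distrib_left mult_zero_right)
  have g1n: "bil n (cn y) (c1 y) = 0" if "y \<in> I" for y
    using const[OF that g11 d1[OF that] d1[OF that]] \<sigma>n[OF that] g01[OF that]
    by (simp add: bil_simps bil_commute[of n "c1 y"])
  have gnn: "bil n (cn y) (cn y) = 0" if "y \<in> I" for y
  proof -
    have e: "dop \<sigma> c1 y = (\<lambda>i. \<mu> y * c0 y i + cn y i)" by (simp add: cn_def)
    show ?thesis using g00[OF that] g0n[OF that] fun_cong[OF \<mu>_def, of y]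
      by (simp add: e bil_simps bil_commute[of n "cn y" "c0 y"]) (simp add: field_simps)
  qed
  have g02: "bil n (c0 y) (c2 y) = 0" if "y \<in> I" for y
    using const[OF that g0n d0[OF that] dn[OF that]] \<sigma>n[OF that] g01[OF that] g1n[OF that]
    by (simp add: bil_simps bil_commute[of n "c1 y"])
  have g12: "bil n (c1 y) (c2 y) = 0" if "y \<in> I" for y
    using const[OF that g1n dn[OF that] d1[OF that]] \<sigma>n[OF that] g11[OF that] g0n[OF that] gnn[OF that]
    by (simp add: bil_simps bil_commute[of n "c2 y"] bil_commute[of n "cn y" "c0 y"])
  have gn2: "bil n (cn y) (c2 y) = 0" if "y \<in> I" for y
    using const[OF that gnn dn[OF that] dn[OF that]] \<sigma>n[OF that] g1n[OF that]
    by (simp add: bil_simps bil_commute[of n "c1 y"] bil_commute[of n "c2 y"])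
  have cv: "curv4 n (N y) (vderiv N y) (vderiv (vderiv N) y) (vderiv (vderiv (vderiv N)) y)
        = \<sigma> y ^ 4 * bil n (c2 y) (c2 y)" if y: "y \<in> I" for y
  proof -
    have "curv4 n (N y) (vderiv N y) (vderiv (vderiv N) y) (vderiv (vderiv (vderiv N)) y)
      = (\<sigma> y)\<^sup>2 * curv4 n (c0 y) (c1 y) (cn y) (\<lambda>i. \<sigma> y * c2 y i)"
    proof (rule curv4_moving[OF I y, of "\<lambda>y. 0" \<sigma> "\<lambda>y. \<sigma> y * \<mu> y" "\<lambda>y. 1 / l y"])
      show "vder cn (\<lambda>i. \<sigma> y * \<mu> y * c1 y i + \<sigma> y * c2 y i - 0 * cn y i) y" if "y \<in> I" for y
        using dn[OF that] by (simp add: algebra_simps)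
      show "vder c1 (\<lambda>i. \<sigma> y * \<mu> y * c0 y i + \<sigma> y * cn y i) y" if "y \<in> I" for y
        using d1[OF that] by (simp add: algebra_simps)
      show "N y = (\<lambda>i. 1 / l y * c0 y i)" if "y \<in> I" for y
        using lp[OF that] by (auto simp: c0_def)
      show "smooth_on_R I (\<lambda>y. 1 / l y)" by (intro smooth_intros I sl) (use lp in force)
    qed (use d0 g00 g01 \<sigma>n y lp[OF y] in \<open>auto intro: smooth_intros I \<sigma> sm\<close>)
    also have "curv4 n (c0 y) (c1 y) (cn y) (\<lambda>i. \<sigma> y * c2 y i) = (\<sigma> y)\<^sup>2 * bil n (c2 y) (c2 y)"
      by (subst curv4_orthogonal)
         (use y g00 g01 g11 g0n g1n gnn g02 g12 gn2 in \<open>simp_all add: bil_simps bil_commute[of n "c1 y" "cn y"] power2_eq_square\<close>)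
    finally show ?thesis by (simp add: power2_eq_square numeral_eq_Suc)
  qed
  have "null_columns n I c0 c1 c2 cn \<sigma> \<mu>"
    by unfold_locales
       (use I \<sigma> s0 s1 s2 sn sm v0 v1 v2 vn d0 d1 dn g00 g01 g11 g0n g1n gnn g02 g12 gn2 bil_commute[of n "c1 _" "cn _"] in auto)
  then show thesis using that lp c0_def cv by blast
qed

context null_columns
begin

lemma columns_second_order:
  assumes n: "n \<ge> 1" and V: "open V" "V \<subseteq> U" "V \<subseteq> I" "smooth_Mob n V e"
    and c: "\<And>x. x \<in> V \<Longrightarrow> col (e x) 0 = e0 x" "\<And>x. x \<in> V \<Longrightarrow> col (e x) 1 = e1 x"
      "\<And>x. x \<in> V \<Longrightarrow> col (e x) (n+1) = en x"
    and f: "\<And>x. x \<in> V \<Longrightarrow> proj (e0 x) = f x"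
  shows "second_order_frame n I f V e"
  unfolding second_order_frame_def
proof (intro conjI ballI)
  show "frame n I f V e" using V c(1) f by (auto simp: frame_def smooth_Mob_def)
  fix x \<alpha> assume x: "x \<in> V" and a: "\<alpha> \<in> {2..n}"
  note h = isom_col[OF smooth_Mob_iso[OF V(4) x]]
  have 0: "vderiv (\<lambda>y. col (e y) 0) x = (\<lambda>i. \<sigma> x * col (e x) 1 i)"
    by (rule vder_imp_vderiv, rule vder_transform[OF V(1) x, of e0]) (use c d0[of x] x V(2) in auto)
  have 1: "vderiv (\<lambda>y. col (e y) 1) x = (\<lambda>i. \<sigma> x * (\<mu> x * col (e x) 0 i + col (e x) (n+1) i))"
    by (rule vder_imp_vderiv, rule vder_transform[OF V(1) x, of e1]) (use c d1[of x] x V(2) in auto)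
  show "phi n e \<alpha> 0 x = 0" "phi n e \<alpha> 1 x = 0"
    using a n h[of \<alpha> 0] h[of \<alpha> 1] h[of \<alpha> "n+1"]
    by (auto simp: phi_omega(3) omega_def 0 1[unfolded One_nat_def] bil_simps Jm_simps)
qed

text \<open>With column 2 equal to \<open>e2\<close>, the derivative of \<open>en\<close> shows that
  phi^0_\<alpha> is \<sigma> for \<alpha> = 2 and 0 otherwise. So the density of the completed frame
  is \<sigma> itself, and all normalisations hold.\<close>

lemma columns_special:
  assumes n: "n \<ge> 2" and V: "open V" "V \<subseteq> U" "V \<subseteq> I" "smooth_Mob n V e"
    and c: "\<And>x. x \<in> V \<Longrightarrow> col (e x) 0 = e0 x" "\<And>x. x \<in> V \<Longrightarrow> col (e x) 1 = e1 x"
      "\<And>x. x \<in> V \<Longrightarrow> col (e x) (n+1) = en x" "\<And>x. x \<in> V \<Longrightarrow> col (e x) 2 = e2 x"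
    and f: "\<And>x. x \<in> V \<Longrightarrow> proj (e0 x) = f x"
  shows "special_third_order_frame n I f V e"
    "\<And>x. x \<in> V \<Longrightarrow> phi n e 1 0 x = \<sigma> x" "\<And>x. x \<in> V \<Longrightarrow> mu1 n e x = \<mu> x"
proof -
  have p: "\<sigma> x > 0" if "x \<in> V" for x using pos V(2) that by blast
  have n1: "n \<ge> 1" using n by simp
  have so: "second_order_frame n I f V e"
    by (rule columns_second_order[OF n1 V c(1-3) f])
  have *: "phi n e 1 0 x = \<sigma> x" "phi n e 0 0 x = 0" "phi n e 0 1 x = \<sigma> x * \<mu> x"
      "\<And>\<alpha>. \<alpha> \<in> {2..n} \<Longrightarrow> phi n e 0 \<alpha> x = (if \<alpha> = 2 then \<sigma> x else 0)" if x: "x \<in> V" for x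
  proof -
    note h = isom_col[OF smooth_Mob_iso[OF V(4) x]]
    have 0: "vderiv (\<lambda>y. col (e y) 0) x = (\<lambda>i. \<sigma> x * col (e x) 1 i)"
      by (rule vder_imp_vderiv, rule vder_transform[OF V(1) x, of e0]) (use c d0[of x] x V(2) in auto)
    have 1: "vderiv (\<lambda>y. col (e y) 1) x = (\<lambda>i. \<sigma> x * (\<mu> x * col (e x) 0 i + col (e x) (n+1) i))"
      by (rule vder_imp_vderiv, rule vder_transform[OF V(1) x, of e1]) (use c d1[of x] x V(2) in auto)
    have N: "vderiv (\<lambda>y. col (e y) (n+1)) x = (\<lambda>i. \<sigma> x * (\<mu> x * col (e x) 1 i + col (e x) 2 i))"
      by (rule vder_imp_vderiv, rule vder_transform[OF V(1) x, of en]) (use c dn[of x] x V(2) in auto)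
    have J: "bil n (col (e x) 1) (col (e x) 1) = 1" "bil n (col (e x) (n+1)) (col (e x) 1) = 0"
      "bil n (col (e x) (n+1)) (col (e x) 0) = -1" "bil n (col (e x) (n+1)) (col (e x) (n+1)) = 0"
      using n h[of 1 1] h[of "n+1" 1] h[of "n+1" 0] h[of "n+1" "n+1"] by (auto simp: Jm_simps)
    show "phi n e 1 0 x = \<sigma> x"
      using phi_omega(3)[of 1 n e 0 x] n J unfolding omega_def 0 by (simp add: bil_simps)
    show "phi n e 0 0 x = 0"
      using phi_omega(1)[of n e 0 x] J unfolding omega_def 0 by (simp add: bil_simps)
    show "phi n e 0 1 x = \<sigma> x * \<mu> x"
      using phi_omega(1)[of n e 1 x] J unfolding omega_def 1 by (simp add: bil_simps)
    show "phi n e 0 \<alpha> x = (if \<alpha> = 2 then \<sigma> x else 0)" if a: "\<alpha> \<in> {2..n}" for \<alpha>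
    proof -
      have "phi n e 0 \<alpha> x = omega n e \<alpha> (n+1) x"
        using phi_omega(1)[of n e \<alpha> x] omega_skew[OF V(1,4) x, of \<alpha> "n+1"] a by simp
      also have "\<dots> = (if \<alpha> = 2 then \<sigma> x else 0)"
        using a n h[of \<alpha> 1] h[of \<alpha> 2] unfolding omega_def N by (auto simp: bil_simps Jm_simps)
      finally show ?thesis .
    qed
  qed
  show "phi n e 1 0 x = \<sigma> x" "mu1 n e x = \<mu> x" if "x \<in> V" for x
    using *[OF that] p[OF that] by (auto simp: mu1_def)
  have "dens n e x = \<sigma> x" if x: "x \<in> V" for x
  proof -
    have "(\<Sum>\<alpha>=2..n. (pcoef n e \<alpha> x)\<^sup>2) = (\<Sum>\<alpha>=2..n. if \<alpha> = 2 then 1 else 0)"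
      by (rule sum.cong) (use *[OF x] p[OF x] in \<open>auto simp: pcoef_def\<close>)
    also have "\<dots> = 1" using n by simp
    finally show ?thesis using *(1)[OF x] p[OF x] by (simp add: dens_def)
  qed
  then show "special_third_order_frame n I f V e"
    using so * n unfolding special_third_order_frame_def by auto
qed

end

text \<open>Since \<open>arclen\<close> is a choice and \<open>one_generic\<close> a universal
  statement, neither says anything at a point without frames. The curves f_t of a variation are only
  known to be immersions, so the construction must avoid dividing by the arclength density; second
  order leaves \<sigma> free, and the constant 1 is taken.\<close>

lemma exists_second_order_frame:
  assumes n: "n \<ge> 2" and I: "open I" "immersion n I f" "x0 \<in> I"
  obtains U e where "x0 \<in> U" "second_order_frame n I f U e"
proof -
  define N where "N = (\<lambda>y. nlift n (f y))"
  have im: "vsmooth I N" "\<And>y. y \<in> I \<Longrightarrow> nullvec n (N y)" "\<And>y. y \<in> I \<Longrightarrow> proj (N y) = f y"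
    "\<And>y. y \<in> I \<Longrightarrow> N y 0 + N y (n+1) = 1" "\<And>y. y \<in> I \<Longrightarrow> bil n (vderiv N y) (vderiv N y) > 0"
    unfolding N_def by (fact immersion_nlift[OF I(1,2)])+
  define \<sigma> :: "real \<Rightarrow> real" where "\<sigma> = (\<lambda>_. 1)"
  have one: "smooth_on_R I \<sigma>" "\<And>y. y \<in> I \<Longrightarrow> 0 < \<sigma> y"
    using smooth_const[OF I(1)] by (auto simp: \<sigma>_def)
  obtain c0 c1 c2 cn \<mu> l where nc: "null_columns n I c0 c1 c2 cn \<sigma> \<mu>"
    and lp: "\<And>y. y \<in> I \<Longrightarrow> l y > 0" and c0: "c0 = (\<lambda>y i. l y * N y i)"
    by (rule null_lift_columns[OF I(1) im(1,2,5), of \<sigma>]) (use one in auto)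
  have "c0 x0 0 + c0 x0 (n+1) = l x0" unfolding c0 using im(4)[OF I(3)] by (simp flip: distrib_left)
  then have pos: "c0 x0 0 + c0 x0 (n+1) > 0" using lp[OF I(3)] by simp
  obtain V e where V: "open V" "x0 \<in> V" "V \<subseteq> I" "smooth_Mob n V e"
    and c: "\<And>x. x \<in> V \<Longrightarrow> col (e x) 0 = c0 x" "\<And>x. x \<in> V \<Longrightarrow> col (e x) 1 = c1 x"
    "\<And>x. x \<in> V \<Longrightarrow> col (e x) (n+1) = cn x"
    using null_columns.frame_with_columns3[OF nc n I(3) pos] by blast
  have f: "proj (c0 x) = f x" if "x \<in> I" for x
    unfolding c0 using lp[OF that] im(3)[OF that] by (simp add: proj_scale)
  have "second_order_frame n I f V e"
    by (rule null_columns.columns_second_order[OF nc _ V(1,3,3,4) c]) (use n V f in auto)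
  then show thesis using that V by blast
qed

lemma arclen_lift_curv:
  assumes "n \<ge> 2" "open I" "immersion n I f" "x \<in> I"
  shows "arclen n I f x = lift_curv n f x powr (1/4)"
proof -
  obtain U e where U: "x \<in> U" "second_order_frame n I f U e"
    using exists_second_order_frame[OF assms] by blast
  have "\<exists>s U e. x \<in> U \<and> second_order_frame n I f U e \<and> s = dens n e x" using U by blast
  then have "\<exists>U e. x \<in> U \<and> second_order_frame n I f U e \<and> arclen n I f x = dens n e x"
    unfolding arclen_def by (rule someI_ex)
  then show ?thesis using second_order_dens(2)[OF _ assms(2,3)] assms(1) by auto
qed

lemma one_generic_lift_curv:
  assumes "n \<ge> 2" "open I" "one_generic n I f" "x \<in> I"
  shows "lift_curv n f x > 0"
proof -
  have im: "immersion n I f" using assms(3) by (simp add: one_generic_def)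
  obtain U e where U: "x \<in> U" "second_order_frame n I f U e"
    using exists_second_order_frame[OF assms(1,2) im assms(4)] by blast
  have "(\<Sum>\<alpha>=2..n. (pcoef n e \<alpha> x)\<^sup>2) \<noteq> 0" using assms(3) U by (auto simp: one_generic_def)
  moreover have "(\<Sum>\<alpha>=2..n. (pcoef n e \<alpha> x)\<^sup>2) \<ge> 0" by (intro sum_nonneg) simp
  moreover have "n \<ge> 1" using assms(1) by simp
  ultimately show ?thesis
    using second_order_dens(1)[OF _ assms(2) im U(2,1)] second_order_lift_curv(1)[OF _ assms(2) im U(2,1)]
    by (simp add: zero_less_mult_iff)
qed

subsection \<open>The Euler-Lagrange vector in a special frame\<close>

definition EL :: "(real \<Rightarrow> real) \<Rightarrow> (real \<Rightarrow> real) \<Rightarrow> (real \<Rightarrow> nat \<Rightarrow> real) \<Rightarrow> (real \<Rightarrow> nat \<Rightarrow> real) \<Rightarrow> real \<Rightarrow> nat \<Rightarrow> real" where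
  "EL \<sigma> \<mu> e2 en x = (\<lambda>i. en x i - dop \<sigma> (dop \<sigma> (dop \<sigma> e2)) x i
      + deriv \<mu> x / \<sigma> x * e2 x i + 2 * \<mu> x * dop \<sigma> e2 x i)"

context
  fixes n I f U e
  assumes n: "n \<ge> 3" and I: "open I" "immersion n I f" and st: "special_third_order_frame n I f U e"
begin

private lemma so: "second_order_frame n I f U e"
  using st by (simp add: special_third_order_frame_def)

private lemma n1: "n \<ge> 1" using n by simp

private lemmas oU = second_orderD(1)[OF so] and sM = second_orderD(2)[OF so]

abbreviation (input) "ec b \<equiv> (\<lambda>y. col (e y) b)"

lemma special_pos: "x \<in> U \<Longrightarrow> phi n e 1 0 x > 0"
proof -
  assume x: "x \<in> U"
  have "phi n e 1 0 x = dens n e x" using st x by (simp add: special_third_order_frame_def)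
  moreover have "dens n e x \<ge> 0" by (simp add: dens_def)
  ultimately show ?thesis using second_order_lift_curv(1)[OF n1 I so x] by simp
qed

lemma special_vder:
  assumes x: "x \<in> U"
  shows "vder (ec 0) (\<lambda>i. phi n e 1 0 x * ec 1 x i) x"
    "vder (ec 1) (\<lambda>i. phi n e 1 0 x * (mu1 n e x * ec 0 x i + ec (n+1) x i)) x"
    "vder (ec (n+1)) (\<lambda>i. phi n e 1 0 x * (mu1 n e x * ec 1 x i + ec 2 x i)) x"
    "vder (ec 2) (\<lambda>i. phi n e 1 0 x * (ec 0 x i + (\<Sum>b=3..n. qX n e b x * ec b x i))) x"
    "\<And>b. b \<in> {3..n} \<Longrightarrow> vder (ec b) (\<lambda>i. phi n e 1 0 x * ((\<Sum>c=3..n. conn n e c b x * ec c x i) - qX n e b x * ec 2 x i)) x"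
proof -
  let ?s = "phi n e 1 0 x"
  have p: "?s \<noteq> 0" using special_pos[OF x] by simp
  have z: "phi n e 0 0 x = 0" "phi n e 0 2 x = ?s" "\<And>b. b \<in> {3..n} \<Longrightarrow> phi n e 0 b x = 0"
    using st x by (auto simp: special_third_order_frame_def)
  have z2: "phi n e \<alpha> 0 x = 0" "phi n e \<alpha> 1 x = 0" if "\<alpha> \<in> {2..n}" for \<alpha>
    using so x that by (auto simp: second_order_frame_def)
  have m: "phi n e 0 1 x = ?s * mu1 n e x" using p by (simp add: mu1_def)
  note d = second_order_vder[OF n1 so x]
  show "vder (ec 0) (\<lambda>i. ?s * ec 1 x i) x" using d(1) z by simp
  show "vder (ec 1) (\<lambda>i. ?s * (mu1 n e x * ec 0 x i + ec (n+1) x i)) x"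
    using d(2) unfolding m by (simp add: distrib_left mult.assoc)
  have split2: "(\<Sum>\<alpha>=2..n. g \<alpha>) = g 2 + (\<Sum>\<alpha>=3..n. g \<alpha>)" for g :: "nat \<Rightarrow> real"
    using sum.atLeast_Suc_atMost[of 2 n g] n by (simp add: numeral_3_eq_3)
  have split: "(\<Sum>A=1..n. g A) = g 1 + (g 2 + (\<Sum>\<alpha>=3..n. g \<alpha>))" for g :: "nat \<Rightarrow> real"
    using sum.atLeast_Suc_atMost[OF n1, of g] split2[of g] by (simp add: numeral_2_eq_2)
  have "(\<Sum>\<alpha>=2..n. phi n e 0 \<alpha> x * ec \<alpha> x i) = ?s * ec 2 x i" for i
    unfolding split2 using z by simp
  then show "vder (ec (n+1)) (\<lambda>i. ?s * (mu1 n e x * ec 1 x i + ec 2 x i)) x"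
    using d(3) unfolding m z(1) by (simp add: distrib_left mult.assoc)
  note sk = omega_skew[OF oU sM x]
  have skew: "phi n e A B x = - phi n e B A x" if "1 \<le> A" "A \<le> n" "1 \<le> B" "B \<le> n" for A B
    using sk[of B A] that by (simp add: phi_omega(3))
  have nA: "phi n e (n+1) A x = phi n e A 0 x" if "1 \<le> A" "A \<le> n" for A
    using sk[of A 0] that by (simp add: phi_omega(2)[simplified] phi_omega(3))
  have q: "phi n e b 2 x = ?s * qX n e b x" for b using p by (simp add: qX_def)
  have cn: "(\<Sum>c=3..n. phi n e c b x * ec c x i) = ?s * (\<Sum>c=3..n. conn n e c b x * ec c x i)" for b i
    using p by (simp add: conn_def sum_distrib_left)
  have "phi n e 1 2 x = 0" "phi n e 2 2 x = 0" "phi n e (n+1) 2 x = 0"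
    using skew[of 1 2] skew[of 2 2] nA[of 2] z2[of 2] n by auto
  then have "(\<lambda>i. phi n e 0 2 x * ec 0 x i + (\<Sum>A=1..n. phi n e A 2 x * ec A x i) + phi n e (n+1) 2 x * ec (n+1) x i)
     = (\<lambda>i. ?s * (ec 0 x i + (\<Sum>b=3..n. qX n e b x * ec b x i)))"
    unfolding split z(2) unfolding q by (auto simp: distrib_left sum_distrib_left mult.assoc)
  then show "vder (ec 2) (\<lambda>i. ?s * (ec 0 x i + (\<Sum>b=3..n. qX n e b x * ec b x i))) x"
    using frame_vder[OF oU sM x, of 2] by simp
  fix b assume b: "b \<in> {3..n}"
  have "phi n e 1 b x = 0" "phi n e 2 b x = - (?s * qX n e b x)" "phi n e (n+1) b x = 0" "phi n e 0 b x = 0"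
    using skew[of 1 b] skew[of 2 b] nA[of b] z2[of b] z(3)[OF b] b n q[of b] by auto
  then have "(\<lambda>i. phi n e 0 b x * ec 0 x i + (\<Sum>A=1..n. phi n e A b x * ec A x i) + phi n e (n+1) b x * ec (n+1) x i)
     = (\<lambda>i. ?s * ((\<Sum>c=3..n. conn n e c b x * ec c x i) - qX n e b x * ec 2 x i))"
    unfolding split cn by (auto simp: right_diff_distrib)
  then show "vder (ec b) (\<lambda>i. ?s * ((\<Sum>c=3..n. conn n e c b x * ec c x i) - qX n e b x * ec 2 x i)) x"
    using frame_vder[OF oU sM x, of b] by simp
qed

lemma special_smooth:
  "smooth_on_R U (phi n e a b)" "smooth_on_R U (mu1 n e)" "smooth_on_R U (qX n e b)"
  "smooth_on_R U (conn n e a b)" "smooth_on_R U (normX2 n e)"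
  "smooth_on_R U (nablaX n e b)"
proof -
  have nz: "phi n e 1 0 x \<noteq> 0" if "x \<in> U" for x using special_pos[OF that] by simp
  show p: "smooth_on_R U (phi n e a b)" for a b by (rule smooth_phi[OF oU sM])
  show "smooth_on_R U (mu1 n e)" unfolding mu1_def[abs_def] by (intro smooth_intros oU p nz)
  show q: "smooth_on_R U (qX n e b)" for b unfolding qX_def[abs_def] by (intro smooth_intros oU p nz)
  show c: "smooth_on_R U (conn n e a b)" for a b unfolding conn_def[abs_def] by (intro smooth_intros oU p nz)
  show "smooth_on_R U (normX2 n e)" unfolding normX2_def[abs_def] by (intro smooth_intros oU q)
  show "smooth_on_R U (nablaX n e b)" unfolding nablaX_def[abs_def] dds_def
    by (intro smooth_intros oU q c p nz)
qed

text \<open>For a section w of \<Theta> the derivative Dw splits into the covariant derivative and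
  -<w,X> e_2, the latter from the e_2 component of each De_b. It is used for w = X and for its
  covariant derivative.\<close>

lemma special_vder_normal:
  assumes x: "x \<in> U" and w: "\<And>b. smooth_on_R U (w b)"
  shows "vder (\<lambda>y i. \<Sum>b=3..n. w b y * ec b y i)
    (\<lambda>i. phi n e 1 0 x * ((\<Sum>c=3..n. (dds n e (w c) x + (\<Sum>b=3..n. w b x * conn n e c b x)) * ec c x i)
        - (\<Sum>b=3..n. w b x * qX n e b x) * ec 2 x i)) x"
proof -
  let ?s = "phi n e 1 0 x"
  have p: "?s \<noteq> 0" using special_pos[OF x] by simp
  have "vder (\<lambda>y i. \<Sum>b=3..n. w b y * ec b y i)
     (\<lambda>i. \<Sum>b=3..n. deriv (w b) x * ec b x i + w b x *
        (?s * ((\<Sum>c=3..n. conn n e c b x * ec c x i) - qX n e b x * ec 2 x i))) x"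
    by (intro vder_sum vder_scale smooth_DERIV[OF oU w x] special_vder(5)[OF x]) auto
  moreover have "(\<Sum>b=3..n. deriv (w b) x * ec b x i + w b x *
        (?s * ((\<Sum>c=3..n. conn n e c b x * ec c x i) - qX n e b x * ec 2 x i)))
     = ?s * ((\<Sum>c=3..n. (dds n e (w c) x + (\<Sum>b=3..n. w b x * conn n e c b x)) * ec c x i)
        - (\<Sum>b=3..n. w b x * qX n e b x) * ec 2 x i)" for i
  proof -
    have 1: "deriv (w b) x = ?s * dds n e (w b) x" for b using p by (simp add: dds_def)
    have "(\<Sum>c=3..n. (\<Sum>b=3..n. w b x * conn n e c b x) * ec c x i)
       = (\<Sum>b=3..n. w b x * (\<Sum>c=3..n. conn n e c b x * ec c x i))"
      unfolding sum_distrib_left sum_distrib_right by (subst sum.swap) (simp add: mult.assoc)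
    then show ?thesis unfolding 1
      by (simp add: algebra_simps sum.distrib sum_subtractf sum_distrib_left)
  qed
  ultimately show ?thesis by simp
qed

text \<open>The connection is metric: its contribution \<open>T\<close> equals its own negative, by
  skew-symmetry of \<open>conn\<close> and exchange of the two summations.\<close>

lemma normX2_dds:
  assumes x: "x \<in> U"
  shows "dds n e (normX2 n e) x = 2 * (\<Sum>b=3..n. nablaX n e b x * qX n e b x)"
proof -
  have "(normX2 n e has_real_derivative (\<Sum>b=3..n. 2 * (qX n e b x * deriv (qX n e b) x))) (at x)"
    unfolding normX2_def[abs_def] power2_eq_square
    by (intro DERIV_sum) (use smooth_DERIV[OF oU special_smooth(3) x] in \<open>auto intro!: derivative_eq_intros\<close>)
  then have 1: "dds n e (normX2 n e) x = 2 * (\<Sum>b=3..n. qX n e b x * dds n e (qX n e b) x)"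
    by (simp add: dds_def DERIV_imp_deriv sum_divide_distrib sum_distrib_left)
  define T where "T = (\<Sum>c=3..n. \<Sum>b=3..n. qX n e c x * (qX n e b x * conn n e c b x))"
  have "qX n e c x * (qX n e b x * conn n e c b x) = - (qX n e b x * (qX n e c x * conn n e b c x))"
    if "b \<in> {3..n}" "c \<in> {3..n}" for b c
  proof -
    have "conn n e c b x = - conn n e b c x"
      using omega_skew[OF oU sM x, of b c] that by (simp add: conn_def phi_omega(3))
    then show ?thesis by simp
  qed
  then have "T = (\<Sum>c=3..n. \<Sum>b=3..n. - (qX n e b x * (qX n e c x * conn n e b c x)))"
    unfolding T_def by (intro sum.cong refl)
  also have "\<dots> = - T" unfolding T_def sum_negf by (subst sum.swap) (rule refl)
  finally have "T = 0" by simp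
  then show ?thesis unfolding 1 nablaX_def
    by (simp add: algebra_simps sum.distrib sum_distrib_left sum_distrib_right T_def)
qed

text \<open>Differentiating three times: De_2 = e_0 + X, then e_1 + \<nabla>X - |X|^2 e_2, and in
  the third derivative the e_2 component is -(1/2) D|X|^2 from \<nabla>X and -D|X|^2 from the
  coefficient of e_2. Together they are the 3/2 of the theorem.\<close>

lemma special_EL:
  assumes x: "x \<in> U"
  shows "EL (phi n e 1 0) (mu1 n e) (ec 2) (ec (n+1)) x = (\<lambda>i. (normX2 n e x + mu1 n e x) * ec 0 x i
     + (dds n e (mu1 n e) x + 3/2 * dds n e (normX2 n e) x) * ec 2 x i
     - (\<Sum>c=3..n. (nabla2X n e c x - qX n e c x * (normX2 n e x + 2 * mu1 n e x)) * ec c x i))"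
proof -
  define \<sigma> where "\<sigma> = phi n e 1 0"
  have \<sigma>n: "\<sigma> y \<noteq> 0" if "y \<in> U" for y using special_pos[OF that] by (simp add: \<sigma>_def)
  note V = special_vder[folded \<sigma>_def] and VN = special_vder_normal[folded \<sigma>_def]
  note S = special_smooth
  have dq: "deriv g y = \<sigma> y * dds n e g y" if "y \<in> U" for g y using \<sigma>n[OF that] by (simp add: dds_def \<sigma>_def)
  define X where "X = (\<lambda>y i. \<Sum>b=3..n. qX n e b y * ec b y i)"
  define Y where "Y = (\<lambda>y i. \<Sum>b=3..n. nablaX n e b y * ec b y i)"
  have D1: "dop \<sigma> (ec 2) y = (\<lambda>i. ec 0 y i + X y i)" if "y \<in> U" for y
    by (rule dop_eqI[where \<sigma> = \<sigma>, OF _ \<sigma>n[OF that]]) (use V(4)[OF that] in \<open>simp add: X_def\<close>)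
  have dX: "vder X (\<lambda>i. \<sigma> y * (Y y i - normX2 n e y * ec 2 y i)) y" if "y \<in> U" for y
    using VN[where w = "qX n e", OF that S(3)] by (simp add: X_def Y_def nablaX_def[symmetric] normX2_def power2_eq_square)
  have dY: "vder Y (\<lambda>i. \<sigma> y * ((\<Sum>c=3..n. nabla2X n e c y * ec c y i) - (1/2) * dds n e (normX2 n e) y * ec 2 y i)) y"
    if "y \<in> U" for y
    using VN[where w = "nablaX n e", OF that S(6)] by (simp add: Y_def nabla2X_def[symmetric] normX2_dds[OF that])
  have D2: "dop \<sigma> (dop \<sigma> (ec 2)) y = (\<lambda>i. ec 1 y i + (Y y i - normX2 n e y * ec 2 y i))" if y: "y \<in> U" for y
  proof (rule dop_eqI[where \<sigma> = \<sigma>, OF _ \<sigma>n[OF y]], rule vder_transform[OF oU y])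
    show "vder (\<lambda>y i. ec 0 y i + X y i) (\<lambda>i. \<sigma> y * (ec 1 y i + (Y y i - normX2 n e y * ec 2 y i))) y"
      using vder_add[OF V(1)[OF y] dX[OF y]] by (simp add: distrib_left)
  qed (simp add: D1)
  have D3: "dop \<sigma> (dop \<sigma> (dop \<sigma> (ec 2))) x = (\<lambda>i. (mu1 n e x * ec 0 x i + ec (n+1) x i)
     + (((\<Sum>c=3..n. nabla2X n e c x * ec c x i) - (1/2) * dds n e (normX2 n e) x * ec 2 x i)
     - (dds n e (normX2 n e) x * ec 2 x i + normX2 n e x * (ec 0 x i + X x i))))"
  proof (rule dop_eqI[where \<sigma> = \<sigma>, OF _ \<sigma>n[OF x]], rule vder_transform[OF oU x])
    have "vder (\<lambda>y i. ec 1 y i + (Y y i - normX2 n e y * ec 2 y i))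
      (\<lambda>i. \<sigma> x * (mu1 n e x * ec 0 x i + ec (n+1) x i) +
        (\<sigma> x * ((\<Sum>c=3..n. nabla2X n e c x * ec c x i) - (1/2) * dds n e (normX2 n e) x * ec 2 x i)
         - (deriv (normX2 n e) x * ec 2 x i + normX2 n e x * (\<sigma> x * (ec 0 x i + X x i))))) x"
      unfolding X_def
      by (intro vder_add vder_diff vder_scale V(2)[OF x] dY[OF x] smooth_DERIV[OF oU S(5) x] V(4)[OF x])
    then show "vder (\<lambda>y i. ec 1 y i + (Y y i - normX2 n e y * ec 2 y i))
      (\<lambda>i. \<sigma> x * ((mu1 n e x * ec 0 x i + ec (n+1) x i)
     + (((\<Sum>c=3..n. nabla2X n e c x * ec c x i) - (1/2) * dds n e (normX2 n e) x * ec 2 x i)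
     - (dds n e (normX2 n e) x * ec 2 x i + normX2 n e x * (ec 0 x i + X x i))))) x"
      unfolding dq[OF x] by (simp add: algebra_simps)
  qed (simp add: D2)
  have dm: "deriv (mu1 n e) x / \<sigma> x = dds n e (mu1 n e) x" by (simp add: dds_def \<sigma>_def)
  have sum: "(\<Sum>c=3..n. (nabla2X n e c x - qX n e c x * (normX2 n e x + 2 * mu1 n e x)) * ec c x i)
     = (\<Sum>c=3..n. nabla2X n e c x * ec c x i) - (normX2 n e x + 2 * mu1 n e x) * X x i" for i
    unfolding X_def by (simp add: left_diff_distrib right_diff_distrib sum_subtractf sum_distrib_left mult_ac)
  show ?thesis
    unfolding EL_def \<sigma>_def[symmetric] D3 D1[OF x] dm sum by (intro ext) (simp add: algebra_simps)
qed

end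

subsection \<open>First variation of the conformal arclength\<close>

lemma times_diff2_diff:
  "times_diff2 k W g \<Longrightarrow> times_diff2 k W h \<Longrightarrow> times_diff2 k W (\<lambda>t x. g t x - h t x)"
  using times_diff2_add[of k W g "\<lambda>t x. (-1) * h t x"] times_diff2_mult[OF times_diff2_const[of k W "-1"]] by simp

lemma times_diff2_sum:
  "(\<And>i. i \<in> A \<Longrightarrow> times_diff2 k W (g i)) \<Longrightarrow> times_diff2 k W (\<lambda>t x. \<Sum>i\<in>A. g i t x)"
  by (induction A rule: infinite_finite_induct) (simp_all add: times_diff2_const times_diff2_add)

lemma times_diff2_bil:
  "(\<And>i. times_diff2 k W (\<lambda>t x. u t x i)) \<Longrightarrow> (\<And>i. times_diff2 k W (\<lambda>t x. v t x i)) \<Longrightarrow>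
    times_diff2 k W (\<lambda>t x. bil n (u t x) (v t x))"
  unfolding bil_def by (intro times_diff2_diff times_diff2_sum times_diff2_mult)

lemma times_diff2_curv4:
  assumes "\<And>i. times_diff2 k W (\<lambda>t x. u t x i)" "\<And>i. times_diff2 k W (\<lambda>t x. v t x i)"
    "\<And>i. times_diff2 k W (\<lambda>t x. w t x i)" "\<And>i. times_diff2 k W (\<lambda>t x. z t x i)"
    "\<And>t x. (t,x) \<in> W \<Longrightarrow> bil n (v t x) (v t x) \<noteq> 0"
  shows "times_diff2 k W (\<lambda>t x. curv4 n (u t x) (v t x) (w t x) (z t x))"
proof -
  have g: "times_diff2 k W (\<lambda>t x. gram4 n (u t x) (v t x) (w t x) (z t x))"
    unfolding gram4_def sym_det4_def
    by (intro times_diff2_diff times_diff2_add times_diff2_mult times_diff2_bil assms(1-4))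
  have i: "times_diff2 k W (\<lambda>t x. inverse (bil n (v t x) (v t x)))"
    by (intro times_diff2_inverse times_diff2_bil assms)
  have "times_diff2 k W (\<lambda>t x. (-1) * (gram4 n (u t x) (v t x) (w t x) (z t x) *
      (inverse (bil n (v t x) (v t x)) * (inverse (bil n (v t x) (v t x)) *
      (inverse (bil n (v t x) (v t x)) * inverse (bil n (v t x) (v t x)))))))"
    by (intro times_diff2_mult times_diff2_const g i)
  then show ?thesis
    by (simp add: curv4_def divide_inverse power_inverse[symmetric] numeral_eq_Suc)
qed

lemma times_diff2_iterate:
  assumes "open W" "\<And>k. times_diff2 k W g"
  shows "times_diff2 k W ((partial_x ^^ j) g)"
proof -
  have "\<forall>k. times_diff2 k W ((partial_x ^^ j) g)"
    by (induction j) (use assms times_diff2_partials(4)[OF assms(1)] in \<open>auto simp del: times_diff2.simps\<close>)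
  then show ?thesis by blast
qed

text \<open>At the frame -det = 1, and the variation of -det is the trace of G^-1 dG, where G is its
  own inverse. It picks up the entries <w3,w3>, <w1,w1> and, twice with a minus sign, <w0,w2>; the
  denominator subtracts four times the variation of <w1,w1>, which turns 1 into -3.\<close>

lemma DERIV_curv4_standard:
  assumes v: "vder w0 t0 0" "vder w1 t1 0" "vder w2 t2 0" "vder w3 t3 0"
    and g: "bil n (w0 0) (w0 0) = 0" "bil n (w0 0) (w1 0) = 0" "bil n (w0 0) (w2 0) = -1" "bil n (w0 0) (w3 0) = 0"
      "bil n (w1 0) (w1 0) = 1" "bil n (w1 0) (w2 0) = 0" "bil n (w1 0) (w3 0) = 0"
      "bil n (w2 0) (w2 0) = 0" "bil n (w2 0) (w3 0) = 0" "bil n (w3 0) (w3 0) = 1"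
  shows "((\<lambda>t. curv4 n (w0 t) (w1 t) (w2 t) (w3 t)) has_real_derivative
     2 * (bil n t3 (w3 0) - bil n t0 (w2 0) - bil n t2 (w0 0) - 3 * bil n t1 (w1 0))) (at 0)"
proof -
  note B = bil_DERIV
  have e: "((\<lambda>t. - sym_det4 (a t) (b t) (c t) (d t) (e t) (f t) (g t) (h t) (i t) (j t) / (e t) ^ 4)
     has_real_derivative (j' - 2 * c' - 3 * e')) (at 0)"
    if "(a has_real_derivative a') (at 0)" "(b has_real_derivative b') (at 0)" "(c has_real_derivative c') (at 0)"
      "(d has_real_derivative d') (at 0)" "(e has_real_derivative e') (at 0)" "(f has_real_derivative f') (at 0)"
      "(g has_real_derivative g') (at 0)" "(h has_real_derivative h') (at 0)" "(i has_real_derivative i') (at 0)"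
      "(j has_real_derivative j') (at 0)"
      "a 0 = 0" "b 0 = 0" "c 0 = -1" "d 0 = 0" "e 0 = 1" "f 0 = 0" "g 0 = 0" "h 0 = 0" "i 0 = 0" "j 0 = 1"
    for a b c d e f g h i j :: "real \<Rightarrow> real" and a' b' c' d' e' f' g' h' i' j'
    unfolding sym_det4_def
    by (rule derivative_eq_intros that refl | simp add: that)+
  show ?thesis
    unfolding curv4_def gram4_def
    by (rule DERIV_cong[OF e[OF B[OF v(1) v(1)] B[OF v(1) v(2)] B[OF v(1) v(3)] B[OF v(1) v(4)]
         B[OF v(2) v(2)] B[OF v(2) v(3)] B[OF v(2) v(4)] B[OF v(3) v(3)] B[OF v(3) v(4)] B[OF v(4) v(4)] g]])
       (simp add: bil_commute[of n "w0 0" t2] bil_commute[of n "w1 0" t1] bil_commute[of n "w3 0" t3])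
qed

section \<open>Linearisation along fixed columns and integration by parts\<close>

context moving_frame
begin

lemma e0_nullvec: "x \<in> U \<Longrightarrow> nullvec n (e0 x)"
  using supp(1) g(1,3) by (force simp: nullvec_def bil_zero_left)

text \<open>The factor from the normalised lift of the undisturbed curve to \<open>e0\<close>. It
  stays fixed while t varies, as do all coefficients derived from it, so passing from a lift to the
  W_j commutes with d/dt.\<close>

definition kap where "kap = (\<lambda>x. e0 x 0 + e0 x (n+1))"

lemma kap: "x \<in> U \<Longrightarrow> kap x \<noteq> 0" "smooth_on_R U kap"
  using nullvec_sum_nonzero[OF e0_nullvec] sm(1) oU unfolding kap_def vsmooth_def
  by (auto intro: smooth_intros)

text \<open>\<open>cjk\<close> is the coefficient of the k-th derivative of the lift in W_j, with
  \<open>kap\<close> in the role of c00. Each row results from the previous one by applying D and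
  removing the \<mu>-term.\<close>

definition c10 where "c10 = (\<lambda>x. deriv kap x / \<sigma> x)"
definition c11 where "c11 = (\<lambda>x. kap x / \<sigma> x)"
definition c20 where "c20 = (\<lambda>x. deriv c10 x / \<sigma> x - \<mu> x * kap x)"
definition c21 where "c21 = (\<lambda>x. (c10 x + deriv c11 x) / \<sigma> x)"
definition c22 where "c22 = (\<lambda>x. c11 x / \<sigma> x)"
definition c30 where "c30 = (\<lambda>x. deriv c20 x / \<sigma> x - \<mu> x * c10 x)"
definition c31 where "c31 = (\<lambda>x. (c20 x + deriv c21 x) / \<sigma> x - \<mu> x * c11 x)"
definition c32 where "c32 = (\<lambda>x. (c21 x + deriv c22 x) / \<sigma> x)"
definition c33 where "c33 = (\<lambda>x. c22 x / \<sigma> x)"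

text \<open>For a lift with jet \<open>Y\<close> these are \<open>W\<^sub>0 = \<kappa>Y\<close>, \<open>W\<^sub>1 = DW\<^sub>0\<close>, \<open>W\<^sub>2 = DW\<^sub>1 - \<mu>W\<^sub>0\<close> and
\<open>W\<^sub>3 = DW\<^sub>2 - \<mu>W\<^sub>1\<close> with \<open>D = \<sigma>\<^sup>-\<^sup>1 d/dx\<close>; for the lift proportional to \<open>e0\<close> itself they are \<open>e0, e1, en, e2\<close>.\<close>
definition w0 where "w0 Y x = (\<lambda>i. kap x * Y (0::nat) x i)"
definition w1 where "w1 Y x = (\<lambda>i. c10 x * Y (0::nat) x i + c11 x * Y 1 x i)"
definition w2 where "w2 Y x = (\<lambda>i. c20 x * Y (0::nat) x i + c21 x * Y 1 x i + c22 x * Y 2 x i)"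
definition w3 where "w3 Y x = (\<lambda>i. c30 x * Y (0::nat) x i + c31 x * Y 1 x i + c32 x * Y 2 x i + c33 x * Y 3 x i)"

lemma c_smooth: "smooth_on_R U c10" "smooth_on_R U c11" "smooth_on_R U c20" "smooth_on_R U c21" "smooth_on_R U c22"
proof -
  have nz: "\<sigma> x \<noteq> 0" if "x \<in> U" for x using pos[OF that] by simp
  note S = oU sm(5,6) kap(2) nz
  show 1: "smooth_on_R U c10" unfolding c10_def by (intro smooth_intros S)
  show 2: "smooth_on_R U c11" unfolding c11_def by (intro smooth_intros S)
  show "smooth_on_R U c20" unfolding c20_def by (intro smooth_intros S 1)
  show "smooth_on_R U c21" unfolding c21_def by (intro smooth_intros S 1 2)
  show "smooth_on_R U c22" unfolding c22_def by (intro smooth_intros S 2)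
qed

lemma w_vder:
  assumes x: "x \<in> U" and Y: "\<And>j. j < 3 \<Longrightarrow> vder (Y j) (Y (Suc j) x) x"
  shows "vder (w0 Y) (\<lambda>i. \<sigma> x * w1 Y x i) x"
    "vder (w1 Y) (\<lambda>i. \<sigma> x * (\<mu> x * w0 Y x i + w2 Y x i)) x"
    "vder (w2 Y) (\<lambda>i. \<sigma> x * (\<mu> x * w1 Y x i + w3 Y x i)) x"
proof -
  have nz: "\<sigma> x \<noteq> 0" using pos[OF x] by simp
  note D = smooth_DERIV[OF oU _ x]
  have Y: "vder (Y 0) (Y 1 x) x" "vder (Y 1) (Y 2 x) x" "vder (Y 2) (Y 3 x) x"
    using Y[of 0] Y[of 1] Y[of 2] by (simp_all add: numeral_2_eq_2 numeral_3_eq_3)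
  have "vder (w0 Y) (\<lambda>i. deriv kap x * Y 0 x i + kap x * Y 1 x i) x"
    unfolding w0_def by (intro vder_scale D kap Y)
  moreover have "(\<lambda>i. deriv kap x * Y 0 x i + kap x * Y 1 x i) = (\<lambda>i. \<sigma> x * w1 Y x i)"
    using nz by (simp add: w1_def c10_def c11_def distrib_left)
  ultimately show "vder (w0 Y) (\<lambda>i. \<sigma> x * w1 Y x i) x" by simp
  have "vder (w1 Y) (\<lambda>i. (deriv c10 x * Y 0 x i + c10 x * Y 1 x i) + (deriv c11 x * Y 1 x i + c11 x * Y 2 x i)) x"
    unfolding w1_def by (intro vder_add vder_scale D c_smooth Y)
  moreover have "(\<lambda>i. (deriv c10 x * Y 0 x i + c10 x * Y 1 x i) + (deriv c11 x * Y 1 x i + c11 x * Y 2 x i))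
    = (\<lambda>i. \<sigma> x * (\<mu> x * w0 Y x i + w2 Y x i))"
  proof -
    have "\<sigma> x * c20 x = deriv c10 x - \<sigma> x * \<mu> x * kap x" "\<sigma> x * c21 x = c10 x + deriv c11 x" "\<sigma> x * c22 x = c11 x"
      using nz by (simp_all add: c20_def c21_def c22_def right_diff_distrib)
    then show ?thesis unfolding w0_def w2_def
      by (intro ext) (simp add: distrib_left mult.assoc[symmetric], simp add: algebra_simps)
  qed
  ultimately show "vder (w1 Y) (\<lambda>i. \<sigma> x * (\<mu> x * w0 Y x i + w2 Y x i)) x" by simp
  have "vder (w2 Y) (\<lambda>i. (deriv c20 x * Y 0 x i + c20 x * Y 1 x i) + (deriv c21 x * Y 1 x i + c21 x * Y 2 x i)
      + (deriv c22 x * Y 2 x i + c22 x * Y 3 x i)) x"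
    unfolding w2_def by (intro vder_add vder_scale D c_smooth Y)
  moreover have "(\<lambda>i. (deriv c20 x * Y 0 x i + c20 x * Y 1 x i) + (deriv c21 x * Y 1 x i + c21 x * Y 2 x i)
      + (deriv c22 x * Y 2 x i + c22 x * Y 3 x i)) = (\<lambda>i. \<sigma> x * (\<mu> x * w1 Y x i + w3 Y x i))"
  proof -
    have "\<sigma> x * c30 x = deriv c20 x - \<sigma> x * \<mu> x * c10 x" "\<sigma> x * c31 x = c20 x + deriv c21 x - \<sigma> x * \<mu> x * c11 x"
      "\<sigma> x * c32 x = c21 x + deriv c22 x" "\<sigma> x * c33 x = c22 x"
      using nz by (simp_all add: c30_def c31_def c32_def c33_def right_diff_distrib)
    then show ?thesis unfolding w1_def w3_def
      by (intro ext) (simp add: distrib_left mult.assoc[symmetric], simp add: algebra_simps)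
  qed
  ultimately show "vder (w2 Y) (\<lambda>i. \<sigma> x * (\<mu> x * w1 Y x i + w3 Y x i)) x" by simp
qed

lemma w_frame:
  assumes Y: "\<And>j x. j < 3 \<Longrightarrow> x \<in> U \<Longrightarrow> vder (Y j) (Y (Suc j) x) x"
    and Y0: "\<And>x. x \<in> U \<Longrightarrow> w0 Y x = e0 x" and x: "x \<in> U"
  shows "w1 Y x = e1 x" "w2 Y x = en x" "w3 Y x = e2 x"
proof -
  have nz: "\<sigma> x \<noteq> 0" if "x \<in> U" for x using pos[OF that] by simp
  have 1: "w1 Y x = e1 x" if x: "x \<in> U" for x
  proof -
    have "vder e0 (\<lambda>i. \<sigma> x * w1 Y x i) x"
      by (rule vder_transform[OF oU x Y0 w_vder(1)[where Y = Y, OF x Y[OF _ x]]])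
    from vder_unique[OF this d0[OF x]] nz[OF x] show ?thesis by (auto simp: fun_eq_iff)
  qed
  have 2: "w2 Y x = en x" if x: "x \<in> U" for x
  proof -
    have "vder e1 (\<lambda>i. \<sigma> x * (\<mu> x * w0 Y x i + w2 Y x i)) x"
      by (rule vder_transform[OF oU x 1 w_vder(2)[where Y = Y, OF x Y[OF _ x]]])
    from vder_unique[OF this d1[OF x]] nz[OF x] Y0[OF x] show ?thesis by (auto simp: fun_eq_iff)
  qed
  show "w1 Y x = e1 x" "w2 Y x = en x" using 1 2 x by auto
  have "vder en (\<lambda>i. \<sigma> x * (\<mu> x * w1 Y x i + w3 Y x i)) x"
    by (rule vder_transform[OF oU x 2 w_vder(3)[where Y = Y, OF x Y[OF _ x]]])
  from vder_unique[OF this dn[OF x]] nz[OF x] 1[OF x] show "w3 Y x = e2 x" by (auto simp: fun_eq_iff)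
qed

text \<open>\<open>Y\<close> may be the jet of the lift of f_t for any t, while the columns remain
  those of f. The recursion of the W_j has the shape of the structure equations, so
  \<open>curv4_moving\<close> applies with p = \<sigma> W_3; this factor of W_3 supplies the second
  \<sigma>^2.\<close>

lemma curv4_w:
  assumes x: "x \<in> U" and Y: "\<And>j x. j < 3 \<Longrightarrow> x \<in> U \<Longrightarrow> vder (Y j) (Y (Suc j) x) x"
    and nul: "\<And>x. x \<in> U \<Longrightarrow> bil n (Y 0 x) (Y 0 x) = 0"
  shows "curv4 n (Y 0 x) (Y 1 x) (Y 2 x) (Y 3 x) = \<sigma> x ^ 4 * curv4 n (w0 Y x) (w1 Y x) (w2 Y x) (w3 Y x)"
proof -
  have nz: "\<sigma> x \<noteq> 0" if "x \<in> U" for x using pos[OF that] by simp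
  have V0: "vderiv (Y 0) y = Y 1 y" if "y \<in> U" for y using vder_imp_vderiv[OF Y[of 0 y]] that by simp
  have V1: "vderiv (vderiv (Y 0)) y = Y 2 y" if y: "y \<in> U" for y
    by (rule vder_imp_vderiv, rule vder_transform[OF oU y, of "Y 1"]) (use V0 Y[of 1 y] y in \<open>auto simp: numeral_2_eq_2\<close>)
  have V2: "vderiv (vderiv (vderiv (Y 0))) x = Y 3 x"
    by (rule vder_imp_vderiv, rule vder_transform[OF oU x, of "Y 2"]) (use V1 Y[of 2 x] x in \<open>auto simp: numeral_3_eq_3 numeral_2_eq_2\<close>)
  have b0: "bil n (w0 Y y) (w0 Y y) = 0" if "y \<in> U" for y using nul[OF that] by (simp add: w0_def bil_simps)
  have b1: "bil n (w0 Y x) (w1 Y x) = 0"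
  proof -
    have "((\<lambda>y. 0) has_real_derivative bil n (\<lambda>i. \<sigma> x * w1 Y x i) (w0 Y x) + bil n (w0 Y x) (\<lambda>i. \<sigma> x * w1 Y x i)) (at x)"
      by (rule DERIV_transform_open[OF oU x _ bil_DERIV[OF w_vder(1)[where Y = Y, OF x Y[OF _ x]] w_vder(1)[where Y = Y, OF x Y[OF _ x]]]])
         (use b0 in auto)
    from DERIV_unique[OF this DERIV_const] show ?thesis
      using nz[OF x] by (simp add: bil_simps bil_commute[of n "w1 Y x" "w0 Y x"])
  qed
  have "curv4 n (Y 0 x) (vderiv (Y 0) x) (vderiv (vderiv (Y 0)) x) (vderiv (vderiv (vderiv (Y 0))) x)
     = (\<sigma> x)\<^sup>2 * curv4 n (w0 Y x) (w1 Y x) (w2 Y x) (\<lambda>i. \<sigma> x * w3 Y x i)"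
  proof (rule curv4_moving[OF oU x, of "\<lambda>y. 0" \<sigma> "\<lambda>y. \<sigma> y * \<mu> y" "\<lambda>y. 1 / kap y"])
    show "smooth_on_R U (\<lambda>y. 1 / kap y)" by (intro smooth_intros oU kap)
    show "vder (w1 Y) (\<lambda>i. \<sigma> y * \<mu> y * w0 Y y i + \<sigma> y * w2 Y y i) y" if "y \<in> U" for y
      using w_vder(2)[where Y = Y, OF that Y[OF _ that]] by (simp add: algebra_simps)
    show "vder (w2 Y) (\<lambda>i. \<sigma> y * \<mu> y * w1 Y y i + \<sigma> y * w3 Y y i - 0 * w2 Y y i) y" if "y \<in> U" for y
      using w_vder(3)[where Y = Y, OF that Y[OF _ that]] by (simp add: algebra_simps)
    show "Y 0 y = (\<lambda>i. 1 / kap y * w0 Y y i)" if "y \<in> U" for y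
      using kap(1)[OF that] by (auto simp: w0_def)
  qed (use w_vder(1) Y b0 b1 x nz kap in \<open>auto intro: smooth_intros oU sm\<close>)
  also have "curv4 n (w0 Y x) (w1 Y x) (w2 Y x) (\<lambda>i. \<sigma> x * w3 Y x i) = (\<sigma> x)\<^sup>2 * curv4 n (w0 Y x) (w1 Y x) (w2 Y x) (w3 Y x)"
    unfolding curv4_def using gram4_fth[of n _ _ _ 0 0 0 "\<sigma> x"] by simp
  finally show ?thesis unfolding V2 V1[OF x] V0[OF x] by (simp add: power2_eq_square numeral_eq_Suc)
qed

lemma gram_frame:
  assumes "x \<in> U"
  shows "curv4 n (e0 x) (e1 x) (en x) (e2 x) = 1"
  using g[OF assms] unit[OF assms] by (subst curv4_orthogonal) auto

text \<open>With \<open>Y\<close> the jet of a variation field, \<open>\<sigma> lagr Y / 2\<close> is the variation of the arclength density.\<close>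
definition lagr where
  "lagr Y x = bil n (w3 Y x) (e2 x) - bil n (w0 Y x) (en x) - bil n (w2 Y x) (e0 x) - 3 * bil n (w1 Y x) (e1 x)"

text \<open>Nullity of the lifts reduces the Lagrangian to <W_3,e_2> - <W_1,e_1>. The terms with
  W_2, W_1 and W_0 against e_2, De_2 and D^2 e_2 move the derivatives of <W_3,e_2> onto e_2 one at a
  time; the term with \<mu> does the same for the leftover \<mu> <W_1,e_2>, and <W_0,e_1> disposes
  of <W_1,e_1>.\<close>

definition bdry where
  "bdry Y x = bil n (w2 Y x) (e2 x) - bil n (w0 Y x) (e1 x) - bil n (w1 Y x) (dop \<sigma> e2 x)
     + bil n (w0 Y x) (dop \<sigma> (dop \<sigma> e2) x) - \<mu> x * bil n (w0 Y x) (e2 x)"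

lemma bdry_DERIV:
  assumes x: "x \<in> U" and Y: "\<And>j x. j < 3 \<Longrightarrow> x \<in> U \<Longrightarrow> vder (Y j) (Y (Suc j) x) x"
    and perp: "\<And>x. x \<in> U \<Longrightarrow> bil n (w0 Y x) (e0 x) = 0"
  shows "(bdry Y has_real_derivative \<sigma> x * lagr Y x - \<sigma> x * bil n (w0 Y x) (EL \<sigma> \<mu> e2 en x)) (at x)"
proof -
  have nz: "\<sigma> x \<noteq> 0" if "x \<in> U" for x using pos[OF that] by simp
  define y2 y3 y4 where "y2 = dop \<sigma> e2" and "y3 = dop \<sigma> y2" and "y4 = dop \<sigma> y3"
  have s2: "vsmooth U y2" unfolding y2_def by (rule vsmooth_dop[OF oU sm(3,5) nz])
  have s3: "vsmooth U y3" unfolding y3_def by (rule vsmooth_dop[OF oU s2 sm(5) nz])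
  have v2: "vder e2 (\<lambda>i. \<sigma> x * y2 x i) x" unfolding y2_def by (rule vder_dop[where \<sigma> = \<sigma>, OF oU sm(3) x nz[OF x]])
  have v3: "vder y2 (\<lambda>i. \<sigma> x * y3 x i) x" unfolding y3_def by (rule vder_dop[where \<sigma> = \<sigma>, OF oU s2 x nz[OF x]])
  have v4: "vder y3 (\<lambda>i. \<sigma> x * y4 x i) x" unfolding y4_def by (rule vder_dop[where \<sigma> = \<sigma>, OF oU s3 x nz[OF x]])
  have EL: "EL \<sigma> \<mu> e2 en x = (\<lambda>i. en x i - y4 x i + deriv \<mu> x / \<sigma> x * e2 x i + 2 * \<mu> x * y2 x i)"
    by (simp add: EL_def y2_def y3_def y4_def)
  note W = w_vder[where Y = Y, OF _ Y]
  have p1: "bil n (w1 Y x) (e0 x) + bil n (w0 Y x) (e1 x) = 0" if x: "x \<in> U" for x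
  proof -
    have "((\<lambda>y. 0) has_real_derivative bil n (\<lambda>i. \<sigma> x * w1 Y x i) (e0 x) + bil n (w0 Y x) (\<lambda>i. \<sigma> x * e1 x i)) (at x)"
      by (rule DERIV_transform_open[OF oU x _ bil_DERIV[OF W(1)[OF x _ x] d0[OF x]]]) (use perp in auto)
    from DERIV_unique[OF this DERIV_const] have "\<sigma> x * (bil n (w1 Y x) (e0 x) + bil n (w0 Y x) (e1 x)) = 0"
      by (simp add: bil_simps distrib_left)
    then show ?thesis using nz[OF x] by simp
  qed
  \<comment> \<open>The second derivative of <W_0,e_0> = 0; it eliminates <W_2,e_0> from
    \<open>lagr\<close>.\<close>
  have p2: "bil n (w2 Y x) (e0 x) + 2 * bil n (w1 Y x) (e1 x) + bil n (w0 Y x) (en x) = 0"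
  proof -
    have "((\<lambda>y. 0) has_real_derivative
      (bil n (\<lambda>i. \<sigma> x * (\<mu> x * w0 Y x i + w2 Y x i)) (e0 x) + bil n (w1 Y x) (\<lambda>i. \<sigma> x * e1 x i)) +
      (bil n (\<lambda>i. \<sigma> x * w1 Y x i) (e1 x) + bil n (w0 Y x) (\<lambda>i. \<sigma> x * (\<mu> x * e0 x i + en x i)))) (at x)"
      by (rule DERIV_transform_open[OF oU x _ DERIV_add[OF bil_DERIV[OF W(2)[OF x _ x] d0[OF x]] bil_DERIV[OF W(1)[OF x _ x] d1[OF x]]]])
         (use p1 in auto)
    from DERIV_unique[OF this DERIV_const]
    have "\<sigma> x * (bil n (w2 Y x) (e0 x) + 2 * bil n (w1 Y x) (e1 x) + bil n (w0 Y x) (en x)) = 0"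
      using perp[OF x] by (simp add: bil_simps algebra_simps)
    then show ?thesis using nz[OF x] by simp
  qed
  have "(bdry Y has_real_derivative
     (bil n (\<lambda>i. \<sigma> x * (\<mu> x * w1 Y x i + w3 Y x i)) (e2 x) + bil n (w2 Y x) (\<lambda>i. \<sigma> x * y2 x i))
     - (bil n (\<lambda>i. \<sigma> x * w1 Y x i) (e1 x) + bil n (w0 Y x) (\<lambda>i. \<sigma> x * (\<mu> x * e0 x i + en x i)))
     - (bil n (\<lambda>i. \<sigma> x * (\<mu> x * w0 Y x i + w2 Y x i)) (y2 x) + bil n (w1 Y x) (\<lambda>i. \<sigma> x * y3 x i))
     + (bil n (\<lambda>i. \<sigma> x * w1 Y x i) (y3 x) + bil n (w0 Y x) (\<lambda>i. \<sigma> x * y4 x i))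
     - (\<mu> x * (bil n (\<lambda>i. \<sigma> x * w1 Y x i) (e2 x) + bil n (w0 Y x) (\<lambda>i. \<sigma> x * y2 x i)) + deriv \<mu> x * bil n (w0 Y x) (e2 x))) (at x)"
    unfolding bdry_def[abs_def] y2_def[symmetric] y3_def[symmetric]
    by (intro DERIV_add DERIV_diff DERIV_mult' bil_DERIV W(1)[OF x _ x] W(2)[OF x _ x] W(3)[OF x _ x] d0[OF x] d1[OF x] v2 v3 v4
        smooth_DERIV[OF oU sm(6) x])
  then show ?thesis
  proof (rule DERIV_cong)
    have p2': "bil n (w2 Y x) (e0 x) = - 2 * bil n (w1 Y x) (e1 x) - bil n (w0 Y x) (en x)" using p2 by linarith
    define m where "m = deriv \<mu> x / \<sigma> x"
    have dm: "deriv \<mu> x = \<sigma> x * m" using nz[OF x] by (simp add: m_def)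
    have EL': "EL \<sigma> \<mu> e2 en x = (\<lambda>i. en x i - y4 x i + m * e2 x i + 2 * \<mu> x * y2 x i)"
      unfolding EL m_def by (rule refl)
    show "bil n (\<lambda>i. \<sigma> x * (\<mu> x * w1 Y x i + w3 Y x i)) (e2 x) + bil n (w2 Y x) (\<lambda>i. \<sigma> x * y2 x i)
     - (bil n (\<lambda>i. \<sigma> x * w1 Y x i) (e1 x) + bil n (w0 Y x) (\<lambda>i. \<sigma> x * (\<mu> x * e0 x i + en x i)))
     - (bil n (\<lambda>i. \<sigma> x * (\<mu> x * w0 Y x i + w2 Y x i)) (y2 x) + bil n (w1 Y x) (\<lambda>i. \<sigma> x * y3 x i))
     + (bil n (\<lambda>i. \<sigma> x * w1 Y x i) (y3 x) + bil n (w0 Y x) (\<lambda>i. \<sigma> x * y4 x i))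
     - (\<mu> x * (bil n (\<lambda>i. \<sigma> x * w1 Y x i) (e2 x) + bil n (w0 Y x) (\<lambda>i. \<sigma> x * y2 x i)) + deriv \<mu> x * bil n (w0 Y x) (e2 x))
     = \<sigma> x * lagr Y x
       - \<sigma> x * bil n (w0 Y x) (EL \<sigma> \<mu> e2 en x)"
      unfolding EL' dm lagr_def bil_simps p2' perp[OF x] by (simp add: algebra_simps)
  qed
qed

end

section \<open>Admissible variations and differentiation under the integral\<close>

lemma positive_near_slice:
  fixes g :: "real \<Rightarrow> real \<Rightarrow> real"
  assumes "open W" "continuous_on W (\<lambda>(t,x). g t x)" "compact K"
    "\<And>x. x \<in> K \<Longrightarrow> (0,x) \<in> W" "\<And>x. x \<in> K \<Longrightarrow> g 0 x > 0"
  obtains \<delta> where "\<delta> > 0" "\<And>t x. \<bar>t\<bar> < \<delta> \<Longrightarrow> x \<in> K \<Longrightarrow> (t,x) \<in> W \<and> g t x > 0"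
proof -
  have o: "open (W \<inter> (\<lambda>(t,x). g t x) -` {0<..})"
    by (rule continuous_open_preimage[OF assms(2,1)]) simp
  have s: "{0} \<times> K \<subseteq> W \<inter> (\<lambda>(t,x). g t x) -` {0<..}" using assms(4,5) by auto
  from Elementary_Topology.tube_lemma[OF assms(3) o s]
  obtain X0 where X: "0 \<in> X0" "open X0" "X0 \<times> K \<subseteq> W \<inter> (\<lambda>(t,x). g t x) -` {0<..}" by blast
  from openE[OF X(2,1)] obtain \<delta> where d: "\<delta> > 0" "ball 0 \<delta> \<subseteq> X0" by blast
  show thesis
  proof (rule that[OF d(1)])
    fix t x assume "\<bar>t\<bar> < \<delta>" "x \<in> K"
    then have "(t,x) \<in> X0 \<times> K" using d(2) by auto
    then show "(t,x) \<in> W \<and> g t x > 0" using X(3) by auto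
  qed
qed

text \<open>The set \<open>U\<close> is I in the direction from the equations to the geodesic, where
  the canonical columns are global, and the domain of one given special frame in the
  converse.\<close>

locale arclength_variation = moving_frame +
  fixes I :: "real set" and f :: "real \<Rightarrow> (nat \<Rightarrow> real) set" and a b \<epsilon> :: real
    and ft :: "real \<Rightarrow> real \<Rightarrow> (nat \<Rightarrow> real) set"
  assumes n2: "n \<ge> 2" and oI: "open I" and UI: "U \<subseteq> I" and ab: "{a..b} \<subseteq> U" "a \<le> b"
    and adm: "admissible_variation n I f {a..b} \<epsilon> ft"
    and fe: "\<And>x. x \<in> U \<Longrightarrow> proj (e0 x) = f x"
begin

definition "T = {-\<epsilon><..<\<epsilon>}"

text \<open>The jet in x of the normalised lift of \<open>ft t\<close>; \<open>M\<close> is its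
  velocity in t. The normalised lift is used because it is defined on all of I for every t.\<close>

definition X :: "nat \<Rightarrow> real \<Rightarrow> real \<Rightarrow> nat \<Rightarrow> real" where
  "X j t x i = (partial_x ^^ j) (\<lambda>t x. nlift n (ft t x) i) t x"
definition M :: "nat \<Rightarrow> real \<Rightarrow> real \<Rightarrow> nat \<Rightarrow> real" where
  "M j t x i = partial_t (\<lambda>t x. X j t x i) t x"

lemma X_0: "X 0 t x = nlift n (ft t x)"
  by (simp add: X_def fun_eq_iff)

lemma oW: "open (T \<times> I)" and T0: "0 \<in> T" and oT: "open T"
  using adm oI by (auto simp: T_def admissible_variation_def intro: open_Times)

lemma local_lift:
  assumes "p \<in> T \<times> I"
  obtains W G where "open W" "p \<in> W" "\<And>i. smooth_on_R2 W (\<lambda>t y. G t y i)"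
    "\<And>t y. (t,y) \<in> W \<Longrightarrow> nullvec n (G t y) \<and> proj (G t y) = ft t y"
proof -
  have "\<forall>p\<in>T \<times> I. \<exists>W G. open W \<and> p \<in> W \<and> W \<subseteq> {-\<epsilon><..<\<epsilon>} \<times> I \<and>
        (\<forall>i. smooth_on_R2 W (\<lambda>t y. G t y i)) \<and>
        (\<forall>(t,y)\<in>W. nullvec n (G t y) \<and> proj (G t y) = ft t y)"
    using adm unfolding T_def admissible_variation_def by blast
  from bspec[OF this assms] obtain W G where "open W" "p \<in> W" "\<forall>i. smooth_on_R2 W (\<lambda>t y. G t y i)"
        "\<forall>(t,y)\<in>W. nullvec n (G t y) \<and> proj (G t y) = ft t y" by blast
  then show thesis by (intro that[of W G]) auto
qed

lemma td_N: "times_diff2 k (T \<times> I) (\<lambda>t x. nlift n (ft t x) i)"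
proof (rule times_diff2_local)
  fix p assume "p \<in> T \<times> I"
  then obtain W G where W: "open W" "p \<in> W" "\<And>i. smooth_on_R2 W (\<lambda>t y. G t y i)"
    "\<And>t y. (t,y) \<in> W \<Longrightarrow> nullvec n (G t y) \<and> proj (G t y) = ft t y" by (rule local_lift) blast
  note G = smooth_on_R2_times_diff2[OF W(1) W(3)]
  have "times_diff2 k W (\<lambda>t y. G t y i * inverse (G t y 0 + G t y (n+1)))"
    using W(4) nullvec_sum_nonzero
    by (intro times_diff2_mult times_diff2_inverse times_diff2_add G) auto
  then have "times_diff2 k W (\<lambda>t x. nlift n (ft t x) i)"
  proof (rule times_diff2_cong[OF W(1), rotated])
    fix t x assume "(t,x) \<in> W"
    then have "nullvec n (G t x)" "proj (G t x) = ft t x" using W(4) by auto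
    then show "G t x i * inverse (G t x 0 + G t x (n+1)) = nlift n (ft t x) i"
      using nlift_proj[of n "G t x"] by (simp add: divide_inverse)
  qed
  then show "\<exists>V. open V \<and> p \<in> V \<and> times_diff2 k V (\<lambda>t x. nlift n (ft t x) i)" using W by blast
qed

lemma td_X: "times_diff2 k (T \<times> I) (\<lambda>t x. X j t x i)"
  unfolding X_def using times_diff2_iterate[OF oW td_N] by simp

lemma X_t: "t \<in> T \<Longrightarrow> x \<in> I \<Longrightarrow> ((\<lambda>s. X j s x i) has_real_derivative M j t x i) (at t)"
  using times_diff2_partials(1)[OF oW td_X, of t x j i] by (simp add: M_def)

lemma X_x: "t \<in> T \<Longrightarrow> x \<in> I \<Longrightarrow> vder (X j t) (X (Suc j) t x) x"
  using times_diff2_partials(2)[OF oW td_X, of t x j] unfolding vder_def by (simp add: X_def)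

text \<open>\<open>M\<close> arises by differentiating in x first and in t last. Exchanging the two
  makes it the jet of the velocity field, as the integration by parts in \<open>bdry_DERIV\<close>
  requires.\<close>

lemma M_x:
  assumes "t \<in> T" "x \<in> I"
  shows "vder (M j t) (M (Suc j) t x) x"
  unfolding vder_def
proof
  fix i
  show "((\<lambda>y. M j t y i) has_real_derivative M (Suc j) t x i) (at x)"
  proof (rule mixed_partials[OF oW, where g = "\<lambda>t x. X j t x i" and gx = "\<lambda>t x. X (Suc j) t x i"
        and gxt = "\<lambda>t x. M (Suc j) t x i" and gt = "\<lambda>t x. M j t x i"])
    show "((\<lambda>y. X j t y i) has_real_derivative X (Suc j) t x i) (at x)" if "(t,x) \<in> T \<times> I" for t x
      using X_x[of t x j] that by (auto simp: vder_def)
    show "continuous_on (T \<times> I) (\<lambda>(t,x). X (Suc j) t x i)"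
      using times_diff2_continuous[OF td_X] by blast
    have "times_diff2 0 (T \<times> I) (partial_t (\<lambda>t x. X (Suc j) t x i))"
      using times_diff2_partials(3)[OF oW td_X] by blast
    then show "continuous_on (T \<times> I) (\<lambda>(t,x). M (Suc j) t x i)" by (simp add: M_def)
  qed (use assms X_t in auto)
qed

lemma ft_immersion: "t \<in> T \<Longrightarrow> immersion n I (ft t)"
  using adm by (auto simp: admissible_variation_def T_def)

lemma X_null: "t \<in> T \<Longrightarrow> x \<in> I \<Longrightarrow> nullvec n (X 0 t x)"
  using immersion_nlift(2)[OF oI ft_immersion] by (simp add: X_0)

lemma X_jet: "t \<in> T \<Longrightarrow> j < 3 \<Longrightarrow> x \<in> U \<Longrightarrow> vder (X j t) (X (Suc j) t x) x"
  using X_x UI by blast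

lemma X_vderiv:
  assumes "t \<in> T" "x \<in> I"
  shows "vderiv (\<lambda>y. nlift n (ft t y)) x = X 1 t x"
    "vderiv (vderiv (\<lambda>y. nlift n (ft t y))) x = X 2 t x"
    "vderiv (vderiv (vderiv (\<lambda>y. nlift n (ft t y)))) x = X 3 t x"
proof -
  have X0: "(\<lambda>y. nlift n (ft t y)) = X 0 t" by (simp add: X_0 fun_eq_iff)
  have 1: "vderiv (X 0 t) y = X 1 t y" if "y \<in> I" for y
    using vder_imp_vderiv[OF X_x[OF assms(1) that, of 0]] by simp
  have 2: "vderiv (vderiv (X 0 t)) y = X 2 t y" if y: "y \<in> I" for y
    by (rule vder_imp_vderiv, rule vder_transform[OF oI y, of "X 1 t"])
       (use 1 X_x[OF assms(1) y, of 1] in \<open>auto simp: numeral_2_eq_2\<close>)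
  have "vderiv (vderiv (vderiv (X 0 t))) x = X 3 t x"
    by (rule vder_imp_vderiv, rule vder_transform[OF oI assms(2), of "X 2 t"])
       (use 2 X_x[OF assms, of 2] in \<open>auto simp: numeral_3_eq_3 numeral_2_eq_2\<close>)
  then show "vderiv (\<lambda>y. nlift n (ft t y)) x = X 1 t x"
    "vderiv (vderiv (\<lambda>y. nlift n (ft t y))) x = X 2 t x"
    "vderiv (vderiv (vderiv (\<lambda>y. nlift n (ft t y)))) x = X 3 t x"
    using 1 2 assms unfolding X0 by auto
qed

definition "C t x = curv4 n (X 0 t x) (X 1 t x) (X 2 t x) (X 3 t x)"

lemma arclen_C: "t \<in> T \<Longrightarrow> x \<in> I \<Longrightarrow> arclen n I (ft t) x = C t x powr (1/4)"
  using arclen_lift_curv[OF n2 oI ft_immersion, of t x] X_vderiv[of t x]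
  by (simp add: lift_curv_def C_def X_0)

lemma td_C: "times_diff2 k (T \<times> I) C"
proof -
  have "bil n (X 1 t x) (X 1 t x) \<noteq> 0" if "(t,x) \<in> T \<times> I" for t x
    using immersion_nlift(5)[OF oI ft_immersion, of t x] X_vderiv(1)[of t x] that by auto
  then show ?thesis unfolding C_def[abs_def] by (intro times_diff2_curv4 td_X) auto
qed

lemma w0_base:
  assumes x: "x \<in> U"
  shows "w0 (\<lambda>j. X j 0) x = e0 x"
proof -
  have "ft 0 x = f x" using adm x UI by (auto simp: admissible_variation_def)
  then have "X 0 0 x = (\<lambda>i. e0 x i / kap x)"
    using nlift_proj[OF e0_nullvec[OF x]] fe[OF x] by (simp add: X_0 kap_def)
  then show ?thesis using kap(1)[OF x] by (simp add: w0_def)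
qed

lemma w_base:
  assumes x: "x \<in> U"
  shows "w1 (\<lambda>j. X j 0) x = e1 x" "w2 (\<lambda>j. X j 0) x = en x" "w3 (\<lambda>j. X j 0) x = e2 x"
  using w_frame[where Y = "\<lambda>j. X j 0", OF X_jet[OF T0] w0_base x] by auto

lemma C_w:
  assumes "t \<in> T" "x \<in> U"
  shows "C t x = \<sigma> x ^ 4 * curv4 n (w0 (\<lambda>j. X j t) x) (w1 (\<lambda>j. X j t) x) (w2 (\<lambda>j. X j t) x) (w3 (\<lambda>j. X j t) x)"
  unfolding C_def
proof (rule curv4_w[where Y = "\<lambda>j. X j t", OF assms(2) X_jet[OF assms(1)]])
  fix x assume "x \<in> U"
  then show "bil n (X 0 t x) (X 0 t x) = 0"
    using X_null[OF assms(1), of x] UI by (auto simp: nullvec_def)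
qed

lemma C_0: "x \<in> U \<Longrightarrow> C 0 x = \<sigma> x ^ 4"
  by (simp add: C_w[OF T0] w0_base w_base gram_frame)

abbreviation "Mj \<equiv> (\<lambda>j. M j 0)"

lemma M_jet: "j < 3 \<Longrightarrow> x \<in> U \<Longrightarrow> vder (M j 0) (M (Suc j) 0 x) x"
  using M_x[OF T0] UI by blast

lemma w_perp:
  assumes x: "x \<in> U"
  shows "bil n (w0 Mj x) (e0 x) = 0"
proof -
  have xI: "x \<in> I" using x UI by blast
  have v: "vder (\<lambda>t. X 0 t x) (M 0 0 x) 0" using X_t[OF T0 xI] by (simp add: vder_def)
  have "((\<lambda>t. 0) has_real_derivative bil n (M 0 0 x) (X 0 0 x) + bil n (X 0 0 x) (M 0 0 x)) (at 0)"
    by (rule DERIV_transform_open[OF oT T0 _ bil_DERIV[OF v v]])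
       (use X_null xI in \<open>simp add: nullvec_def\<close>)
  from DERIV_unique[OF this DERIV_const] have "bil n (M 0 0 x) (X 0 0 x) = 0"
    by (simp add: bil_commute[of n "X 0 0 x"])
  then show ?thesis using w0_base[OF x, symmetric] by (simp add: w0_def bil_simps)
qed

lemma C_t:
  assumes x: "x \<in> U"
  shows "((\<lambda>t. C t x) has_real_derivative \<sigma> x ^ 4 * (2 * lagr Mj x)) (at 0)"
proof (rule DERIV_transform_open[OF oT T0])
  have D: "((\<lambda>s. X j s x i) has_real_derivative M j 0 x i) (at 0)" for j i
    using X_t[OF T0] x UI by auto
  have v: "vder (\<lambda>t. w0 (\<lambda>j. X j t) x) (w0 Mj x) 0" "vder (\<lambda>t. w1 (\<lambda>j. X j t) x) (w1 Mj x) 0"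
    "vder (\<lambda>t. w2 (\<lambda>j. X j t) x) (w2 Mj x) 0" "vder (\<lambda>t. w3 (\<lambda>j. X j t) x) (w3 Mj x) 0"
    unfolding vder_def w0_def w1_def w2_def w3_def by (intro allI DERIV_add DERIV_cmult D)+
  show "((\<lambda>t. \<sigma> x ^ 4 * curv4 n (w0 (\<lambda>j. X j t) x) (w1 (\<lambda>j. X j t) x) (w2 (\<lambda>j. X j t) x) (w3 (\<lambda>j. X j t) x))
    has_real_derivative \<sigma> x ^ 4 * (2 * lagr Mj x)) (at 0)"
    using DERIV_cmult[OF DERIV_curv4_standard[OF v, of n], of "\<sigma> x ^ 4"] g[OF x] unit[OF x]
    by (simp add: w0_base[OF x] w_base[OF x] lagr_def)
qed (use C_w x in auto)

text \<open>Outside K the points f_t(x) do not move, hence neither does the normalised lift, nor its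
  x-derivatives since I - K is open. The endpoints a and b are covered because K lies in the
  interior of [a,b].\<close>

lemma M_outside:
  assumes "x \<in> I" "x \<notin> {a<..<b}"
  shows "M j 0 x = (\<lambda>i. 0)"
proof -
  obtain K where K: "compact K" "K \<subseteq> interior {a..b}" "\<And>t x. t \<in> T \<Longrightarrow> x \<in> I - K \<Longrightarrow> ft t x = f x"
    using adm unfolding admissible_variation_def T_def by blast
  have xK: "x \<in> I - K" using assms K(2) by (auto simp: interior_atLeastAtMost_real)
  have o: "open (I - K)" using oI K(1) by (simp add: open_Diff compact_imp_closed)
  have "\<forall>t\<in>T. \<forall>y\<in>I - K. X j t y i = X j 0 y i" for i
  proof (induction j)
    case 0
    then show ?case using K(3) T0 by (simp add: X_def)
  next
    case (Suc j)
    show ?case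
    proof (intro ballI)
      fix t y assume ty: "t \<in> T" "y \<in> I - K"
      have "((\<lambda>y. X j t y i) has_real_derivative X (Suc j) t y i) (at y)"
        "((\<lambda>y. X j 0 y i) has_real_derivative X (Suc j) 0 y i) (at y)"
        using X_x[OF ty(1), of y j] X_x[OF T0, of y j] ty by (auto simp: vder_def)
      moreover from this(1) have "((\<lambda>y. X j 0 y i) has_real_derivative X (Suc j) t y i) (at y)"
        by (rule DERIV_transform_open[OF o ty(2), rotated]) (use Suc ty in auto)
      ultimately show "X (Suc j) t y i = X (Suc j) 0 y i" using DERIV_unique by blast
    qed
  qed
  then have c: "X j t x i = X j 0 x i" if "t \<in> T" for t i using that xK by blast
  have "((\<lambda>s. X j 0 x i) has_real_derivative M j 0 x i) (at 0)" for i
    by (rule DERIV_transform_open[OF oT T0 c X_t[OF T0 assms(1)]])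
  then show ?thesis using DERIV_unique[OF _ DERIV_const] by blast
qed

lemma bdry_ends: "bdry Mj a = 0" "bdry Mj b = 0"
proof -
  have "bdry Mj x = 0" if "x \<in> I" "x \<notin> {a<..<b}" for x
    using M_outside[OF that] by (simp add: bdry_def w0_def w1_def w2_def bil_zero_left)
  then show "bdry Mj a = 0" "bdry Mj b = 0" using ab UI by (auto simp: subset_iff)
qed

theorem first_variation:
  "((\<lambda>t. integral {a..b} (\<lambda>x. arclen n I (ft t) x)) has_real_derivative
     integral {a..b} (\<lambda>x. 1/2 * \<sigma> x * bil n (w0 Mj x) (EL \<sigma> \<mu> e2 en x))) (at 0)"
proof -
  have abI: "{a..b} \<subseteq> I" using ab UI by blast
  \<comment> \<open>The curves f_t need not be 1-generic, and the fourth root is not differentiable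
    at 0; compactness of [a,b] keeps the radicand positive for all small t.\<close>
  have "C 0 x > 0" if "x \<in> {a..b}" for x
    using C_0[of x] pos[of x] ab(1) that by auto
  then obtain \<delta> where d: "\<delta> > 0" "\<And>t x. \<bar>t\<bar> < \<delta> \<Longrightarrow> x \<in> {a..b} \<Longrightarrow> (t,x) \<in> T \<times> I \<and> C t x > 0"
    using positive_near_slice[OF oW times_diff2_continuous[OF td_C] compact_Icc[of a b]] T0 abI by blast
  define B where "B = ball (0::real) \<delta>"
  have B: "open B" "convex B" "0 \<in> B" using d(1) by (auto simp: B_def)
  have sub: "B \<times> {a..b} \<subseteq> T \<times> I" and Cp: "\<And>t x. t \<in> B \<Longrightarrow> x \<in> {a..b} \<Longrightarrow> C t x > 0"
    using d(2) by (auto simp: B_def)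
  define Ct where "Ct = partial_t C"
  have Ct: "((\<lambda>t. C t x) has_real_derivative Ct t x) (at t)" if "t \<in> T" "x \<in> I" for t x
    using times_diff2_partials(1)[OF oW td_C, of t x] that by (simp add: Ct_def)
  have cC: "continuous_on (B \<times> {a..b}) (\<lambda>(t,x). C t x)" and cCt: "continuous_on (B \<times> {a..b}) (\<lambda>(t,x). Ct t x)"
    using continuous_on_subset[OF times_diff2_continuous[OF td_C] sub]
      continuous_on_subset[OF times_diff2_continuous[OF times_diff2_partials(3)[OF oW td_C]] sub]
    by (auto simp: Ct_def)
  define L' where "L' t x = 1/4 * C t x powr (1/4 - 1) * Ct t x" for t x
  have cL: "continuous_on (B \<times> {a..b}) (\<lambda>(t,x). C t x powr (1/4))"
    using cC Cp by (force simp: case_prod_beta intro!: continuous_intros)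
  have cL': "continuous_on (B \<times> {a..b}) (\<lambda>(t,x). L' t x)"
    unfolding L'_def using cC cCt Cp by (force simp: case_prod_beta intro!: continuous_intros)
  have slice: "continuous_on {a..b} (h t)" if "t \<in> B" "continuous_on (B \<times> {a..b}) (\<lambda>(t,x). h t x)"
    for t and h :: "real \<Rightarrow> real \<Rightarrow> real"
  proof -
    have "continuous_on {a..b} (\<lambda>x. (\<lambda>(t,x). h t x) (t, x))"
      by (rule continuous_on_compose2[OF that(2)]) (use that in \<open>auto intro!: continuous_intros\<close>)
    then show ?thesis by simp
  qed
  have "((\<lambda>t. integral (cbox a b) (\<lambda>x. C t x powr (1/4))) has_field_derivative integral (cbox a b) (L' 0)) (at 0 within B)"
  proof (rule leibniz_rule_field_derivative)
    show "((\<lambda>t. C t x powr (1/4)) has_field_derivative L' t x) (at t within B)"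
      if "t \<in> B" "x \<in> cbox a b" for t x
    proof -
      have "(t,x) \<in> B \<times> {a..b}" using that by simp
      then have tx: "t \<in> T" "x \<in> I" "C t x > 0" using subsetD[OF sub] Cp by auto
      show ?thesis using DERIV_fun_powr[OF Ct[OF tx(1,2)] tx(3), of "1/4"]
        unfolding L'_def by (auto intro: has_field_derivative_at_within)
    qed
    show "(\<lambda>x. C t x powr (1/4)) integrable_on cbox a b" if "t \<in> B" for t
      using integrable_continuous_interval[OF slice[OF that cL]] by simp
    show "continuous_on (B \<times> cbox a b) (\<lambda>(x, t). L' x t)" using cL' by simp
  qed (use B in auto)
  then have lz: "((\<lambda>t. integral {a..b} (\<lambda>x. C t x powr (1/4))) has_field_derivative integral {a..b} (L' 0)) (at 0)"
    using at_within_open[OF B(3,1)] by simp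
  have der: "((\<lambda>t. integral {a..b} (\<lambda>x. arclen n I (ft t) x)) has_field_derivative integral {a..b} (L' 0)) (at 0)"
  proof (rule DERIV_transform_open[OF B(1,3) _ lz])
    fix t assume "t \<in> B"
    then show "integral {a..b} (\<lambda>x. C t x powr (1/4)) = integral {a..b} (\<lambda>x. arclen n I (ft t) x)"
      by (intro integral_cong) (use arclen_C sub in \<open>auto simp: subset_iff\<close>)
  qed
  \<comment> \<open>The exact part: the derivative of \<open>bdry Mj\<close>, which vanishes at both
    ends.\<close>
  define \<beta> where "\<beta> x = \<sigma> x * lagr Mj x - \<sigma> x * bil n (w0 Mj x) (EL \<sigma> \<mu> e2 en x)" for x
  have bd: "(\<beta> has_integral 0) {a..b}"
  proof -
    have "(\<beta> has_integral (bdry Mj b - bdry Mj a)) {a..b}"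
    proof (rule fundamental_theorem_of_calculus[OF ab(2)])
      fix x assume x: "x \<in> {a..b}"
      have "(bdry Mj has_real_derivative \<beta> x) (at x)"
        unfolding \<beta>_def 
        by (rule bdry_DERIV[where Y = Mj, OF _ M_jet w_perp]) (use x ab in auto)
      then show "(bdry Mj has_vector_derivative \<beta> x) (at x within {a..b})"
        using has_real_derivative_iff_has_vector_derivative has_field_derivative_at_within by blast
    qed
    then show ?thesis by (simp add: bdry_ends)
  qed
  have eq: "L' 0 x = 1/2 * \<sigma> x * bil n (w0 Mj x) (EL \<sigma> \<mu> e2 en x) + 1/2 * \<beta> x" if "x \<in> {a..b}" for x
  proof -
    have x: "x \<in> U" "x \<in> I" using that ab UI by auto
    have s: "\<sigma> x > 0" using pos[OF x(1)] .
    have "Ct 0 x = \<sigma> x ^ 4 * (2 * lagr Mj x)"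
      by (rule DERIV_unique[OF Ct[OF T0 x(2)] C_t[OF x(1)]])
    \<comment> \<open>The power -3/4 of \<sigma>^4 is \<sigma>^-3, so a single \<sigma> remains and
      the constants 1/4 and 2 combine to 1/2.\<close>
    moreover have "C 0 x powr (1/4 - 1) * \<sigma> x ^ 4 = \<sigma> x"
    proof -
      have "\<sigma> x ^ 4 = \<sigma> x powr 4" using powr_realpow[OF s, of 4] by simp
      then have "C 0 x powr (1/4 - 1) * \<sigma> x ^ 4 = \<sigma> x powr (4 * (1/4 - 1)) * \<sigma> x powr 4"
        by (simp add: C_0[OF x(1)] powr_powr)
      also have "\<dots> = \<sigma> x powr 1" by (simp only: powr_add[symmetric]) simp
      finally show ?thesis using s by simp
    qed
    ultimately have "L' 0 x = 1/4 * \<sigma> x * (2 * lagr Mj x)"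
      unfolding L'_def by (metis (no_types, lifting) mult.assoc)
    then show ?thesis unfolding \<beta>_def by (simp add: algebra_simps)
  qed
  have "(L' 0 has_integral integral {a..b} (L' 0)) {a..b}"
    using integrable_continuous_interval[OF slice[OF B(3) cL']] by (rule integrable_integral)
  then have "((\<lambda>x. L' 0 x - 1/2 * \<beta> x) has_integral integral {a..b} (L' 0) - 1/2 * 0) {a..b}"
    by (intro has_integral_diff has_integral_mult_right bd)
  then have "((\<lambda>x. 1/2 * \<sigma> x * bil n (w0 Mj x) (EL \<sigma> \<mu> e2 en x)) has_integral integral {a..b} (L' 0)) {a..b}"
    by (subst has_integral_cong[where g = "\<lambda>x. L' 0 x - 1/2 * \<beta> x"]) (use eq in auto)
  then have i: "integral {a..b} (\<lambda>x. 1/2 * \<sigma> x * bil n (w0 Mj x) (EL \<sigma> \<mu> e2 en x)) = integral {a..b} (L' 0)"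
    by (rule integral_unique)
  show ?thesis unfolding i by (rule der)
qed

end

subsection \<open>Conformal geodesics\<close>

lemma vderiv_cong: "open V \<Longrightarrow> x \<in> V \<Longrightarrow> (\<And>y. y \<in> V \<Longrightarrow> u y = v y) \<Longrightarrow> vderiv u x = vderiv v x"
  unfolding vderiv_def
  by (intro ext deriv_cong_ev) (auto simp: eventually_nhds)

lemma EL_cong:
  assumes V: "open V" "x \<in> V" and eq: "\<And>y. y \<in> V \<Longrightarrow> \<sigma> y = \<sigma>' y" "\<And>y. y \<in> V \<Longrightarrow> \<mu> y = \<mu>' y"
    "\<And>y. y \<in> V \<Longrightarrow> e2 y = e2' y" "\<And>y. y \<in> V \<Longrightarrow> en y = en' y"
  shows "EL \<sigma> \<mu> e2 en x = EL \<sigma>' \<mu>' e2' en' x"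
proof -
  have D: "dop \<sigma> u y = dop \<sigma>' u' y" if "\<And>z. z \<in> V \<Longrightarrow> u z = u' z" "y \<in> V" for u u' y
    using vderiv_cong[OF V(1) that(2,1)] eq(1)[OF that(2)] by (simp add: dop_def)
  have "deriv \<mu> x = deriv \<mu>' x"
    by (rule deriv_cong_ev) (use V eq in \<open>auto simp: eventually_nhds\<close>)
  moreover have "dop \<sigma> (dop \<sigma> (dop \<sigma> e2)) x = dop \<sigma>' (dop \<sigma>' (dop \<sigma>' e2')) x"
    by (intro D eq(3) V(2))
  moreover have "dop \<sigma> e2 x = dop \<sigma>' e2' x" by (intro D eq(3) V(2))
  ultimately show ?thesis using eq V(2) by (simp add: EL_def)
qed

lemma smooth_curv4:
  assumes U: "open U" and s: "vsmooth U u" "vsmooth U v" "vsmooth U w" "vsmooth U z"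
    and nz: "\<And>x. x \<in> U \<Longrightarrow> bil n (v x) (v x) \<noteq> 0"
  shows "smooth_on_R U (\<lambda>x. curv4 n (u x) (v x) (w x) (z x))"
proof -
  have "smooth_on_R U (\<lambda>x. gram4 n (u x) (v x) (w x) (z x))"
    unfolding gram4_def sym_det4_def by (intro smooth_diff smooth_add smooth_mult smooth_bil U s)
  then show ?thesis unfolding curv4_def
    by (intro smooth_divide smooth_minus smooth_power smooth_bil U s) (use nz in auto)
qed

lemma special_moving_frame:
  assumes n: "n \<ge> 3" and I: "open I" "immersion n I f" and st: "special_third_order_frame n I f U e"
  shows "moving_frame n U (\<lambda>y. col (e y) 0) (\<lambda>y. col (e y) 1) (\<lambda>y. col (e y) 2) (\<lambda>y. col (e y) (n+1))
    (phi n e 1 0) (mu1 n e)"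
proof -
  have so: "second_order_frame n I f U e" using st by (simp add: special_third_order_frame_def)
  note U = second_orderD(1)[OF so] and sM = second_orderD(2)[OF so]
  note g = isom_col[OF smooth_Mob_iso[OF sM]]
  note V = special_vder[OF n I st]
  show ?thesis
  proof
    show "bil n (col (e x) 0) (col (e x) 0) = 0" "bil n (col (e x) 0) (col (e x) 1) = 0"
      "bil n (col (e x) 0) (col (e x) (n+1)) = -1" "bil n (col (e x) 0) (col (e x) 2) = 0"
      "bil n (col (e x) 1) (col (e x) 1) = 1" "bil n (col (e x) 1) (col (e x) (n+1)) = 0"
      "bil n (col (e x) 1) (col (e x) 2) = 0" "bil n (col (e x) (n+1)) (col (e x) (n+1)) = 0"
      "bil n (col (e x) (n+1)) (col (e x) 2) = 0" "bil n (col (e x) 2) (col (e x) 2) = 1" if "x \<in> U" for x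
      using n g[OF that, of 0 0] g[OF that, of 0 1] g[OF that, of 0 "n+1"] g[OF that, of 0 2]
        g[OF that, of 1 1] g[OF that, of 1 "n+1"] g[OF that, of 1 2] g[OF that, of "n+1" "n+1"]
        g[OF that, of "n+1" 2] g[OF that, of 2 2] by (auto simp: Jm_simps)
  qed (use U sM V special_smooth[OF n I st] special_pos[OF n I st] smooth_Mob_col[OF sM]
      isom_vsupp[OF smooth_Mob_iso[OF sM]] in blast)+
qed

text \<open>Taking \<sigma> to be the arclength density, positive by 1-genericity, makes the
  canonical columns of the lift a \<open>moving_frame\<close> on all of I. Near each point they are
  completed to a special frame, where the hypothesis leaves E a multiple of e_0, and the velocity of
  a null lift is orthogonal to e_0.\<close>

lemma EL_geodesic:
  assumes n: "n \<ge> 3" and I: "open I" and og: "one_generic n I f"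
    and EL: "\<And>U e x. special_third_order_frame n I f U e \<Longrightarrow> x \<in> U \<Longrightarrow>
          dds n e (mu1 n e) x + 3/2 * dds n e (normX2 n e) x = 0 \<and>
          (\<forall>c\<in>{3..n}. nabla2X n e c x - qX n e c x * (normX2 n e x + 2 * mu1 n e x) = 0)"
  shows "conformal_geodesic n I f"
  unfolding conformal_geodesic_def
proof (intro conjI og allI impI, elim conjE)
  fix a b \<epsilon> ft assume ab: "a \<le> b" "{a..b} \<subseteq> I" and adm: "admissible_variation n I f {a..b} \<epsilon> ft"
  have n2: "n \<ge> 2" using n by simp
  have imm: "immersion n I f" using og by (simp add: one_generic_def)
  define N where "N = (\<lambda>y. nlift n (f y))"
  have im: "vsmooth I N" "\<And>y. y \<in> I \<Longrightarrow> nullvec n (N y)" "\<And>y. y \<in> I \<Longrightarrow> proj (N y) = f y"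
    "\<And>y. y \<in> I \<Longrightarrow> N y 0 + N y (n+1) = 1" "\<And>y. y \<in> I \<Longrightarrow> bil n (vderiv N y) (vderiv N y) > 0"
    unfolding N_def by (fact immersion_nlift[OF I imm])+
  define \<sigma> where "\<sigma> = (\<lambda>x. lift_curv n f x powr (1/4))"
  have lc: "lift_curv n f x > 0" if "x \<in> I" for x by (rule one_generic_lift_curv[OF n2 I og that])
  have slc: "smooth_on_R I (lift_curv n f)"
  proof -
    have "smooth_on_R I (\<lambda>x. curv4 n (N x) (vderiv N x) (vderiv (vderiv N) x) (vderiv (vderiv (vderiv N)) x))"
      by (intro smooth_curv4 vsmooth_vderiv I im) (use im(5) in force)
    then show ?thesis by (simp add: lift_curv_def[abs_def] Let_def N_def)
  qed
  have s\<sigma>: "smooth_on_R I \<sigma>" unfolding \<sigma>_def by (intro smooth_powr I slc lc)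
  have \<sigma>p: "\<sigma> x > 0" if "x \<in> I" for x using lc[OF that] by (simp add: \<sigma>_def)
  have \<sigma>4: "\<sigma> x ^ 4 = lift_curv n f x" if "x \<in> I" for x
    using lc[OF that] powr_realpow[of "\<sigma> x" 4] \<sigma>p[OF that] by (simp add: \<sigma>_def powr_powr)
  obtain c0 c1 c2 cn \<mu> l where nc: "null_columns n I c0 c1 c2 cn \<sigma> \<mu>"
    and lp: "\<And>y. y \<in> I \<Longrightarrow> l y > 0" and c0: "c0 = (\<lambda>y i. l y * N y i)"
    and cv: "\<And>y. y \<in> I \<Longrightarrow> curv4 n (N y) (vderiv N y) (vderiv (vderiv N) y) (vderiv (vderiv (vderiv N)) y)
        = \<sigma> y ^ 4 * bil n (c2 y) (c2 y)"
    using null_lift_columns[OF I im(1,2,5) s\<sigma> \<sigma>p] by blast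
  have g22: "bil n (c2 y) (c2 y) = 1" if "y \<in> I" for y
    using cv[OF that] \<sigma>4[OF that] lc[OF that] by (simp add: lift_curv_def Let_def N_def)
  have pf: "proj (c0 x) = f x" if "x \<in> I" for x
    unfolding c0 using lp[OF that] im(3)[OF that] by (simp add: proj_scale)
  interpret arclength_variation n I c0 c1 c2 cn \<sigma> \<mu> I f a b \<epsilon> ft
    using nc g22 n2 I ab adm pf
    by (simp add: arclength_variation_def arclength_variation_axioms_def moving_frame_def moving_frame_axioms_def)
  have "bil n (w0 Mj x) (EL \<sigma> \<mu> c2 cn x) = 0" if "x \<in> {a..b}" for x
  proof -
    have x: "x \<in> I" using that ab by blast
    have "c0 x 0 + c0 x (n+1) = l x" unfolding c0 using im(4)[OF x] by (simp flip: distrib_left)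
    then have ps: "c0 x 0 + c0 x (n+1) > 0" using lp[OF x] by simp
    obtain V e where V: "open V" "x \<in> V" "V \<subseteq> I" "smooth_Mob n V e"
      and c: "\<And>x. x \<in> V \<Longrightarrow> col (e x) 0 = c0 x" "\<And>x. x \<in> V \<Longrightarrow> col (e x) 1 = c1 x"
        "\<And>x. x \<in> V \<Longrightarrow> col (e x) (n+1) = cn x" "\<And>x. x \<in> V \<Longrightarrow> col (e x) 2 = c2 x"
      using frame_with_columns4[OF n x ps] by blast
    have st: "special_third_order_frame n I f V e" and p10: "\<And>x. x \<in> V \<Longrightarrow> phi n e 1 0 x = \<sigma> x"
      and m1: "\<And>x. x \<in> V \<Longrightarrow> mu1 n e x = \<mu> x"
      using columns_special[OF n2 V(1,3,3,4) c, of f] V(3) pf by (auto simp: subset_iff)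
    have "EL \<sigma> \<mu> c2 cn x = EL (phi n e 1 0) (mu1 n e) (\<lambda>y. col (e y) 2) (\<lambda>y. col (e y) (n+1)) x"
      by (rule EL_cong[OF V(1,2)]) (use p10 m1 c in auto)
    also have "\<dots> = (\<lambda>i. (normX2 n e x + mu1 n e x) * c0 x i)"
      unfolding special_EL[OF n I imm st V(2)] using EL[OF st V(2)] c(1)[OF V(2)] by simp
    finally show ?thesis using w_perp[OF x] by (simp add: bil_simps)
  qed
  then have "integral {a..b} (\<lambda>x. 1/2 * \<sigma> x * bil n (w0 Mj x) (EL \<sigma> \<mu> c2 cn x)) = integral {a..b} (\<lambda>x. 0)"
    by (intro integral_cong) auto
  then show "((\<lambda>t. integral {a..b} (\<lambda>x. arclen n I (ft t) x)) has_real_derivative 0) (at 0)"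
    using first_variation by simp
qed

section \<open>Test variations and the converse direction\<close>

lemma smooth_on_R2_quadratic:
  assumes U: "open U" and s: "smooth_on_R U \<alpha>" "smooth_on_R U \<beta>" "smooth_on_R U \<gamma>"
  shows "smooth_on_R2 (T \<times> U) (\<lambda>t x. \<alpha> x + t * \<beta> x + t\<^sup>2 * \<gamma> x)"
proof -
  have D: "((deriv ^^ j) g has_real_derivative (deriv ^^ Suc j) g x) (at x)"
    if "smooth_on_R U g" "x \<in> U" for g j x
  proof -
    have "smooth_on_R U ((deriv ^^ j) g)" by (induction j) (use that U smooth_deriv in auto)
    from smooth_DERIV[OF U this that(2)] show ?thesis by simp
  qed
  have C: "continuous_on (T \<times> U) (\<lambda>p. (deriv ^^ j) g (snd p))" if "smooth_on_R U g" for g j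
  proof (rule continuous_on_compose2[of U "(deriv ^^ j) g" _ snd])
    show "continuous_on U ((deriv ^^ j) g)"
      using D[OF that] by (meson DERIV_continuous continuous_at_imp_continuous_on)
  qed (auto intro: continuous_intros)
  define A where "A = (\<lambda>j x. (deriv ^^ j) \<alpha> x)"
  define B where "B = (\<lambda>j x. (deriv ^^ j) \<beta> x)"
  define G where "G = (\<lambda>j x. (deriv ^^ j) \<gamma> x)"
  have DA: "(A j has_real_derivative A (Suc j) x) (at x)" "(B j has_real_derivative B (Suc j) x) (at x)"
    "(G j has_real_derivative G (Suc j) x) (at x)" if "x \<in> U" for j x
    using D[OF s(1) that] D[OF s(2) that] D[OF s(3) that] unfolding A_def B_def G_def by auto
  have CA: "continuous_on (T \<times> U) (\<lambda>p. A j (snd p))" "continuous_on (T \<times> U) (\<lambda>p. B j (snd p))"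
    "continuous_on (T \<times> U) (\<lambda>p. G j (snd p))" for j
    unfolding A_def B_def G_def by (intro C s)+
  define E :: "nat \<Rightarrow> nat \<Rightarrow> real \<Rightarrow> real \<Rightarrow> real" where
    "E = (\<lambda>i j t x. if i = 0 then A j x + t * B j x + t\<^sup>2 * G j x
        else if i = 1 then B j x + 2 * t * G j x else if i = 2 then 2 * G j x else 0)"
  have 1: "\<forall>(t,x)\<in>T \<times> U. E 0 0 t x = \<alpha> x + t * \<beta> x + t\<^sup>2 * \<gamma> x"
    by (simp add: E_def A_def B_def G_def)
  have 2: "continuous_on (T \<times> U) (\<lambda>(t,x). E i j t x)" for i j
    unfolding E_def case_prod_beta
    by (cases "i = 0"; cases "i = 1"; cases "i = 2") (auto intro!: continuous_intros CA)
  have 3: "\<forall>(t,x)\<in>T \<times> U. ((\<lambda>s. E i j s x) has_real_derivative E (Suc i) j t x) (at t) \<and>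
          ((\<lambda>y. E i j t y) has_real_derivative E i (Suc j) t x) (at x)" for i j
  proof -
    have "((\<lambda>s. E i j s x) has_real_derivative E (Suc i) j t x) (at t) \<and>
          ((\<lambda>y. E i j t y) has_real_derivative E i (Suc j) t x) (at x)" if x: "x \<in> U" for t x
    proof -
      note d = DA[OF x]
      consider "i = 0" | "i = 1" | "i = 2" | "i \<ge> 3" by linarith
      then show ?thesis
        by cases (auto simp: E_def intro!: derivative_eq_intros d)
    qed
    then show ?thesis by auto
  qed
  show ?thesis unfolding smooth_on_R2_def using 1 2 3 by blast
qed

text \<open>The fundamental lemma of the calculus of variations: if the e_\<beta> component of E
  were nonzero at \<open>x0\<close>, pushing the curve along e_\<beta> near \<open>x0\<close> would
  change its length to first order. Most of the work is to make an admissible variation of all of f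
  out of this push.\<close>

lemma geodesic_EL_column:
  assumes n: "n \<ge> 3" and I: "open I" and cg: "conformal_geodesic n I f"
    and st: "special_third_order_frame n I f U e" and x0: "x0 \<in> U" and \<beta>: "\<beta> \<in> {2..n}"
  shows "bil n (col (e x0) \<beta>) (EL (phi n e 1 0) (mu1 n e) (\<lambda>y. col (e y) 2) (\<lambda>y. col (e y) (n+1)) x0) = 0"
proof (rule ccontr)
  assume contra: "\<not> ?thesis"
  have imm: "immersion n I f" using cg by (simp add: conformal_geodesic_def one_generic_def)
  have n2: "n \<ge> 2" using n by simp
  have so: "second_order_frame n I f U e" using st by (simp add: special_third_order_frame_def)
  note U = second_orderD(1)[OF so] and sM = second_orderD(2)[OF so] and UI = second_orderD(3)[OF so]
    and pf = second_orderD(4)[OF so]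
  define \<sigma> where "\<sigma> = phi n e 1 0"
  define \<mu> where "\<mu> = mu1 n e"
  define e0 where "e0 = (\<lambda>y. col (e y) 0)"
  define eb where "eb = (\<lambda>y. col (e y) \<beta>)"
  define e2 where "e2 = (\<lambda>y. col (e y) 2)"
  define en where "en = (\<lambda>y. col (e y) (n+1))"
  interpret moving_frame n U e0 "\<lambda>y. col (e y) 1" e2 en \<sigma> \<mu>
    unfolding e0_def e2_def en_def \<sigma>_def \<mu>_def by (rule special_moving_frame[OF n I imm st])
  have iso: "isom n (e x)" if "x \<in> U" for x by (rule smooth_Mob_iso[OF sM that])
  have J: "bil n (e0 x) (eb x) = 0" "bil n (en x) (eb x) = 0" "bil n (eb x) (eb x) = 1" if "x \<in> U" for x
    using isom_col[OF iso[OF that], of 0 \<beta>] isom_col[OF iso[OF that], of "n+1" \<beta>]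
      isom_col[OF iso[OF that], of \<beta> \<beta>] \<beta> by (auto simp: e0_def en_def eb_def Jm_simps)
  have sb: "vsmooth U eb" unfolding eb_def by (rule smooth_Mob_col[OF sM])
  have nz: "\<sigma> x \<noteq> 0" if "x \<in> U" for x using pos[OF that] by simp
  define F where "F = (\<lambda>x. bil n (eb x) (EL \<sigma> \<mu> e2 en x))"
  have sEL: "vsmooth U (EL \<sigma> \<mu> e2 en)"
  proof -
    have "smooth_on_R U (\<lambda>x. deriv \<mu> x / \<sigma> x)" by (intro smooth_intros oU sm nz)
    moreover have "smooth_on_R U (\<lambda>x. 2 * \<mu> x)" by (intro smooth_intros oU sm)
    ultimately show ?thesis unfolding EL_def[abs_def]
      by (intro vsmooth_add vsmooth_diff vsmooth_scale vsmooth_dop oU sm nz)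
  qed
  have cF: "continuous_on U F" unfolding F_def
    by (intro smooth_continuous smooth_bil oU sb sEL)
  have F0: "F x0 \<noteq> 0" using contra unfolding F_def eb_def e2_def en_def \<sigma>_def \<mu>_def .
  \<comment> \<open>Velocities of two lifts of the same variation differ by multiples of
    \<open>e0\<close>; pairing with E does not see the difference.\<close>
  have e0EL: "bil n (e0 x) (EL \<sigma> \<mu> e2 en x) = 0" if "x \<in> U" for x
  proof -
    have sub: "{3..n} \<subseteq> {1..n}" by auto
    have "bil n (e0 x) (\<lambda>i. \<Sum>c=3..n. (nabla2X n e c x - qX n e c x * (normX2 n e x + 2 * mu1 n e x)) * col (e x) c i) = 0"
      using isom_col_sum(1)[OF iso[OF that] sub, of 0] by (simp add: e0_def)
    then show ?thesis
      using special_EL[OF n I imm st that] g(1,4)[OF that]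
      unfolding \<sigma>_def[symmetric] \<mu>_def[symmetric] e2_def[symmetric] en_def[symmetric]
      by (simp only: bil_add_right bil_diff_right bil_scale_right) (simp add: e0_def e2_def \<mu>_def)
  qed
  define s where "s = sgn (F x0)"
  have "open {x \<in> U. s * F x > 0}"
    by (rule open_positive_set[OF U]) (intro continuous_intros cF)
  moreover have "x0 \<in> {x \<in> U. s * F x > 0}" using x0 F0 by (auto simp: s_def sgn_if)
  ultimately obtain r where r: "r > 0" "cball x0 r \<subseteq> {x \<in> U. s * F x > 0}"
    using open_contains_cball by blast
  \<comment> \<open>Half the radius for the bump, so that [a',b'] can be the compact set K in the
    interior of [a,b].\<close>
  define a b a' b' where "a = x0 - r" and "b = x0 + r" and "a' = x0 - r/2" and "b' = x0 + r/2"
  have ab: "{a..b} = cball x0 r" by (auto simp: a_def b_def cball_def dist_real_def)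
  have abU: "{a..b} \<subseteq> U" and Fp: "\<And>x. x \<in> {a..b} \<Longrightarrow> s * F x > 0" using r(2) unfolding ab by auto
  have K: "{a'..b'} \<subseteq> interior {a..b}" "{a'..b'} \<subseteq> U" "a < b"
    using r(1) abU by (auto simp: a_def b_def a'_def b'_def interior_atLeastAtMost_real)
  obtain h where h: "smooth_on_R UNIV h" "\<And>x. h x \<ge> 0" "\<And>x. h x > 0 \<longleftrightarrow> a' < x \<and> x < b'"
    "\<And>x. h x \<noteq> 0 \<Longrightarrow> x \<in> {a'..b'}" using smooth_bump[of a' b'] by blast
  have sh: "smooth_on_R U h" using smooth_subset[OF h(1)] by simp
  define B where "B = (\<lambda>y i. h y * eb y i)"
  define \<Gamma> where "\<Gamma> = (\<lambda>y i. (1/2 * h y * h y) * en y i)"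
  have sB: "vsmooth U B" unfolding B_def by (intro vsmooth_scale oU sh sb)
  have s\<Gamma>: "vsmooth U \<Gamma>" unfolding \<Gamma>_def by (intro vsmooth_scale smooth_mult smooth_const oU sh sm)
  \<comment> \<open>The quadratic term keeps the lift null: <e_0, e_{n+1}> = -1, so twice its
    product with \<open>e0\<close> is -t^2 h^2, which cancels the norm of the linear term.\<close>
  define G where "G = (\<lambda>t y i. e0 y i + t * B y i + t\<^sup>2 * \<Gamma> y i)"
  have G_out: "G t y = e0 y" if "y \<notin> {a'..b'}" for t y
  proof -
    have "h y = 0" using h(4)[of y] that by blast
    then show ?thesis by (simp add: G_def B_def \<Gamma>_def)
  qed
  have G0: "G 0 y = e0 y" for y by (simp add: G_def)
  have G_bil: "bil n (G t y) (G t y) = 0" "bil n (G t y) (en y) = -1" if "y \<in> U" for t y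
  proof -
    have B: "bil n (e0 y) (B y) = 0" "bil n (B y) (B y) = (h y)\<^sup>2" "bil n (en y) (B y) = 0"
      using J[OF that] by (simp_all add: B_def bil_simps power2_eq_square)
    have \<Gamma>: "bil n (e0 y) (\<Gamma> y) = - 1/2 * (h y)\<^sup>2" "bil n (B y) (\<Gamma> y) = 0" "bil n (\<Gamma> y) (\<Gamma> y) = 0" "bil n (\<Gamma> y) (en y) = 0"
      using J[OF that] g(3,8)[OF that] B(3)
      by (simp_all add: \<Gamma>_def bil_simps power2_eq_square bil_commute[of n "B y" "en y"])
    show "bil n (G t y) (G t y) = 0"
      using B \<Gamma> g(1)[OF that] unfolding G_def
      by (simp add: bil_simps bil_commute[of n "B y" "e0 y"] bil_commute[of n "\<Gamma> y" "e0 y"]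
          bil_commute[of n "\<Gamma> y" "B y"] power2_eq_square)
    show "bil n (G t y) (en y) = -1"
      using B \<Gamma> g(3)[OF that] unfolding G_def by (simp add: bil_simps bil_commute[of n "B y" "en y"])
  qed
  have G_null: "nullvec n (G t y)" if "y \<in> U" for t y
  proof -
    have "vsupp n (G t y)"
      using isom_vsupp[OF iso[OF that]] unfolding G_def B_def \<Gamma>_def e0_def eb_def en_def
      by (simp add: vsupp_def)
    moreover have "G t y \<noteq> (\<lambda>i. 0)" using G_bil(2)[OF that, of t] by (auto simp: bil_zero_left)
    ultimately show ?thesis using G_bil(1)[OF that] by (simp add: nullvec_def)
  qed
  have sG: "vsmooth U (G t)" for t
    unfolding G_def by (intro vsmooth_add vsmooth_scale smooth_const oU sm sB s\<Gamma>)
  have sG2: "smooth_on_R2 (T \<times> U) (\<lambda>t y. G t y i)" for T i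
    unfolding G_def using sm(1) sB s\<Gamma> by (intro smooth_on_R2_quadratic oU) (auto simp: vsmooth_def)
  define dG where "dG = (\<lambda>t y i. vderiv e0 y i + t * vderiv B y i + t\<^sup>2 * vderiv \<Gamma> y i)"
  have dG: "vder (G t) (dG t y) y" if "y \<in> U" for t y
  proof -
    have "vder (\<lambda>y i. e0 y i + t * B y i + t\<^sup>2 * \<Gamma> y i)
      (\<lambda>i. vderiv e0 y i + (0 * B y i + t * vderiv B y i) + (0 * \<Gamma> y i + t\<^sup>2 * vderiv \<Gamma> y i)) y"
      by (intro vder_add vder_scale DERIV_const vsmooth_vder[OF oU] sm sB s\<Gamma> that)
    then show ?thesis by (simp add: G_def dG_def)
  qed
  have cont: "continuous_on (UNIV \<times> U) (\<lambda>(t,y). bil n (dG t y) (dG t y))"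
  proof -
    have c: "continuous_on (UNIV \<times> U) (\<lambda>p. vderiv w (snd p) i)" if "vsmooth U w" for w i
    proof (rule continuous_on_compose2[of U "\<lambda>y. vderiv w y i" _ snd])
      show "continuous_on U (\<lambda>y. vderiv w y i)"
        using smooth_continuous[OF oU] vsmooth_vderiv[OF oU that] by (simp add: vsmooth_def)
    qed (auto intro: continuous_intros)
    show ?thesis unfolding bil_def dG_def case_prod_beta
      by (intro continuous_intros c sm sB s\<Gamma>)
  qed
  have dG_out: "bil n (dG t y) (dG t y) > 0" if y: "y \<in> U" and out: "t = 0 \<or> y \<notin> {a'..b'}" for t y
  proof -
    have "dG t y = (\<lambda>i. \<sigma> y * col (e y) 1 i)"
    proof (cases "t = 0")
      case True
      then show ?thesis using vder_imp_vderiv[OF d0[OF y]] by (simp add: dG_def)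
    next
      case False
      have o: "open (U - {a'..b'})" using oU by (simp add: open_Diff)
      have "vder (G t) (\<lambda>i. \<sigma> y * col (e y) 1 i) y"
        by (rule vder_transform[OF o _ _ d0[OF y]]) (use G_out y out False in auto)
      then show ?thesis using vder_unique[OF dG[OF y]] by blast
    qed
    then show ?thesis using g(5)[OF y] pos[OF y] by (simp add: bil_simps)
  qed
  \<comment> \<open>One \<epsilon> has to keep every curve immersed: compactness provides it on
    [a',b'], and elsewhere the lift is still \<open>e0\<close>, of speed \<sigma>.\<close>
  obtain \<epsilon> where \<epsilon>: "\<epsilon> > 0" "\<And>t x. \<bar>t\<bar> < \<epsilon> \<Longrightarrow> x \<in> {a'..b'} \<Longrightarrow> bil n (dG t x) (dG t x) > 0"
  proof (rule positive_near_slice[OF _ cont, of "{a'..b'}"])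
    show "open (UNIV \<times> U)" using oU by (simp add: open_Times)
    show "\<And>x. x \<in> {a'..b'} \<Longrightarrow> bil n (dG 0 x) (dG 0 x) > 0" using dG_out K(2) by blast
  qed (use K(2) in auto)
  have dG_pos: "bil n (dG t y) (dG t y) > 0" if "\<bar>t\<bar> < \<epsilon>" "y \<in> U" for t y
    using \<epsilon>(2)[OF that(1), of y] dG_out[OF that(2), of t] by blast
  define ft where "ft = (\<lambda>t x. if x \<in> U then proj (G t x) else f x)"
  have pe: "proj (e0 x) = f x" if "x \<in> U" for x using pf[OF that] by (simp add: e0_def)
  have ft_out: "ft t x = f x" if "x \<notin> {a'..b'}" for t x using G_out[OF that] pe by (simp add: ft_def)
  \<comment> \<open>At points outside \<open>U\<close> no frame is available and the variation is f
    itself; the neighbourhood of such a point is shrunk to avoid the support of the bump.\<close>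
  have lift: "\<exists>V F. open V \<and> x \<in> V \<and> V \<subseteq> I \<and> V \<inter> {a'..b'} = {} \<and> vsmooth V F \<and>
      (\<forall>y\<in>V. nullvec n (F y) \<and> proj (F y) = f y \<and> (\<forall>c. vderiv F y \<noteq> (\<lambda>i. c * F y i)))"
    if x: "x \<in> I" "x \<notin> U" for x
  proof -
    from immersion_local_lift[OF imm x(1)] obtain V F where V: "open V" "x \<in> V" "V \<subseteq> I" "vsmooth V F"
      "\<forall>y\<in>V. nullvec n (F y) \<and> proj (F y) = f y \<and> (\<forall>c. vderiv F y \<noteq> (\<lambda>i. c * F y i))" by blast
    show ?thesis
    proof (intro exI[of _ "V - {a'..b'}"] exI[of _ F] conjI)
      show "open (V - {a'..b'})" using V(1) by (simp add: open_Diff)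
      show "x \<in> V - {a'..b'}" using V(2) x(2) K(2) by blast
      show "V - {a'..b'} \<subseteq> I" using V(3) by blast
      show "vsmooth (V - {a'..b'}) F" by (rule vsmooth_subset[OF V(4)]) blast
      show "\<forall>y\<in>V - {a'..b'}. nullvec n (F y) \<and> proj (F y) = f y \<and> (\<forall>c. vderiv F y \<noteq> (\<lambda>i. c * F y i))"
        using V(5) by blast
    qed blast
  qed
  have adm: "admissible_variation n I f {a..b} \<epsilon> ft"
    unfolding admissible_variation_def
  proof (intro conjI ballI)
    show "\<epsilon> > 0" by (rule \<epsilon>(1))
    show "\<exists>W G. open W \<and> p \<in> W \<and> W \<subseteq> {-\<epsilon><..<\<epsilon>} \<times> I \<and> (\<forall>i. smooth_on_R2 W (\<lambda>t y. G t y i)) \<and>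
        (\<forall>(t,y)\<in>W. nullvec n (G t y) \<and> proj (G t y) = ft t y)" if p: "p \<in> {-\<epsilon><..<\<epsilon>} \<times> I" for p
    proof (cases "snd p \<in> U")
      case True
      have "open ({-\<epsilon><..<\<epsilon>} \<times> U)" by (rule open_Times[OF _ oU]) simp
      moreover have "p \<in> {-\<epsilon><..<\<epsilon>} \<times> U" using True p by (simp add: mem_Times_iff)
      moreover have "{-\<epsilon><..<\<epsilon>} \<times> U \<subseteq> {-\<epsilon><..<\<epsilon>} \<times> I" by (intro Sigma_mono order_refl UI)
      moreover have "\<forall>(t,y)\<in>{-\<epsilon><..<\<epsilon>} \<times> U. nullvec n (G t y) \<and> proj (G t y) = ft t y"
        using G_null by (simp add: ft_def)
      moreover have "\<forall>i. smooth_on_R2 ({-\<epsilon><..<\<epsilon>} \<times> U) (\<lambda>t y. G t y i)" using sG2 by (rule allI)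
      ultimately show ?thesis by (intro exI[of _ "{-\<epsilon><..<\<epsilon>} \<times> U"] exI[of _ G]) (simp only: simp_thms)
    next
      case False
      have "snd p \<in> I" using p by (simp add: mem_Times_iff)
      from lift[OF this False] obtain V F where V: "open V" "snd p \<in> V" "V \<subseteq> I" "V \<inter> {a'..b'} = {}" "vsmooth V F"
        "\<forall>y\<in>V. nullvec n (F y) \<and> proj (F y) = f y" by blast
      have "smooth_on_R2 ({-\<epsilon><..<\<epsilon>} \<times> V) (\<lambda>t y. F y i)" for i
        using smooth_on_R2_quadratic[OF V(1) _ smooth_const[OF V(1)] smooth_const[OF V(1)], of "\<lambda>y. F y i" _ 0 0] V(5)
        by (simp add: vsmooth_def)
      moreover have "ft t y = f y" if "y \<in> V" for t y using ft_out[of y t] V(4) that by blast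
      ultimately show ?thesis
        using V p by (intro exI[of _ "{-\<epsilon><..<\<epsilon>} \<times> V"] exI[of _ "\<lambda>t. F"])
          (simp add: open_Times mem_Times_iff Sigma_mono[OF order_refl V(3)])
    qed
    show "immersion n I (ft t)" if t: "t \<in> {-\<epsilon><..<\<epsilon>}" for t
      unfolding immersion_def
    proof
      fix x assume x: "x \<in> I"
      have "\<exists>V F. open V \<and> x \<in> V \<and> V \<subseteq> I \<and> vsmooth V F \<and>
          (\<forall>y\<in>V. nullvec n (F y) \<and> proj (F y) = ft t y \<and> (\<forall>c. vderiv F y \<noteq> (\<lambda>i. c * F y i)))"
      proof (cases "x \<in> U")
        case True
        have "vderiv (G t) y \<noteq> (\<lambda>i. c * G t y i)" if y: "y \<in> U" for y c
        proof
          assume "vderiv (G t) y = (\<lambda>i. c * G t y i)"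
          then have "bil n (dG t y) (dG t y) = 0"
            using vder_imp_vderiv[OF dG[OF y]] G_bil(1)[OF y] by (simp add: bil_simps)
          moreover have "\<bar>t\<bar> < \<epsilon>" using t by auto
          ultimately show False using dG_pos[OF _ y, of t] by simp
        qed
        then show ?thesis using True UI oU sG[of t] G_null
          by (intro exI[of _ U] exI[of _ "G t"]) (simp add: ft_def)
      next
        case False
        from lift[OF x False] obtain V F where V: "open V" "x \<in> V" "V \<subseteq> I" "V \<inter> {a'..b'} = {}" "vsmooth V F"
          "\<forall>y\<in>V. nullvec n (F y) \<and> proj (F y) = f y \<and> (\<forall>c. vderiv F y \<noteq> (\<lambda>i. c * F y i))" by blast
        have "ft t y = f y" if "y \<in> V" for y using ft_out[of y t] V(4) that by blast
        then show ?thesis using V by (intro exI[of _ V] exI[of _ F]) simp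
      qed
      then show "\<exists>U F. open U \<and> x \<in> U \<and> U \<subseteq> I \<and> (\<forall>i. smooth_on_R U (\<lambda>y. F y i)) \<and>
          (\<forall>y\<in>U. nullvec n (F y) \<and> proj (F y) = ft t y \<and> (\<forall>c. (\<lambda>i. deriv (\<lambda>z. F z i) y) \<noteq> (\<lambda>i. c * F y i)))"
        unfolding vsmooth_def vderiv_def .
    qed
    show "ft 0 x = f x" for x using G0 pe by (simp add: ft_def)
    show "\<exists>K. compact K \<and> K \<subseteq> interior {a..b} \<and> (\<forall>t\<in>{-\<epsilon><..<\<epsilon>}. \<forall>x\<in>I - K. ft t x = f x)"
      using K(1) ft_out by (intro exI[of _ "{a'..b'}"]) auto
  qed
  interpret arclength_variation n U e0 "\<lambda>y. col (e y) 1" e2 en \<sigma> \<mu> I f a b \<epsilon> ft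
    by unfold_locales (use n2 I UI abU K(3) adm pe in auto)
  have w0M: "bil n (w0 Mj x) (EL \<sigma> \<mu> e2 en x) = h x * F x" if x: "x \<in> U" for x
  proof -
    have xI: "x \<in> I" using x UI by blast
    define k where "k = (\<lambda>v :: nat \<Rightarrow> real. v 0 + v (n+1))"
    have kn: "k (e0 x) \<noteq> 0" using kap(1)[OF x] by (simp add: k_def kap_def)
    have DG: "((\<lambda>t. G t x i) has_real_derivative B x i) (at 0)" for i
      unfolding G_def by (auto intro!: derivative_eq_intros)
    then have Dk: "((\<lambda>t. k (G t x)) has_real_derivative k (B x)) (at 0)"
      unfolding k_def by (intro DERIV_add)
    have "((\<lambda>t. G t x i / k (G t x)) has_real_derivative
        (B x i * k (e0 x) - e0 x i * k (B x)) / (k (e0 x) * k (e0 x))) (at 0)" for i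
      using DERIV_divide[OF DG Dk] kn by (simp add: G0)
    moreover have "G t x i / k (G t x) = X 0 t x i" for t i
    proof -
      have "ft t x = proj (G t x)" using x by (simp add: ft_def)
      then show ?thesis unfolding X_0 using nlift_proj[OF G_null[OF x]] by (simp add: k_def)
    qed
    ultimately have M0: "M 0 0 x i = (B x i * k (e0 x) - e0 x i * k (B x)) / (k (e0 x) * k (e0 x))" for i
      using DERIV_unique[OF X_t[OF T0 xI]] by simp
    have "kap x = k (e0 x)" by (simp add: kap_def k_def)
    \<comment> \<open>The quotient rule for the normalisation of G: rescaling the lift changes the
      velocity \<open>B\<close> only by a multiple of \<open>e0\<close>.\<close>
    then have "w0 Mj x = (\<lambda>i. B x i - (k (B x) / k (e0 x)) * e0 x i)"
      using kn unfolding w0_def M0 by (auto simp: field_simps)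
    then show ?thesis using e0EL[OF x] by (simp add: bil_simps B_def F_def)
  qed
  have "((\<lambda>t. integral {a..b} (\<lambda>x. arclen n I (ft t) x)) has_real_derivative 0) (at 0)"
    using cg abU UI K(3) adm unfolding conformal_geodesic_def by (meson less_imp_le order_trans)
  from DERIV_unique[OF first_variation this]
  have "integral {a..b} (\<lambda>x. 1/2 * \<sigma> x * bil n (w0 Mj x) (EL \<sigma> \<mu> e2 en x)) = 0" .
  moreover have "integral {a..b} (\<lambda>x. 1/2 * \<sigma> x * bil n (w0 Mj x) (EL \<sigma> \<mu> e2 en x)) = integral {a..b} (\<lambda>x. 1/2 * \<sigma> x * (h x * F x))"
    by (rule integral_cong) (use w0M abU in auto)
  ultimately have "integral {a..b} (\<lambda>x. s * (1/2 * \<sigma> x * (h x * F x))) = 0" by simp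
  moreover have "continuous_on {a..b} (\<lambda>x. s * (1/2 * \<sigma> x * (h x * F x)))"
  proof -
    have "continuous_on U \<sigma>" "continuous_on U h" using smooth_continuous[OF oU] sm sh by auto
    then show ?thesis using continuous_on_subset[OF _ abU] cF by (intro continuous_intros) auto
  qed
  moreover have "s * (1/2 * \<sigma> x * (h x * F x)) \<ge> 0" if "x \<in> {a..b}" for x
  proof -
    have eq: "s * (1/2 * \<sigma> x * (h x * F x)) = (1/2 * \<sigma> x * h x) * (s * F x)" by simp
    have "\<sigma> x > 0" using pos that abU by blast
    then show ?thesis unfolding eq using h(2)[of x] Fp[OF that]
      by (intro mult_nonneg_nonneg[of "1/2 * \<sigma> x * h x" "s * F x"]) auto
  qed
  moreover have x0ab: "x0 \<in> {a..b}" using r(1) by (simp add: a_def b_def)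
  ultimately have "s * (1/2 * \<sigma> x0 * (h x0 * F x0)) = 0"
    using integral_eq_0_iff[of a b "\<lambda>x. s * (1/2 * \<sigma> x * (h x * F x))"] K(3) by blast
  moreover have "h x0 > 0" using h(3) r(1) by (simp add: a'_def b'_def)
  moreover have "s * F x0 > 0" by (rule Fp[OF x0ab])
  ultimately show False using pos[OF x0] by auto
qed

theorem mainTheorem5:
  fixes n :: nat and I :: "real set" and f :: "real \<Rightarrow> (nat \<Rightarrow> real) set"
  assumes "n \<ge> 3"
    and "open I" and "is_interval I" and "I \<noteq> {}"
    and "one_generic n I f"
  shows "conformal_geodesic n I f \<longleftrightarrow>
    (\<forall>U e. special_third_order_frame n I f U e \<longrightarrow>
       (\<forall>x\<in>U.
          dds n e (mu1 n e) x + 3/2 * dds n e (normX2 n e) x = 0 \<and>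
          (\<forall>c\<in>{3..n}. nabla2X n e c x - qX n e c x * (normX2 n e x + 2 * mu1 n e x) = 0)))"
proof
  assume "\<forall>U e. special_third_order_frame n I f U e \<longrightarrow>
       (\<forall>x\<in>U.
          dds n e (mu1 n e) x + 3/2 * dds n e (normX2 n e) x = 0 \<and>
          (\<forall>c\<in>{3..n}. nabla2X n e c x - qX n e c x * (normX2 n e x + 2 * mu1 n e x) = 0))"
  then show "conformal_geodesic n I f" by (intro EL_geodesic[OF assms(1,2,5)]) blast
next
  assume cg: "conformal_geodesic n I f"
  have imm: "immersion n I f" using assms(5) by (simp add: one_generic_def)
  show "\<forall>U e. special_third_order_frame n I f U e \<longrightarrow>
       (\<forall>x\<in>U.
          dds n e (mu1 n e) x + 3/2 * dds n e (normX2 n e) x = 0 \<and>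
          (\<forall>c\<in>{3..n}. nabla2X n e c x - qX n e c x * (normX2 n e x + 2 * mu1 n e x) = 0))"
  proof (intro allI impI ballI)
    fix U e x assume st: "special_third_order_frame n I f U e" and x: "x \<in> U"
    have "second_order_frame n I f U e" using st by (simp add: special_third_order_frame_def)
    then have iso: "isom n (e x)" using smooth_Mob_iso[OF second_orderD(2)] x by blast
    define P where "P = normX2 n e x + mu1 n e x"
    define Q where "Q = dds n e (mu1 n e) x + 3/2 * dds n e (normX2 n e) x"
    define R where "R c = nabla2X n e c x - qX n e c x * (normX2 n e x + 2 * mu1 n e x)" for c
    have sub: "{3..n} \<subseteq> {1..n}" by auto
    \<comment> \<open>For 2 <= \<beta> <= n column \<beta> is orthogonal to column 0, so
      \<open>P\<close> drops out; \<beta> = 2 isolates \<open>Q\<close>, and \<beta> = c >= 3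
      isolates \<open>R c\<close>.\<close>
    have z: "P * bil n (col (e x) \<beta>) (col (e x) 0) + Q * bil n (col (e x) \<beta>) (col (e x) 2)
        - (if \<beta> \<in> {3..n} then R \<beta> else 0) = 0" if b: "\<beta> \<in> {2..n}" for \<beta>
    proof -
      have "bil n (col (e x) \<beta>) (\<lambda>i. P * col (e x) 0 i + Q * col (e x) 2 i - (\<Sum>c=3..n. R c * col (e x) c i)) = 0"
        using geodesic_EL_column[OF assms(1,2) cg st x b] special_EL[OF assms(1,2) imm st x]
        unfolding P_def Q_def R_def by simp
      moreover have "\<beta> < n + 2" using b by simp
      ultimately show ?thesis
        unfolding bil_diff_right bil_add_right bil_scale_right using isom_col_sum(1)[OF iso sub, of \<beta> R] by simp
    qed
    have "Q = 0"
      using z[of 2] isom_col[OF iso, of 2 0] isom_col[OF iso, of 2 2] assms(1) by (simp add: Jm_simps)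
    moreover have "R c = 0" if "c \<in> {3..n}" for c
      using z[of c] isom_col[OF iso, of c 0] isom_col[OF iso, of c 2] that by (auto simp: Jm_simps)
    ultimately show "dds n e (mu1 n e) x + 3/2 * dds n e (normX2 n e) x = 0 \<and>
          (\<forall>c\<in>{3..n}. nabla2X n e c x - qX n e c x * (normX2 n e x + 2 * mu1 n e x) = 0)"
      unfolding Q_def R_def by blast
  qed
qed

end
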